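(* Let $H$ be a Hopf algebra over a field $\Bbbk$ with the dual Chevalley property. Then $H$ is a projective generator of left as well as right $H_{(1)}$-modules. (Here $H_{(1)}$ is a Hopf subalgebra of $H$, acting on $H$ by multiplication.)
   Context: The coradical $H_0$ of a coalgebra $H$ is the sum of all its simple subcoalgebras. A Hopf algebra $H$ (possibly infinite-dimensional) has the dual Chevalley property if $H_0$ is a Hopf subalgebra of $H$. For subspaces $X,Y$ of a coalgebra $H$, $X\wedge Y=\Delta^{-1}(X\otimes H+H\otimes Y)$. Simple subcoalgebras $C,D$ of $H$ are directly linked in $H$ if $C+D\subsetneq C\wedge D+D\wedge C$. They are linked in $H$ if there are $n\in\mathbb{N}$ (with $n=0$ allowed) and simple subcoalgebras $E_0,\dots,E_n$ with $C=E_0$, $D=E_n$ and $E_i,E_{i+1}$ directly linked in $H$ for $0\le i<n$; this is an equivalence relation. A subcoalgebra $H'\subseteq H$ is link-indecomposable if any two simple subcoalgebras of $H'$ are linked in $H'$; a link-indecomposable component of $H$ is a maximal link-indecomposable subcoalgebra. $H_{(1)}$ denotes the link-indecomposable component of $H$ containing the unit element $1$; under the dual Chevalley property it is a Hopf subalgebra of $H$. *)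

theory Defs
  imports Complex_Main "HOL-Library.Poly_Mapping"
begin

section \<open>Tensor powers of a vector space\<close>

text \<open>
  The tensor square of a vector space \<open>H\<close> with scalar multiplication \<open>scale\<close> is the free vector
  space on \<open>H \<times> H\<close> modulo the bilinearity relations, and the tensor cube is treated alike. The
  quotients themselves depend on \<open>scale\<close> and hence are not types, so we calculate with
  representatives, i.e. finitely supported functions \<open>'h \<times> 'h \<Rightarrow>\<^sub>0 'k\<close> (formal linear combinations
  of pairs), and replace equality in the tensor product by congruence modulo the span of the
  relations.
\<close>

definition pscale :: "'k::field \<Rightarrow> ('x \<Rightarrow>\<^sub>0 'k) \<Rightarrow> ('x \<Rightarrow>\<^sub>0 'k)" where
  "pscale c p = Poly_Mapping.map (\<lambda>d. c * d) p"

lemma lookup_pscale [simp]: "Poly_Mapping.lookup (pscale c p) x = c * Poly_Mapping.lookup p x"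
  by (simp add: pscale_def Poly_Mapping.map.rep_eq when_def)

lemma vector_space_pscale: "vector_space pscale"
  by unfold_locales (auto intro!: poly_mapping_eqI simp: lookup_add algebra_simps)

definition gen :: "'x \<Rightarrow> ('x \<Rightarrow>\<^sub>0 'k::field)" where
  "gen x = Poly_Mapping.single x 1"

text \<open>The linear extension of \<open>f\<close> from the basis of a free vector space.\<close>

definition lin_ext :: "('k::field \<Rightarrow> 'v \<Rightarrow> 'v::ab_group_add) \<Rightarrow> ('x \<Rightarrow> 'v) \<Rightarrow> ('x \<Rightarrow>\<^sub>0 'k) \<Rightarrow> 'v" where
  "lin_ext s f p = (\<Sum>x\<in>Poly_Mapping.keys p. s (Poly_Mapping.lookup p x) (f x))"

definition tensor2_rel :: "('k::field \<Rightarrow> 'h \<Rightarrow> 'h::ab_group_add) \<Rightarrow> ('h \<times> 'h \<Rightarrow>\<^sub>0 'k) set" where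
  "tensor2_rel scale =
     {gen (a + a', b) - gen (a, b) - gen (a', b) | a a' b. True}
   \<union> {gen (a, b + b') - gen (a, b) - gen (a, b') | a b b'. True}
   \<union> {gen (scale c a, b) - pscale c (gen (a, b)) | c a b. True}
   \<union> {gen (a, scale c b) - pscale c (gen (a, b)) | c a b. True}"

definition tensor3_rel :: "('k::field \<Rightarrow> 'h \<Rightarrow> 'h::ab_group_add) \<Rightarrow> ('h \<times> 'h \<times> 'h \<Rightarrow>\<^sub>0 'k) set" where
  "tensor3_rel scale =
     {gen (a + a', b, d) - gen (a, b, d) - gen (a', b, d) | a a' b d. True}
   \<union> {gen (a, b + b', d) - gen (a, b, d) - gen (a, b', d) | a b b' d. True}
   \<union> {gen (a, b, d + d') - gen (a, b, d) - gen (a, b, d') | a b d d'. True}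
   \<union> {gen (scale c a, b, d) - pscale c (gen (a, b, d)) | c a b d. True}
   \<union> {gen (a, scale c b, d) - pscale c (gen (a, b, d)) | c a b d. True}
   \<union> {gen (a, b, scale c d) - pscale c (gen (a, b, d)) | c a b d. True}"

definition tensor2_eq ::
    "('k::field \<Rightarrow> 'h \<Rightarrow> 'h::ab_group_add) \<Rightarrow> ('h \<times> 'h \<Rightarrow>\<^sub>0 'k) \<Rightarrow> ('h \<times> 'h \<Rightarrow>\<^sub>0 'k) \<Rightarrow> bool" where
  "tensor2_eq scale p q \<longleftrightarrow> p - q \<in> module.span pscale (tensor2_rel scale)"

definition tensor3_eq ::
    "('k::field \<Rightarrow> 'h \<Rightarrow> 'h::ab_group_add) \<Rightarrow> ('h \<times> 'h \<times> 'h \<Rightarrow>\<^sub>0 'k) \<Rightarrow> ('h \<times> 'h \<times> 'h \<Rightarrow>\<^sub>0 'k) \<Rightarrow> bool" where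
  "tensor3_eq scale p q \<longleftrightarrow> p - q \<in> module.span pscale (tensor3_rel scale)"

text \<open>
  The representatives of the elements of the subspace of \<open>H \<otimes> H\<close> spanned by the \<open>a \<otimes> b\<close> with
  \<open>(a, b) \<in> A\<close>. Thus \<open>tensor2_sub scale (X \<times> Y)\<close> stands for \<open>X \<otimes> Y \<subseteq> H \<otimes> H\<close>.
\<close>

definition tensor2_sub ::
    "('k::field \<Rightarrow> 'h \<Rightarrow> 'h::ab_group_add) \<Rightarrow> ('h \<times> 'h) set \<Rightarrow> ('h \<times> 'h \<Rightarrow>\<^sub>0 'k) set" where
  "tensor2_sub scale A = module.span pscale (gen ` A \<union> tensor2_rel scale)"

definition tensor2_mult ::
    "('h \<times> 'h \<Rightarrow>\<^sub>0 'k::field) \<Rightarrow> ('h \<times> 'h \<Rightarrow>\<^sub>0 'k) \<Rightarrow> ('h::ring_1 \<times> 'h \<Rightarrow>\<^sub>0 'k)" where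
  "tensor2_mult p q =
     lin_ext pscale (\<lambda>(a, b). lin_ext pscale (\<lambda>(a', b'). gen (a * a', b * b')) q) p"

section \<open>Hopf algebras\<close>

text \<open>
  \<open>\<Delta> h\<close> is a representative of the comultiplication of \<open>h\<close>; the choice of representatives is
  arbitrary and nothing below depends on it.
\<close>

locale hopf_algebra = vector_space scale
  for scale :: "'k::field \<Rightarrow> 'h::ring_1 \<Rightarrow> 'h" +
  fixes \<Delta> :: "'h \<Rightarrow> ('h \<times> 'h \<Rightarrow>\<^sub>0 'k)"
    and \<epsilon> :: "'h \<Rightarrow> 'k"
    and S :: "'h \<Rightarrow> 'h"
  assumes scale_mult_left: "scale c x * y = scale c (x * y)"
    and scale_mult_right: "x * scale c y = scale c (x * y)"
    and comult_add: "tensor2_eq scale (\<Delta> (x + y)) (\<Delta> x + \<Delta> y)"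
    and comult_scale: "tensor2_eq scale (\<Delta> (scale c x)) (pscale c (\<Delta> x))"
    and counit_linear: "Vector_Spaces.linear scale (*) \<epsilon>"
    and coassoc:
      "tensor3_eq scale
         (lin_ext pscale (\<lambda>(a, b). lin_ext pscale (\<lambda>(a', a''). gen (a', a'', b)) (\<Delta> a)) (\<Delta> x))
         (lin_ext pscale (\<lambda>(a, b). lin_ext pscale (\<lambda>(b', b''). gen (a, b', b'')) (\<Delta> b)) (\<Delta> x))"
    and counit_left: "lin_ext scale (\<lambda>(a, b). scale (\<epsilon> a) b) (\<Delta> x) = x"
    and counit_right: "lin_ext scale (\<lambda>(a, b). scale (\<epsilon> b) a) (\<Delta> x) = x"
    and comult_one: "tensor2_eq scale (\<Delta> 1) (gen (1, 1))"
    and comult_mult: "tensor2_eq scale (\<Delta> (x * y)) (tensor2_mult (\<Delta> x) (\<Delta> y))"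
    and counit_one: "\<epsilon> 1 = 1"
    and counit_mult: "\<epsilon> (x * y) = \<epsilon> x * \<epsilon> y"
    and antipode_linear: "Vector_Spaces.linear scale scale S"
    and antipode_left: "lin_ext scale (\<lambda>(a, b). S a * b) (\<Delta> x) = scale (\<epsilon> x) 1"
    and antipode_right: "lin_ext scale (\<lambda>(a, b). a * S b) (\<Delta> x) = scale (\<epsilon> x) 1"

section \<open>Coradical and dual Chevalley property\<close>

definition subcoalgebra ::
    "('k::field \<Rightarrow> 'h \<Rightarrow> 'h::ab_group_add) \<Rightarrow> ('h \<Rightarrow> ('h \<times> 'h \<Rightarrow>\<^sub>0 'k)) \<Rightarrow> 'h set \<Rightarrow> bool" where
  "subcoalgebra scale \<Delta> C \<longleftrightarrow>
     module.subspace scale C \<and> (\<forall>c\<in>C. \<Delta> c \<in> tensor2_sub scale (C \<times> C))"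

definition simple_subcoalgebra ::
    "('k::field \<Rightarrow> 'h \<Rightarrow> 'h::ab_group_add) \<Rightarrow> ('h \<Rightarrow> ('h \<times> 'h \<Rightarrow>\<^sub>0 'k)) \<Rightarrow> 'h set \<Rightarrow> bool" where
  "simple_subcoalgebra scale \<Delta> C \<longleftrightarrow>
     subcoalgebra scale \<Delta> C \<and> C \<noteq> {0} \<and>
     (\<forall>D. subcoalgebra scale \<Delta> D \<and> D \<subseteq> C \<longrightarrow> D = {0} \<or> D = C)"

definition coradical ::
    "('k::field \<Rightarrow> 'h \<Rightarrow> 'h::ab_group_add) \<Rightarrow> ('h \<Rightarrow> ('h \<times> 'h \<Rightarrow>\<^sub>0 'k)) \<Rightarrow> 'h set" where
  "coradical scale \<Delta> = module.span scale (\<Union> {C. simple_subcoalgebra scale \<Delta> C})"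

definition hopf_subalgebra ::
    "('k::field \<Rightarrow> 'h \<Rightarrow> 'h::ring_1) \<Rightarrow> ('h \<Rightarrow> ('h \<times> 'h \<Rightarrow>\<^sub>0 'k)) \<Rightarrow> ('h \<Rightarrow> 'h) \<Rightarrow> 'h set \<Rightarrow> bool" where
  "hopf_subalgebra scale \<Delta> S K \<longleftrightarrow>
     subcoalgebra scale \<Delta> K \<and> 1 \<in> K \<and> (\<forall>x\<in>K. \<forall>y\<in>K. x * y \<in> K) \<and> (\<forall>x\<in>K. S x \<in> K)"

definition dual_Chevalley ::
    "('k::field \<Rightarrow> 'h \<Rightarrow> 'h::ring_1) \<Rightarrow> ('h \<Rightarrow> ('h \<times> 'h \<Rightarrow>\<^sub>0 'k)) \<Rightarrow> ('h \<Rightarrow> 'h) \<Rightarrow> bool" where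
  "dual_Chevalley scale \<Delta> S \<longleftrightarrow> hopf_subalgebra scale \<Delta> S (coradical scale \<Delta>)"

section \<open>Link-indecomposable components\<close>

definition subspace_sum :: "'h::ab_group_add set \<Rightarrow> 'h set \<Rightarrow> 'h set" where
  "subspace_sum X Y = {x + y | x y. x \<in> X \<and> y \<in> Y}"

text \<open>
  In the following definitions \<open>L\<close> is the coalgebra in which wedges and links are formed, a
  subcoalgebra of the ambient one. As \<open>L \<otimes> L\<close> embeds into \<open>H \<otimes> H\<close> over a field, the condition
  defining \<open>\<Delta>\<^sup>-\<^sup>1 (X \<otimes> L + L \<otimes> Y)\<close> can be evaluated in \<open>H \<otimes> H\<close>.
\<close>

definition wedge ::
    "('k::field \<Rightarrow> 'h \<Rightarrow> 'h::ab_group_add) \<Rightarrow> ('h \<Rightarrow> ('h \<times> 'h \<Rightarrow>\<^sub>0 'k)) \<Rightarrow> 'h set \<Rightarrow> 'h set \<Rightarrow> 'h set \<Rightarrow> 'h set" where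
  "wedge scale \<Delta> L X Y = {h \<in> L. \<Delta> h \<in> tensor2_sub scale (X \<times> L \<union> L \<times> Y)}"

definition directly_linked ::
    "('k::field \<Rightarrow> 'h \<Rightarrow> 'h::ab_group_add) \<Rightarrow> ('h \<Rightarrow> ('h \<times> 'h \<Rightarrow>\<^sub>0 'k)) \<Rightarrow> 'h set \<Rightarrow> 'h set \<Rightarrow> 'h set \<Rightarrow> bool" where
  "directly_linked scale \<Delta> L C D \<longleftrightarrow>
     subspace_sum C D \<subset> subspace_sum (wedge scale \<Delta> L C D) (wedge scale \<Delta> L D C)"

definition linked ::
    "('k::field \<Rightarrow> 'h \<Rightarrow> 'h::ab_group_add) \<Rightarrow> ('h \<Rightarrow> ('h \<times> 'h \<Rightarrow>\<^sub>0 'k)) \<Rightarrow> 'h set \<Rightarrow> 'h set \<Rightarrow> 'h set \<Rightarrow> bool" where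
  "linked scale \<Delta> L C D \<longleftrightarrow>
     (\<exists>(n::nat) E. E 0 = C \<and> E n = D \<and>
        (\<forall>i\<le>n. simple_subcoalgebra scale \<Delta> (E i) \<and> E i \<subseteq> L) \<and>
        (\<forall>i<n. directly_linked scale \<Delta> L (E i) (E (Suc i))))"

definition link_indecomposable ::
    "('k::field \<Rightarrow> 'h \<Rightarrow> 'h::ab_group_add) \<Rightarrow> ('h \<Rightarrow> ('h \<times> 'h \<Rightarrow>\<^sub>0 'k)) \<Rightarrow> 'h set \<Rightarrow> bool" where
  "link_indecomposable scale \<Delta> L \<longleftrightarrow>
     subcoalgebra scale \<Delta> L \<and>
     (\<forall>C D. simple_subcoalgebra scale \<Delta> C \<and> C \<subseteq> L \<and> simple_subcoalgebra scale \<Delta> D \<and> D \<subseteq> L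
        \<longrightarrow> linked scale \<Delta> L C D)"

definition link_component ::
    "('k::field \<Rightarrow> 'h \<Rightarrow> 'h::ab_group_add) \<Rightarrow> ('h \<Rightarrow> ('h \<times> 'h \<Rightarrow>\<^sub>0 'k)) \<Rightarrow> 'h set \<Rightarrow> bool" where
  "link_component scale \<Delta> L \<longleftrightarrow>
     link_indecomposable scale \<Delta> L \<and>
     (\<forall>L'. link_indecomposable scale \<Delta> L' \<and> L \<subseteq> L' \<longrightarrow> L' = L)"

definition unit_component ::
    "('k::field \<Rightarrow> 'h \<Rightarrow> 'h::ring_1) \<Rightarrow> ('h \<Rightarrow> ('h \<times> 'h \<Rightarrow>\<^sub>0 'k)) \<Rightarrow> 'h set" where
  "unit_component scale \<Delta> = (THE L. link_component scale \<Delta> L \<and> 1 \<in> L)"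

section \<open>Projective generators\<close>

text \<open>
  Modules over a (noncommutative) unital subring \<open>K\<close> of a ring. The multiplication of \<open>K\<close> is passed
  as the argument \<open>mul\<close>: right modules are left modules for \<open>\<lambda>a b. b * a\<close>. The carrier of a module
  is an arbitrary subgroup of a type of class \<open>ab_group_add\<close>.
\<close>

definition unital_subring :: "'r::ring_1 set \<Rightarrow> bool" where
  "unital_subring K \<longleftrightarrow> 1 \<in> K \<and> (\<forall>a\<in>K. \<forall>b\<in>K. a - b \<in> K \<and> a * b \<in> K)"

definition module_over ::
    "'r::ring_1 set \<Rightarrow> ('r \<Rightarrow> 'r \<Rightarrow> 'r) \<Rightarrow> ('r \<Rightarrow> 'm \<Rightarrow> 'm) \<Rightarrow> 'm::ab_group_add set \<Rightarrow> bool" where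
  "module_over K mul act M \<longleftrightarrow>
     unital_subring K \<and>
     0 \<in> M \<and> (\<forall>x\<in>M. \<forall>y\<in>M. x - y \<in> M) \<and>
     (\<forall>a\<in>K. \<forall>x\<in>M. act a x \<in> M) \<and>
     (\<forall>a\<in>K. \<forall>x\<in>M. \<forall>y\<in>M. act a (x + y) = act a x + act a y) \<and>
     (\<forall>a\<in>K. \<forall>b\<in>K. \<forall>x\<in>M. act (a + b) x = act a x + act b x) \<and>
     (\<forall>a\<in>K. \<forall>b\<in>K. \<forall>x\<in>M. act (mul a b) x = act a (act b x)) \<and>
     (\<forall>x\<in>M. act 1 x = x)"

definition module_hom ::
    "'r set \<Rightarrow> ('r \<Rightarrow> 'm \<Rightarrow> 'm) \<Rightarrow> 'm::ab_group_add set \<Rightarrow> ('r \<Rightarrow> 'n \<Rightarrow> 'n) \<Rightarrow> 'n::ab_group_add set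
      \<Rightarrow> ('m \<Rightarrow> 'n) \<Rightarrow> bool" where
  "module_hom K actM M actN N f \<longleftrightarrow>
     (\<forall>x\<in>M. f x \<in> N) \<and>
     (\<forall>x\<in>M. \<forall>y\<in>M. f (x + y) = f x + f y) \<and>
     (\<forall>a\<in>K. \<forall>x\<in>M. f (actM a x) = actN a (f x))"

text \<open>
  Quantification over all modules is rendered by the type arguments: \<open>P\<close> is a projective generator
  if the predicates below hold for all types \<open>'m\<close> and \<open>'n\<close>. Being a generator means that
  \<open>Hom(P, -)\<close> is faithful.
\<close>

definition projective_module ::
    "'m::ab_group_add itself \<Rightarrow> 'n::ab_group_add itself \<Rightarrow>
     'r::ring_1 set \<Rightarrow> ('r \<Rightarrow> 'r \<Rightarrow> 'r) \<Rightarrow> ('r \<Rightarrow> 'p \<Rightarrow> 'p) \<Rightarrow> 'p::ab_group_add set \<Rightarrow> bool" where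
  "projective_module TM TN K mul act P \<longleftrightarrow>
     module_over K mul act P \<and>
     (\<forall>actM (M :: 'm set) actN (N :: 'n set) g f.
        module_over K mul actM M \<and> module_over K mul actN N \<and>
        module_hom K actM M actN N g \<and> g ` M = N \<and> module_hom K act P actN N f
        \<longrightarrow> (\<exists>h. module_hom K act P actM M h \<and> (\<forall>x\<in>P. g (h x) = f x)))"

definition generator_module ::
    "'m::ab_group_add itself \<Rightarrow> 'n::ab_group_add itself \<Rightarrow>
     'r::ring_1 set \<Rightarrow> ('r \<Rightarrow> 'r \<Rightarrow> 'r) \<Rightarrow> ('r \<Rightarrow> 'p \<Rightarrow> 'p) \<Rightarrow> 'p::ab_group_add set \<Rightarrow> bool" where
  "generator_module TM TN K mul act P \<longleftrightarrow>
     module_over K mul act P \<and>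
     (\<forall>actM (M :: 'm set) actN (N :: 'n set) f g.
        module_over K mul actM M \<and> module_over K mul actN N \<and>
        module_hom K actM M actN N f \<and> module_hom K actM M actN N g \<and> (\<exists>x\<in>M. f x \<noteq> g x)
        \<longrightarrow> (\<exists>h. module_hom K act P actM M h \<and> (\<exists>x\<in>P. f (h x) \<noteq> g (h x))))"

definition projective_generator ::
    "'m::ab_group_add itself \<Rightarrow> 'n::ab_group_add itself \<Rightarrow>
     'r::ring_1 set \<Rightarrow> ('r \<Rightarrow> 'r \<Rightarrow> 'r) \<Rightarrow> ('r \<Rightarrow> 'p \<Rightarrow> 'p) \<Rightarrow> 'p::ab_group_add set \<Rightarrow> bool" where
  "projective_generator TM TN K mul act P \<longleftrightarrow>
     projective_module TM TN K mul act P \<and> generator_module TM TN K mul act P"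

end

theory Submission
  imports Defs
begin

text \<open>
  Over the dual algebra, a coalgebra is a locally finite bimodule and its subcoalgebras are the
  sub-bimodules. Lifting idempotents of the dual algebra shows that the coalgebra splits along every
  set \<open>\<A>\<close> of simple subcoalgebras that is closed under links: it is the direct sum of the largest
  subcoalgebra with all simple subcoalgebras in \<open>\<A>\<close> and of the one for the complement of \<open>\<A>\<close>.

  Let \<open>C\<close> and \<open>C'\<close> be linked and \<open>D\<close> simple. If no simple subcoalgebra of \<open>C' D\<close> were in the class of
  a simple \<open>E \<subseteq> C D\<close>, then projecting the product of \<open>C \<and> C'\<close> and \<open>D\<close> to the part of \<open>E\<close> and multiplying
  by the antipode of \<open>D\<close> would map \<open>C \<and> C'\<close> into the coradical, which is closed under products, and
  split the link. Hence multiplication by \<open>K = H\<^sub>(\<^sub>1\<^sub>)\<close> preserves all linkage classes. So \<open>K\<close> is a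
  subalgebra, the projection \<open>\<pi>: H \<rightarrow> K\<close> is a \<open>K\<close>-bimodule map, and \<open>K\<close> is a direct summand of \<open>H\<close>.

  For projectivity, put \<open>\<lambda> = \<epsilon> \<circ> \<pi>\<close>. The \<open>K\<close>-linear maps \<open>x \<mapsto> \<pi> (x S b)\<close> satisfy
  \<open>\<pi> (x S b\<^sub>1) b\<^sub>2 = x\<^sub>1 \<lambda> (x\<^sub>2 S b)\<close>, so they form a dual basis of \<open>K D\<close> once some \<open>b \<in> D\<close> has
  \<open>\<lambda> (d S b) = \<epsilon> d\<close> for all \<open>d \<in> D\<close>. Such a \<open>b\<close> exists because the \<open>K\<close>-part of the endomorphism algebra
  of the comodule \<open>D\<close> is a bimodule retract of it and thus von Neumann regular, and because
  \<open>S\<^sup>2 D = D\<close>. Adding up over the different blocks \<open>K D\<close> gives an endomorphism of \<open>H\<close> that is the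
  identity on the coradical, hence is invertible, and correcting by its inverse yields a dual basis
  of \<open>H\<close>.
\<close>

section \<open>Linear algebra\<close>

text \<open>Equations in \<open>H \<otimes> H\<close> are tested by evaluating bilinear maps, hence
  by pairs of linear forms, and subcoalgebras are handled through the dual algebra. So every
  argument stays inside H, although the tensor square is not a type.

  The delicate point is the element b. If K is spanned by the unit, \<lambda> restricts to the Haar
  integral on the coradical and pairs D with S D. For larger K the forms \<lambda>(_ S b) may fill
  only a small part of the dual of D: for D inside K they are just the multiples of \<epsilon>. A
  normalised trace is no way out, since dimensions can vanish in the field. But these forms are
  closed under convolution, so products of elements \<open>\<epsilon> - \<phi> c\<close> have the
  same shape, and one with extremal kernel can be chosen by finite dimension. Von Neumann regularity
  is what enlarges the kernel as long as it is not everything.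

  The bijectivity of \<open>S^2\<close> on D enters twice: to turn a factor d into S d', which makes
  the two halves of the link argument symmetric, and to pass from \<open>S^2 D\<close> back to D
  when b is constructed.\<close>

definition linmap :: "('k::field \<Rightarrow> 'a \<Rightarrow> 'a) \<Rightarrow> ('k \<Rightarrow> 'b \<Rightarrow> 'b) \<Rightarrow> ('a::ab_group_add \<Rightarrow> 'b::ab_group_add) \<Rightarrow> bool" where
  "linmap s t f \<longleftrightarrow> (\<forall>x y. f (x + y) = f x + f y) \<and> (\<forall>c x. f (s c x) = t c (f x))"

lemma linmapI: "(\<And>x y. f (x + y) = f x + f y) \<Longrightarrow> (\<And>c x. f (s c x) = t c (f x)) \<Longrightarrow> linmap s t f"
  by (auto simp: linmap_def)

lemma linmap_add: "linmap s t f \<Longrightarrow> f (x + y) = f x + f y"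
  and linmap_scale: "linmap s t f \<Longrightarrow> f (s c x) = t c (f x)"
  by (auto simp: linmap_def)

lemma linmap_0: "linmap s t f \<Longrightarrow> f 0 = 0"
  using linmap_add[of s t f 0 0] by simp

lemma linmap_diff: "linmap s t f \<Longrightarrow> f (x - y) = f x - f y"
  using linmap_add[of s t f "x - y" y] by (simp add: algebra_simps)

lemma linmap_sum: "linmap s t f \<Longrightarrow> f (sum g A) = (\<Sum>i\<in>A. f (g i))"
  by (induction A rule: infinite_finite_induct) (auto simp: linmap_0 linmap_add)

lemma linmap_sum_list: "linmap s t f \<Longrightarrow> f (sum_list (map g xs)) = (\<Sum>i\<leftarrow>xs. f (g i))"
  by (induction xs) (auto simp: linmap_0 linmap_add)

lemma linmap_compose: "linmap t u g \<Longrightarrow> linmap s t f \<Longrightarrow> linmap s u (\<lambda>x. g (f x))"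
  by (auto simp: linmap_def)

text \<open>Bridge to the library notion. \<open>linmap\<close> omits the vector space axioms, which
  keeps the composition rules free of side conditions.\<close>

lemma linmap_iff_linear: "vector_space s \<Longrightarrow> vector_space t \<Longrightarrow> linmap s t f \<longleftrightarrow> Vector_Spaces.linear s t f"
  by (auto simp: Vector_Spaces.linear_iff linmap_def)

lemma vector_space_times: "vector_space ((*) :: 'k::field \<Rightarrow> 'k \<Rightarrow> 'k)"
  by unfold_locales (auto simp: algebra_simps)

text \<open>A copy of \<^locale>\<open>vector_space\<close> without the global interpretation for real vector spaces, which would
  capture the names introduced below.\<close>

locale vspace = vector_space scale
  for scale :: "'a::field \<Rightarrow> 'b::ab_group_add \<Rightarrow> 'b"
begin

abbreviation linear_form :: "('b \<Rightarrow> 'a) \<Rightarrow> bool" where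
  "linear_form \<equiv> linmap scale (*)"

abbreviation linear_op :: "('b \<Rightarrow> 'b) \<Rightarrow> bool" where
  "linear_op \<equiv> linmap scale scale"

text \<open>A left inverse of the inclusion. Applied factorwise to tensors, such projections later
  take the place of adapted bases.\<close>

lemma projection_exists:
  assumes "subspace V"
  shows "\<exists>P. linear_op P \<and> range P \<subseteq> V \<and> (\<forall>x\<in>V. P x = x)"
proof -
  interpret vector_space_pair scale scale
    using vector_space_axioms by (simp add: vector_space_pair_def)
  have "Vector_Spaces.linear scale scale (\<lambda>x. x)"
    by (simp add: Vector_Spaces.linear_iff vector_space_axioms)
  from linear_exists_left_inverse_on[OF this assms] show ?thesis
    by (auto simp: inj_on_def Vector_Spaces.linear_iff linmap_def)
qed

lemma form_separates_subspace:
  assumes "subspace V" "x \<notin> V"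
  shows "\<exists>f. linear_form f \<and> (\<forall>v\<in>V. f v = 0) \<and> f x = 1"
proof -
  interpret vector_space_pair scale "(*) :: 'a \<Rightarrow> 'a \<Rightarrow> 'a"
    using vector_space_axioms vector_space_times by (simp add: vector_space_pair_def)
  obtain B where B: "B \<subseteq> V" "independent B" "V \<subseteq> span B" by (rule basis_exists)
  have spB: "span B \<subseteq> V" using B(1) assms(1) by (rule span_minimal)
  hence "independent (insert x B)" using B(2) assms(2) by (intro independent_insertI) auto
  from linear_independent_extend[OF this, of "\<lambda>y. if y = x then 1 else 0"]
  obtain g where g: "Vector_Spaces.linear scale (*) g" "\<And>y. y \<in> insert x B \<Longrightarrow> g y = (if y = x then 1 else 0)"
    by blast
  have lin: "linear_form g"
    using g(1) by (simp add: Vector_Spaces.linear_iff linmap_def)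
  have "g y = 0" if "y \<in> span B" for y
    using that
  proof (induction rule: span_induct_alt)
    case (step c b y)
    moreover from this assms(2) B(1) have "b \<noteq> x" by auto
    ultimately show ?case using g(2)[of b] by (simp add: linmap_add[OF lin] linmap_scale[OF lin])
  qed (simp add: linmap_0[OF lin])
  hence "\<forall>v\<in>V. g v = 0" using B(3) by blast
  moreover have "g x = 1" using g(2)[of x] by simp
  ultimately show ?thesis using lin by blast
qed

lemma forms_separate:
  assumes "\<And>f. linear_form f \<Longrightarrow> f x = f y"
  shows "x = y"
proof (rule ccontr)
  assume "x \<noteq> y"
  hence "x - y \<notin> {0}" by simp
  from form_separates_subspace[OF _ this] obtain f where "linear_form f" "f (x - y) = 1"
    by auto
  with assms[of f] show False by (simp add: linmap_diff)
qed

lemma in_subspaceI_forms: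
  assumes "subspace V" "\<And>f. linear_form f \<Longrightarrow> (\<forall>v\<in>V. f v = 0) \<Longrightarrow> f x = 0"
  shows "x \<in> V"
  using form_separates_subspace[OF assms(1), of x] assms(2) by fastforce

text \<open>With the counit for h, this yields forms that act as the identity on one subcoalgebra
  and as zero on another.\<close>

lemma form_on_direct_sum:
  assumes "subspace X" "subspace Y" "X \<inter> Y \<subseteq> {0}" "linear_form h"
  shows "\<exists>f. linear_form f \<and> (\<forall>x\<in>X. f x = h x) \<and> (\<forall>y\<in>Y. f y = 0)"
proof -
  interpret vector_space_pair scale scale
    using vector_space_axioms by (simp add: vector_space_pair_def)
  obtain Q where Q: "linear_op Q" "range Q \<subseteq> Y" "\<And>x. x \<in> Y \<Longrightarrow> Q x = x"
    using projection_exists[OF assms(2)] by blast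
  \<comment> \<open>\<open>x - Q x\<close> kills Y but stays injective on X, so a left inverse r
    recovers the component in X.\<close>
  have inj: "inj_on (\<lambda>x. x - Q x) X"
  proof (rule inj_onI)
    fix x y assume *: "x \<in> X" "y \<in> X" "x - Q x = y - Q y"
    hence "x - y = Q (x - y)" by (simp add: linmap_diff[OF Q(1)] algebra_simps)
    hence "x - y \<in> Y" using Q(2) by (metis rangeI subsetD)
    moreover have "x - y \<in> X" using * assms(1) subspace_diff by blast
    ultimately show "x = y" using assms(3) by auto
  qed
  have "Vector_Spaces.linear scale scale (\<lambda>x. x - Q x)"
    using Q(1) vector_space_axioms
    by (auto simp: Vector_Spaces.linear_iff linmap_def scale_right_diff_distrib)
  from linear_exists_left_inverse_on[OF this assms(1) inj]
  obtain r where r: "Vector_Spaces.linear scale scale r" "\<And>x. x \<in> X \<Longrightarrow> r (x - Q x) = x" by blast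
  have r': "linear_op r" using r(1) by (auto simp: Vector_Spaces.linear_iff linmap_def)
  have "linear_form (\<lambda>x. h (r (x - Q x)))"
  proof (rule linmapI)
    fix x y
    have "x + y - Q (x + y) = (x - Q x) + (y - Q y)" by (simp add: linmap_add[OF Q(1)])
    then show "h (r (x + y - Q (x + y))) = h (r (x - Q x)) + h (r (y - Q y))"
      by (simp only: linmap_add[OF r'] linmap_add[OF assms(4)])
  next
    fix c x
    have "scale c x - Q (scale c x) = scale c (x - Q x)"
      by (simp add: linmap_scale[OF Q(1)] scale_right_diff_distrib)
    then show "h (r (scale c x - Q (scale c x))) = c * h (r (x - Q x))"
      by (simp only: linmap_scale[OF r'] linmap_scale[OF assms(4)])
  qed
  moreover have "\<forall>x\<in>X. h (r (x - Q x)) = h x" using r(2) by auto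
  moreover have "\<forall>x\<in>Y. h (r (x - Q x)) = 0"
    using Q(3) by (auto simp: linmap_0[OF r'] linmap_0[OF assms(4)])
  ultimately show ?thesis by (intro exI[of _ "\<lambda>x. h (r (x - Q x))"]) blast
qed

section \<open>Finite-dimensional subspaces\<close>

definition fin_dim :: "'b set \<Rightarrow> bool" where
  "fin_dim X \<longleftrightarrow> (\<exists>F. finite F \<and> X \<subseteq> span F)"

lemma fin_dim_mono: "X \<subseteq> Y \<Longrightarrow> fin_dim Y \<Longrightarrow> fin_dim X"
  by (auto simp: fin_dim_def)

lemma fin_dim_basis:
  assumes "fin_dim X"
  shows "\<exists>B. B \<subseteq> X \<and> independent B \<and> X \<subseteq> span B \<and> finite B \<and> card B = dim X"
proof -
  obtain B where B: "B \<subseteq> X" "independent B" "X \<subseteq> span B" "card B = dim X" by (rule basis_exists)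
  from assms obtain F where "finite F" "X \<subseteq> span F" by (auto simp: fin_dim_def)
  with B independent_span_bound[of F B] have "finite B" by blast
  with B show ?thesis by blast
qed

lemma dim_le:
  assumes "X \<subseteq> Y" "fin_dim Y"
  shows "dim X \<le> dim Y"
proof -
  obtain B where "B \<subseteq> Y" "independent B" "Y \<subseteq> span B" "finite B" "card B = dim Y"
    using fin_dim_basis[OF assms(2)] by blast
  then show ?thesis using dim_le_card[of X B] assms(1) by auto
qed

lemma dim_less:
  assumes "subspace X" "X \<subset> Y" "fin_dim Y"
  shows "dim X < dim Y"
proof -
  have "fin_dim X" using assms fin_dim_mono by blast
  then obtain B where B: "B \<subseteq> X" "independent B" "X \<subseteq> span B" "finite B" "card B = dim X"
    using fin_dim_basis by blast
  from assms(2) obtain y where y: "y \<in> Y" "y \<notin> X" by blast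
  have "y \<notin> span B" using span_minimal[OF B(1) assms(1)] y by blast
  hence ind: "independent (insert y B)" using B(2) independent_insertI by blast
  obtain C where C: "C \<subseteq> Y" "independent C" "Y \<subseteq> span C" "finite C" "card C = dim Y"
    using fin_dim_basis[OF assms(3)] by blast
  have "insert y B \<subseteq> span C" using B(1) C(3) y assms(2) by blast
  from independent_span_bound[OF C(4) ind this] have "card (insert y B) \<le> dim Y" using C by simp
  moreover have "y \<notin> B" using B(1) y by blast
  ultimately show ?thesis using B by simp
qed

lemma subspace_eq_if_dim_le: "subspace X \<Longrightarrow> X \<subseteq> Y \<Longrightarrow> fin_dim Y \<Longrightarrow> dim Y \<le> dim X \<Longrightarrow> X = Y"
  using dim_less[of X Y] by fastforce

lemma fin_dim_image:
  assumes "linear_op f" "fin_dim X"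
  shows "fin_dim (f ` X)" "dim (f ` X) \<le> dim X"
proof -
  obtain B where B: "B \<subseteq> X" "independent B" "X \<subseteq> span B" "finite B" "card B = dim X"
    using fin_dim_basis[OF assms(2)] by blast
  have "f x \<in> span (f ` B)" if "x \<in> span B" for x
    using that
  proof (induction rule: span_induct_alt)
    case base then show ?case by (simp add: linmap_0[OF assms(1)] span_zero)
  next
    case (step c x y)
    then show ?case
      by (simp add: linmap_add[OF assms(1)] linmap_scale[OF assms(1)] span_add span_scale span_base)
  qed
  with B(3) have sub: "f ` X \<subseteq> span (f ` B)" by blast
  with B(4) show "fin_dim (f ` X)" by (auto simp: fin_dim_def)
  have "dim (f ` X) \<le> card (f ` B)" using sub B(4) by (intro dim_le_card) auto
  also have "\<dots> \<le> card B" using B(4) by (rule card_image_le)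
  finally show "dim (f ` X) \<le> dim X" using B(5) by simp
qed

lemma linmap_on_span_eq:
  assumes "linmap scale t f" "linmap scale t g" "\<And>x. x \<in> X \<Longrightarrow> f x = g x" "x \<in> span X"
  shows "f x = g x"
  using assms(4)
proof (induction rule: span_induct_alt)
  case base show ?case by (simp add: linmap_0[OF assms(1)] linmap_0[OF assms(2)])
next
  case (step c x y)
  then show ?case by (simp add: linmap_add[OF assms(1)] linmap_add[OF assms(2)]
        linmap_scale[OF assms(1)] linmap_scale[OF assms(2)] assms(3))
qed

lemma subspace_linear_image:
  assumes f: "linear_op f" and X: "subspace X"
  shows "subspace (f ` X)"
proof (rule subspaceI)
  show "0 \<in> f ` X" using linmap_0[OF f] subspace_0[OF X] by force
next
  fix x y assume "x \<in> f ` X" "y \<in> f ` X"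
  then obtain x' y' where "x' \<in> X" "y' \<in> X" "x = f x'" "y = f y'" by blast
  then show "x + y \<in> f ` X"
    using subspace_add[OF X] linmap_add[OF f, of x' y'] by (intro image_eqI[of _ _ "x' + y'"]) auto
next
  fix c x assume "x \<in> f ` X"
  then obtain x' where "x' \<in> X" "x = f x'" by blast
  then show "scale c x \<in> f ` X"
    using subspace_scale[OF X] linmap_scale[OF f, of c x'] by (intro image_eqI[of _ _ "scale c x'"]) auto
qed

lemma subspace_linear_vimage:
  assumes f: "linmap scale t f" and t: "vector_space t" and X: "module.subspace t X" and Y: "subspace Y"
  shows "subspace {x \<in> Y. f x \<in> X}"
proof -
  interpret t: vector_space t by fact
  show ?thesis
    by (rule subspaceI)
      (simp_all add: linmap_0[OF f] linmap_add[OF f] linmap_scale[OF f] subspace_0[OF Y] subspace_add[OF Y]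
        subspace_scale[OF Y] t.subspace_0[OF X] t.subspace_add[OF X] t.subspace_scale[OF X])
qed

text \<open>Finite-dimensional duality: a space of forms without common zero on X restricts onto the
  dual of X. The induction cuts X down to the kernel of one form f.\<close>

lemma separating_forms_exhaust:
  assumes sep: "\<And>x. x \<in> X \<Longrightarrow> (\<And>f. f \<in> \<F> \<Longrightarrow> f x = 0) \<Longrightarrow> x = 0"
    and lin: "\<And>f. f \<in> \<F> \<Longrightarrow> linear_form f"
    and add: "\<And>f g. f \<in> \<F> \<Longrightarrow> g \<in> \<F> \<Longrightarrow> (\<lambda>x. f x + g x) \<in> \<F>"
    and scale: "\<And>c f. f \<in> \<F> \<Longrightarrow> (\<lambda>x. c * f x) \<in> \<F>"
    and zero: "(\<lambda>x. 0) \<in> \<F>"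
    and X: "subspace X" "fin_dim X" and h: "linear_form h"
  shows "\<exists>f\<in>\<F>. \<forall>x\<in>X. f x = h x"
  using X(2,1) sep h
proof (induction "dim X" arbitrary: X h rule: less_induct)
  case less
  show ?case
  proof (cases "X = {0}")
    case True
    then show ?thesis using zero less.prems(4) linmap_0[OF less.prems(4)] by (intro bexI[of _ "\<lambda>x. 0"]) auto
  next
    case False
    then obtain v where v: "v \<in> X" "v \<noteq> 0" using less.prems(2) subspace_0 by blast
    then obtain f where f: "f \<in> \<F>" "f v \<noteq> 0" using less.prems(3)[of v] by blast
    note lf = lin[OF f(1)]
    define X' where "X' = {x \<in> X. f x = 0}"
    have sX': "subspace X'"
      using subspace_linear_vimage[OF lf vector_space_times _ less.prems(2), of "{0}"]
        module.subspace_single_0[OF module_iff_vector_space[THEN iffD2, OF vector_space_times]]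
      by (simp add: X'_def)
    have sub: "X' \<subset> X" using v f by (auto simp: X'_def)
    have d: "dim X' < dim X" by (rule dim_less[OF sX' sub less.prems(1)])
    have "\<exists>g\<in>\<F>. \<forall>x\<in>X'. g x = h x"
    proof (rule less.hyps[OF d fin_dim_mono[OF _ less.prems(1)] sX' _ less.prems(4)])
      show "X' \<subseteq> X" using sub by blast
    next
      fix x assume "x \<in> X'" "\<And>f. f \<in> \<F> \<Longrightarrow> f x = 0"
      with less.prems(3) sub show "x = 0" by blast
    qed
    then obtain g where g: "g \<in> \<F>" "\<And>x. x \<in> X' \<Longrightarrow> g x = h x" by blast
    note lg = lin[OF g(1)]
    \<comment> \<open>This makes \<open>g + c f\<close> agree with h at v, and v together with the
      kernel of f spans X.\<close>
    define c where "c = (h v - g v) / f v"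
    have "g x + c * f x = h x" if "x \<in> X" for x
    proof -
      define y where "y = x - scale (f x / f v) v"
      have "y \<in> X" using that v(1) less.prems(2) by (simp add: y_def subspace_diff subspace_scale)
      moreover have "f y = 0" using f(2) by (simp add: y_def linmap_diff[OF lf] linmap_scale[OF lf])
      ultimately have "y \<in> X'" by (simp add: X'_def)
      from g(2)[OF this] have *: "g x - f x / f v * g v = h x - f x / f v * h v"
        by (simp add: y_def linmap_diff[OF lg] linmap_scale[OF lg] linmap_diff[OF less.prems(4)]
            linmap_scale[OF less.prems(4)])
      have "c * f x = f x / f v * h v - f x / f v * g v"
        by (simp add: c_def right_diff_distrib diff_divide_distrib mult.commute)
      moreover have "p + (q - r) = (p - r) + q" for p q r :: 'a by simp
      ultimately have "g x + c * f x = (g x - f x / f v * g v) + f x / f v * h v" by metis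
      then show ?thesis unfolding * by simp
    qed
    moreover have "(\<lambda>x. g x + c * f x) \<in> \<F>" using add[OF g(1) scale[OF f(1)]] .
    ultimately show ?thesis by (intro bexI[of _ "\<lambda>x. g x + c * f x"] ballI)
  qed
qed

lemma maximal_subspace_exists:
  assumes "P X0" "\<And>X. P X \<Longrightarrow> subspace X \<and> X \<subseteq> L" "fin_dim L"
  shows "\<exists>X. P X \<and> (\<forall>Y. P Y \<longrightarrow> X \<subseteq> Y \<longrightarrow> Y = X)"
proof -
  have "\<forall>X. P X \<longrightarrow> dim X < Suc (dim L)" using assms(2,3) dim_le by (meson le_imp_less_Suc)
  from ex_has_greatest_nat[OF assms(1) this]
  obtain X where X: "P X" "\<And>Y. P Y \<Longrightarrow> dim Y \<le> dim X" by blast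
  have "Y = X" if "P Y" "X \<subseteq> Y" for Y
    using subspace_eq_if_dim_le[of X Y] X that assms(2)[of X] assms(2)[of Y] fin_dim_mono[of Y L] assms(3)
    by metis
  with X show ?thesis by blast
qed

lemma minimal_subspace_exists:
  assumes "P X0" "\<And>X. P X \<Longrightarrow> subspace X \<and> X \<subseteq> L" "fin_dim L"
  shows "\<exists>X. P X \<and> (\<forall>Y. P Y \<longrightarrow> Y \<subseteq> X \<longrightarrow> Y = X)"
proof -
  obtain X where X: "P X" "\<And>Y. P Y \<Longrightarrow> dim X \<le> dim Y"
    using ex_has_least_nat[of P X0 dim] assms(1) by blast
  have "Y = X" if "P Y" "Y \<subseteq> X" for Y
    using subspace_eq_if_dim_le[of Y X] X that assms(2)[of X] assms(2)[of Y] fin_dim_mono[of X L] assms(3)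
    by metis
  with X show ?thesis by blast
qed

lemma span_image_in:
  assumes f: "linear_op f" and V: "subspace V" and "\<And>x. x \<in> A \<Longrightarrow> f x \<in> V" and "x \<in> span A"
  shows "f x \<in> V"
  using assms(4)
proof (induction rule: span_induct_alt)
  case base
  show ?case by (simp add: linmap_0[OF f] subspace_0[OF V])
next
  case (step c x y)
  then show ?case
    by (simp add: linmap_add[OF f] linmap_scale[OF f] subspace_add[OF V] subspace_scale[OF V] assms(3))
qed

lemma subspace_sum_list: "subspace V \<Longrightarrow> (\<And>x. x \<in> set xs \<Longrightarrow> f x \<in> V) \<Longrightarrow> sum_list (map f xs) \<in> V"
  by (induction xs) (auto simp: subspace_0 subspace_add)

definition ann :: "'b set \<Rightarrow> ('b \<Rightarrow> 'a) set" where
  "ann X = {f. linear_form f \<and> (\<forall>x\<in>X. f x = 0)}"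

lemma ann_linear: "f \<in> ann X \<Longrightarrow> linear_form f"
  and annD: "f \<in> ann X \<Longrightarrow> x \<in> X \<Longrightarrow> f x = 0"
  and annI: "linear_form f \<Longrightarrow> (\<And>x. x \<in> X \<Longrightarrow> f x = 0) \<Longrightarrow> f \<in> ann X"
  and ann_mono: "X \<subseteq> Y \<Longrightarrow> ann Y \<subseteq> ann X"
  by (auto simp: ann_def)

lemma ann_span: "ann (span X) = ann X"
proof
  show "ann (span X) \<subseteq> ann X" by (rule ann_mono[OF span_superset])
next
  show "ann X \<subseteq> ann (span X)"
  proof
    fix f assume f: "f \<in> ann X"
    have "f x = 0" if "x \<in> span X" for x
      using linmap_on_span_eq[of "(*)" f "\<lambda>x. 0" X x] f that by (auto simp: ann_def linmap_def)
    with f show "f \<in> ann (span X)" by (auto simp: ann_def)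
  qed
qed

subsection \<open>Bilinear maps\<close>

definition bilin :: "('a \<Rightarrow> 'u \<Rightarrow> 'u) \<Rightarrow> ('b \<Rightarrow> 'b \<Rightarrow> 'u::ab_group_add) \<Rightarrow> bool" where
  "bilin t B \<longleftrightarrow> (\<forall>v. linmap scale t (\<lambda>u. B u v)) \<and> (\<forall>u. linmap scale t (\<lambda>v. B u v))"

lemma bilinI: "(\<And>v. linmap scale t (\<lambda>u. B u v)) \<Longrightarrow> (\<And>u. linmap scale t (\<lambda>v. B u v)) \<Longrightarrow> bilin t B"
  by (simp add: bilin_def)

lemma bilin_left: "bilin t B \<Longrightarrow> linmap scale t (\<lambda>u. B u v)"
  and bilin_right: "bilin t B \<Longrightarrow> linmap scale t (\<lambda>v. B u v)"
  by (auto simp: bilin_def)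

lemma bilin_linmap: "linmap t t' g \<Longrightarrow> bilin t B \<Longrightarrow> bilin t' (\<lambda>u v. g (B u v))"
  by (auto simp: bilin_def linmap_def)

text \<open>Expand the first factors in a basis of the whole space. The vector paired with a basis
  element i is the given expression for the i-th coordinate form, hence zero.\<close>

lemma tensor_zero_left:
  assumes "vector_space t" "\<And>f. linear_form f \<Longrightarrow> (\<Sum>(u,v)\<leftarrow>xs. scale (f u) v) = 0" and B: "bilin t B"
  shows "(\<Sum>(u,v)\<leftarrow>xs. B u v) = 0"
proof -
  interpret t: vector_space t by fact
  define b where "b = extend_basis {}"
  have b: "independent b" "span b = UNIV"
    unfolding b_def using independent_extend_basis[OF independent_empty] span_extend_basis[OF independent_empty]
    by blast+
  let ?r = "representation b"
  have form: "linear_form (\<lambda>u. ?r u i)" for i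
    by (rule linmapI) (simp_all add: representation_add[OF b(1)] representation_scale[OF b(1)] b(2))
  define F where "F = (\<Union>u\<in>set (map fst xs). {i. ?r u i \<noteq> 0})"
  have F: "finite F" unfolding F_def by (auto simp: finite_representation)
  have B0: "B u 0 = 0" for u using linmap_0[OF bilin_right[OF B]] .
  have expand: "(\<Sum>(u,v)\<leftarrow>ys. B u v) = (\<Sum>i\<in>F. B i (\<Sum>(u,v)\<leftarrow>ys. scale (?r u i) v))"
    if "set ys \<subseteq> set xs" for ys
    using that
  proof (induction ys)
    case Nil
    then show ?case by (simp add: B0)
  next
    case (Cons p ys)
    obtain u v where p: "p = (u, v)" by force
    have sub: "{i. ?r u i \<noteq> 0} \<subseteq> F" using Cons.prems p by (force simp: F_def)
    have "u = (\<Sum>i | ?r u i \<noteq> 0. scale (?r u i) i)"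
      using sum_nonzero_representation_eq[OF b(1), of u] b(2) by simp
    also have "\<dots> = (\<Sum>i\<in>F. scale (?r u i) i)"
      using sub F by (intro sum.mono_neutral_left) auto
    finally have "B u v = B (\<Sum>i\<in>F. scale (?r u i) i) v" by simp
    also have "\<dots> = (\<Sum>i\<in>F. t (?r u i) (B i v))"
      by (simp add: linmap_sum[OF bilin_left[OF B]] linmap_scale[OF bilin_left[OF B]])
    also have "\<dots> = (\<Sum>i\<in>F. B i (scale (?r u i) v))"
      by (simp add: linmap_scale[OF bilin_right[OF B]])
    finally show ?case using Cons p
      by (simp add: linmap_add[OF bilin_right[OF B]] sum.distrib)
  qed
  show ?thesis
    using expand[OF order_refl] by (simp add: assms(2)[OF form] B0)
qed

lemma tensor_zero:
  assumes "vector_space t" "\<And>f g. linear_form f \<Longrightarrow> linear_form g \<Longrightarrow> (\<Sum>(u,v)\<leftarrow>xs. f u * g v) = 0"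
    and B: "bilin t B"
  shows "(\<Sum>(u,v)\<leftarrow>xs. B u v) = 0"
proof (rule tensor_zero_left[OF assms(1) _ B])
  fix f assume f: "linear_form f"
  show "(\<Sum>(u,v)\<leftarrow>xs. scale (f u) v) = 0"
  proof (rule forms_separate)
    fix g assume g: "linear_form g"
    have "g (\<Sum>(u,v)\<leftarrow>xs. scale (f u) v) = (\<Sum>(u,v)\<leftarrow>xs. f u * g v)"
      by (simp add: linmap_sum_list[OF g] case_prod_unfold linmap_scale[OF g])
    with assms(2)[OF f g] show "g (\<Sum>(u,v)\<leftarrow>xs. scale (f u) v) = g 0" by (simp add: linmap_0[OF g])
  qed
qed

end

section \<open>Coalgebras\<close>

text \<open>
  The comultiplication is given by lists of pairs, \<open>\<Delta> x\<close> being the sum of the \<open>u \<otimes> v\<close> with \<open>(u, v)\<close>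
  in \<open>cop x\<close>. Identities in tensor powers of the coalgebra are expressed by evaluating multilinear
  maps.
\<close>

locale coalg = vspace scale
  for scale :: "'a::field \<Rightarrow> 'b::ab_group_add \<Rightarrow> 'b" +
  fixes cop :: "'b \<Rightarrow> ('b \<times> 'b) list" and \<epsilon> :: "'b \<Rightarrow> 'a"
  assumes cop_form: "bilin (*) \<beta> \<Longrightarrow> linear_form (\<lambda>x. \<Sum>(u,v)\<leftarrow>cop x. \<beta> u v)"
    and coassoc_form:
      "(\<And>b c. linear_form (\<lambda>a. \<tau> a b c)) \<Longrightarrow> (\<And>a c. linear_form (\<lambda>b. \<tau> a b c)) \<Longrightarrow>
       (\<And>a b. linear_form (\<lambda>c. \<tau> a b c)) \<Longrightarrow>
       (\<Sum>(a,b)\<leftarrow>cop x. \<Sum>(a',a'')\<leftarrow>cop a. \<tau> a' a'' b) = (\<Sum>(a,b)\<leftarrow>cop x. \<Sum>(b',b'')\<leftarrow>cop b. \<tau> a b' b'')"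
    and eps_linear: "linear_form \<epsilon>"
    and counit_l: "(\<Sum>(u,v)\<leftarrow>cop x. scale (\<epsilon> u) v) = x"
    and counit_r: "(\<Sum>(u,v)\<leftarrow>cop x. scale (\<epsilon> v) u) = x"
begin

text \<open>Sweedler notation: \<open>sw B x\<close> stands for \<open>B x\<^sub>1 x\<^sub>2\<close>.\<close>

definition sw :: "('b \<Rightarrow> 'b \<Rightarrow> 'u::ab_group_add) \<Rightarrow> 'b \<Rightarrow> 'u" where
  "sw B x = (\<Sum>(u,v)\<leftarrow>cop x. B u v)"

lemma sw_zero [simp]: "sw (\<lambda>u v. 0) x = 0"
  by (simp add: sw_def case_prod_unfold)

lemma sw_add: "sw (\<lambda>u v. B u v + C u v) x = sw B x + sw C x"
  by (simp add: sw_def case_prod_unfold sum_list_addf)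

lemma sw_diff: "sw (\<lambda>u v. B u v - C u v) x = sw B x - sw C x"
  by (simp add: sw_def case_prod_unfold sum_list_subtractf)

lemma sw_sum: "sw (\<lambda>u v. \<Sum>i\<in>I. B i u v) x = (\<Sum>i\<in>I. sw (B i) x)"
proof (induction I rule: infinite_finite_induct)
  case (insert i I)
  then show ?case by (simp add: sw_add)
qed simp_all

lemma sw_app: "linmap s t f \<Longrightarrow> f (sw B x) = sw (\<lambda>u v. f (B u v)) x"
  by (simp add: sw_def case_prod_unfold linmap_sum_list)

lemma sw_swap: "sw (\<lambda>a b. sw (\<lambda>c d. T a b c d) y) x = sw (\<lambda>c d. sw (\<lambda>a b. T a b c d) x) y"
proof -
  have "(\<Sum>p\<leftarrow>ps. \<Sum>q\<leftarrow>qs. f p q) = (\<Sum>q\<leftarrow>qs. \<Sum>p\<leftarrow>ps. f p q)"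
    for f :: "_ \<Rightarrow> _ \<Rightarrow> 'u::ab_group_add" and ps :: "('b \<times> 'b) list" and qs :: "('b \<times> 'b) list"
    by (induction ps) (simp_all add: sum_list_addf)
  then show ?thesis by (simp add: sw_def case_prod_unfold)
qed

text \<open>The locale axioms speak of scalar-valued maps only. Vector values are allowed because
  linear forms separate points.\<close>

lemma sw_linear:
  assumes t: "vector_space t" and B: "bilin t B"
  shows "linmap scale t (sw B)"
proof -
  interpret t: vspace t using t by (simp add: vspace_def)
  have form: "linear_form (\<lambda>x. f (sw B x))" if f: "t.linear_form f" for f
    using cop_form[OF bilin_linmap[OF f B]] unfolding sw_app[OF f] unfolding sw_def .
  show ?thesis
  proof (rule linmapI; rule t.forms_separate)
    fix x y f assume f: "t.linear_form f"
    then show "f (sw B (x + y)) = f (sw B x + sw B y)"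
      using linmap_add[OF form[OF f]] by (simp add: linmap_add[OF f])
  next
    fix c x f assume f: "t.linear_form f"
    then show "f (sw B (scale c x)) = f (t c (sw B x))"
      using linmap_scale[OF form[OF f]] by (simp add: linmap_scale[OF f])
  qed
qed

definition trilin :: "('a \<Rightarrow> 'u \<Rightarrow> 'u) \<Rightarrow> ('b \<Rightarrow> 'b \<Rightarrow> 'b \<Rightarrow> 'u::ab_group_add) \<Rightarrow> bool" where
  "trilin t T \<longleftrightarrow> (\<forall>b c. linmap scale t (\<lambda>a. T a b c)) \<and> (\<forall>a c. linmap scale t (\<lambda>b. T a b c)) \<and>
     (\<forall>a b. linmap scale t (\<lambda>c. T a b c))"

lemma trilinI:
  "(\<And>b c. linmap scale t (\<lambda>a. T a b c)) \<Longrightarrow> (\<And>a c. linmap scale t (\<lambda>b. T a b c)) \<Longrightarrow>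
   (\<And>a b. linmap scale t (\<lambda>c. T a b c)) \<Longrightarrow> trilin t T"
  by (simp add: trilin_def)

lemma coassoc:
  assumes t: "vector_space t" and T: "trilin t T"
  shows "sw (\<lambda>a b. sw (\<lambda>a' a''. T a' a'' b) a) x = sw (\<lambda>a b. sw (\<lambda>b' b''. T a b' b'') b) x"
proof -
  interpret t: vspace t using t by (simp add: vspace_def)
  show ?thesis
  proof (rule t.forms_separate)
    fix f assume f: "t.linear_form f"
    have "sw (\<lambda>a b. sw (\<lambda>a' a''. f (T a' a'' b)) a) x = sw (\<lambda>a b. sw (\<lambda>b' b''. f (T a b' b'')) b) x"
      unfolding sw_def by (rule coassoc_form) (use T in \<open>auto simp: trilin_def intro: linmap_compose[OF f]\<close>)
    then show "f (sw (\<lambda>a b. sw (\<lambda>a' a''. T a' a'' b) a) x) = f (sw (\<lambda>a b. sw (\<lambda>b' b''. T a b' b'') b) x)"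
      by (simp add: sw_app[OF f])
  qed
qed

lemma counit_left: "linmap scale t g \<Longrightarrow> sw (\<lambda>u v. t (\<epsilon> u) (g v)) x = g x"
  using sw_app[of scale t g "\<lambda>u v. scale (\<epsilon> u) v" x] counit_l[of x] by (simp add: sw_def linmap_scale)

lemma counit_right: "linmap scale t g \<Longrightarrow> sw (\<lambda>u v. t (\<epsilon> v) (g u)) x = g x"
  using sw_app[of scale t g "\<lambda>u v. scale (\<epsilon> v) u" x] counit_r[of x] by (simp add: sw_def linmap_scale)

section \<open>Closure rules for linearity of Sweedler expressions\<close>

lemma lin_id: "linear_op (\<lambda>x. x)"
  by (simp add: linmap_def)

lemma lin_scale: "linear_op f \<Longrightarrow> linear_op (\<lambda>x. scale c (f x))"
  by (simp add: linmap_def scale_right_distrib scale_left_commute)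

lemma lin_scale_left: "linear_form f \<Longrightarrow> linear_op (\<lambda>x. scale (f x) v)"
  by (simp add: linmap_def scale_left_distrib)

lemma lin_mult_left: "linear_form f \<Longrightarrow> linear_form (\<lambda>x. f x * c)"
  by (simp add: linmap_def algebra_simps)

lemma lin_mult_right: "linear_form f \<Longrightarrow> linear_form (\<lambda>x. c * f x)"
  by (simp add: linmap_def algebra_simps)

lemma lin_add_op: "linear_op f \<Longrightarrow> linear_op g \<Longrightarrow> linear_op (\<lambda>x. f x + g x)"
  by (simp add: linmap_def scale_right_distrib)

lemma lin_diff_op: "linear_op f \<Longrightarrow> linear_op g \<Longrightarrow> linear_op (\<lambda>x. f x - g x)"
  by (simp add: linmap_def scale_right_diff_distrib)

lemma lin_add_form: "linear_form f \<Longrightarrow> linear_form g \<Longrightarrow> linear_form (\<lambda>x. f x + g x)"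
  by (simp add: linmap_def algebra_simps)

lemma lin_diff_form: "linear_form f \<Longrightarrow> linear_form g \<Longrightarrow> linear_form (\<lambda>x. f x - g x)"
  by (simp add: linmap_def algebra_simps)

lemma lin_zero_form: "linear_form (\<lambda>x. 0)"
  by (simp add: linmap_def)

lemma lin_sum_form: "(\<And>i. i \<in> I \<Longrightarrow> linear_form (f i)) \<Longrightarrow> linear_form (\<lambda>x. \<Sum>i\<in>I. f i x)"
  by (simp add: linmap_def sum.distrib sum_distrib_left)

lemma lin_eps: "linear_op f \<Longrightarrow> linear_form (\<lambda>x. \<epsilon> (f x))"
  by (rule linmap_compose[OF eps_linear])

lemma lin_times: "linmap (*) (*) (\<lambda>x. c * x)" for c :: 'a
  by (simp add: linmap_def algebra_simps)

lemma lin_sw_body: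
  assumes "vector_space t" "\<And>u v. linmap scale t (\<lambda>x. B x u v)"
  shows "linmap scale t (\<lambda>x. sw (\<lambda>u v. B x u v) y)"
proof -
  interpret t: vector_space t by fact
  have t: "linmap t t (t c)" for c
    by (simp add: linmap_def t.scale_right_distrib t.scale_left_commute)
  show ?thesis
    unfolding linmap_def sw_app[OF t]
    by (simp add: sw_def case_prod_unfold linmap_add[OF assms(2)] linmap_scale[OF assms(2)] sum_list_addf)
qed

lemma lin_sw_arg:
  assumes "vector_space t" "\<And>v. linmap scale t (\<lambda>u. B u v)" "\<And>u. linmap scale t (\<lambda>v. B u v)" "linear_op g"
  shows "linmap scale t (\<lambda>x. sw (\<lambda>u v. B u v) (g x))"
  by (rule linmap_compose[OF sw_linear[OF assms(1)] assms(4)]) (simp add: bilin_def assms)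

lemmas lin_intros = lin_id lin_scale lin_scale_left lin_mult_left lin_mult_right eps_linear lin_eps
  lin_sw_body[OF vector_space_axioms] lin_sw_body[OF vector_space_times]
  lin_sw_arg[OF vector_space_axioms] lin_sw_arg[OF vector_space_times]
  lin_add_op lin_diff_op lin_add_form lin_diff_form

lemmas coassoc_op = coassoc[OF vector_space_axioms]
  and coassoc_scalar = coassoc[OF vector_space_times]

subsection \<open>The action of the dual algebra\<close>

text \<open>The usual left action of the dual algebra; \<open>ra\<close> is the right action and
  \<open>conv\<close> the product.\<close>

definition la :: "('b \<Rightarrow> 'a) \<Rightarrow> 'b \<Rightarrow> 'b" where
  "la f = sw (\<lambda>u v. scale (f v) u)"

definition ra :: "('b \<Rightarrow> 'a) \<Rightarrow> 'b \<Rightarrow> 'b" where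
  "ra f = sw (\<lambda>u v. scale (f u) v)"

definition conv :: "('b \<Rightarrow> 'a) \<Rightarrow> ('b \<Rightarrow> 'a) \<Rightarrow> 'b \<Rightarrow> 'a" where
  "conv f g = sw (\<lambda>u v. f u * g v)"

lemma la_linear: "linear_form f \<Longrightarrow> linear_op (la f)"
  unfolding la_def by (rule sw_linear[OF vector_space_axioms bilinI]) (auto intro: lin_intros)

lemma ra_linear: "linear_form f \<Longrightarrow> linear_op (ra f)"
  unfolding ra_def by (rule sw_linear[OF vector_space_axioms bilinI]) (auto intro: lin_intros)

lemma conv_linear: "linear_form f \<Longrightarrow> linear_form g \<Longrightarrow> linear_form (conv f g)"
  unfolding conv_def by (rule sw_linear[OF vector_space_times bilinI]) (auto intro: lin_intros)

text \<open>The action is transposed to multiplication in the dual algebra. With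
  \<open>forms_separate\<close>, identities between elements reduce to identities of
  \<open>conv\<close>.\<close>

lemma form_la: "linear_form g \<Longrightarrow> g (la f x) = conv g f x"
  by (simp add: la_def conv_def sw_app[of scale "(*)" g] linmap_scale[of scale "(*)" g] mult.commute)

lemma form_ra: "linear_form g \<Longrightarrow> g (ra f x) = conv f g x"
  by (simp add: ra_def conv_def sw_app[of scale "(*)" g] linmap_scale[of scale "(*)" g])

lemma la_eps [simp]: "la \<epsilon> x = x"
  using counit_r by (simp add: la_def sw_def)

lemma ra_eps [simp]: "ra \<epsilon> x = x"
  using counit_l by (simp add: ra_def sw_def)

lemma eps_la [simp]: "linear_form f \<Longrightarrow> \<epsilon> (la f x) = f x"
  using form_la[OF eps_linear, of f x] form_ra[of f \<epsilon> x] by simp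

lemma eps_ra [simp]: "linear_form f \<Longrightarrow> \<epsilon> (ra f x) = f x"
  using form_ra[OF eps_linear, of f x] form_la[of f \<epsilon> x] by simp

lemma conv_eps_left [simp]: "linear_form f \<Longrightarrow> conv \<epsilon> f = f"
  using form_ra[of f \<epsilon>] by (simp add: fun_eq_iff)

lemma conv_eps_right [simp]: "linear_form f \<Longrightarrow> conv f \<epsilon> = f"
  using form_la[of f \<epsilon>] by (simp add: fun_eq_iff)

text \<open>Coassociativity as a bimodule law; associativity of \<open>conv\<close> is derived from
  it.\<close>

lemma la_ra:
  assumes f: "linear_form f" and g: "linear_form g"
  shows "la f (ra g x) = ra g (la f x)"
proof -
  have "la f (ra g x) = sw (\<lambda>a b. sw (\<lambda>b' b''. scale (g a * f b'') b') b) x"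
    unfolding ra_def by (subst sw_app[OF la_linear[OF f]])
      (simp add: linmap_scale[OF la_linear[OF f]], simp add: la_def sw_app[OF lin_scale[OF lin_id]])
  also have "\<dots> = sw (\<lambda>a b. sw (\<lambda>a' a''. scale (g a' * f b) a'') a) x"
    by (rule coassoc_op[symmetric], rule trilinI) (intro lin_intros f g)+
  also have "\<dots> = ra g (la f x)"
    unfolding la_def by (subst sw_app[OF ra_linear[OF g]])
      (simp add: linmap_scale[OF ra_linear[OF g]], simp add: ra_def sw_app[OF lin_scale[OF lin_id]] mult.commute)
  finally show ?thesis .
qed

lemma conv_assoc:
  assumes "linear_form f" "linear_form g" "linear_form h"
  shows "conv (conv f g) h x = conv f (conv g h) x"
proof -
  have "conv (conv f g) h x = conv f g (la h x)" by (simp add: form_la assms conv_linear)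
  also have "\<dots> = g (ra f (la h x))" by (simp add: form_ra assms)
  also have "\<dots> = g (la h (ra f x))" by (simp add: la_ra assms)
  also have "\<dots> = conv g h (ra f x)" by (simp add: form_la assms)
  also have "\<dots> = conv f (conv g h) x" by (simp add: form_ra assms conv_linear)
  finally show ?thesis .
qed

lemma conv_assoc_fun:
  "linear_form f \<Longrightarrow> linear_form g \<Longrightarrow> linear_form h \<Longrightarrow> conv (conv f g) h = conv f (conv g h)"
  by (rule ext) (rule conv_assoc)

lemma la_la:
  assumes "linear_form f" "linear_form g"
  shows "la f (la g x) = la (conv f g) x"
  by (rule forms_separate) (simp add: form_la assms conv_linear conv_assoc)

lemma ra_ra:
  assumes "linear_form f" "linear_form g"
  shows "ra g (ra f x) = ra (conv f g) x"
  by (rule forms_separate) (simp add: form_ra assms conv_linear conv_assoc)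

lemma la_form_diff: "la (\<lambda>u. f u - g u) x = la f x - la g x"
  by (simp add: la_def scale_left_diff_distrib sw_diff)

lemma ra_form_diff: "ra (\<lambda>u. f u - g u) x = ra f x - ra g x"
  by (simp add: ra_def scale_left_diff_distrib sw_diff)

lemma ra_form_add: "ra (\<lambda>u. f u + g u) x = ra f x + ra g x"
  by (simp add: ra_def scale_left_distrib sw_add)

lemma la_form_add: "la (\<lambda>u. f u + g u) x = la f x + la g x"
  by (simp add: la_def scale_left_distrib sw_add)

lemma ra_form_scale: "ra (\<lambda>u. c * f u) x = scale c (ra f x)"
  by (simp add: ra_def sw_app[OF lin_scale[OF lin_id]])

lemma la_form_scale: "la (\<lambda>u. c * f u) x = scale c (la f x)"
  by (simp add: la_def sw_app[OF lin_scale[OF lin_id]])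

lemma la_form_zero [simp]: "la (\<lambda>u. 0) x = 0"
  by (simp add: la_def)

lemma ra_form_zero [simp]: "ra (\<lambda>u. 0) x = 0"
  by (simp add: ra_def)

text \<open>The co-opposite coalgebra, through which one-sided results are transferred to the other
  side.\<close>

lemma coalg_cop: "coalg scale (\<lambda>x. map prod.swap (cop x)) \<epsilon>"
proof -
  have sw: "(\<Sum>(u,v)\<leftarrow>map prod.swap (cop x). B u v) = sw (\<lambda>u v. B v u) x" for B :: "'b \<Rightarrow> 'b \<Rightarrow> 'u::ab_group_add" and x
    by (simp add: sw_def comp_def case_prod_unfold)
  show "coalg scale (\<lambda>x. map prod.swap (cop x)) \<epsilon>"
  proof (unfold_locales, goal_cases)
    case (1 \<beta>)
    then show ?case unfolding sw by (intro sw_linear[OF vector_space_times]) (auto simp: bilin_def)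
  next
    case (2 \<tau> x)
    then show ?case unfolding sw
      by (intro coassoc_scalar[of "\<lambda>a b c. \<tau> c b a", symmetric]) (auto simp: trilin_def)
  next
    case (4 x)
    then show ?case unfolding sw unfolding sw_def by (rule counit_r)
  next
    case (5 x)
    then show ?case unfolding sw unfolding sw_def by (rule counit_l)
  qed (rule eps_linear)
qed

subsection \<open>Wedges and subcoalgebras\<close>

text \<open>The condition expresses \<open>\<Delta> x \<in> X \<otimes> H + H \<otimes> Y\<close>.\<close>

definition cwedge :: "'b set \<Rightarrow> 'b set \<Rightarrow> 'b set" where
  "cwedge X Y = {x. \<forall>f\<in>ann X. \<forall>g\<in>ann Y. conv f g x = 0}"

lemma cwedgeD: "x \<in> cwedge X Y \<Longrightarrow> f \<in> ann X \<Longrightarrow> g \<in> ann Y \<Longrightarrow> conv f g x = 0"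
  by (auto simp: cwedge_def)

text \<open>Split \<open>u \<otimes> v\<close> by projections P onto X and Q onto Y. The part
  \<open>(u - P u) \<otimes> (v - Q v)\<close> of the coproduct is killed by all pairs of forms,
  since f(u - P u) annihilates X and g(v - Q v) annihilates Y; the other parts have a factor in X or
  in Y.\<close>

lemma sw_in_cwedge:
  assumes t: "vector_space t" and B: "bilin t B" and V: "module.subspace t V"
    and XY: "subspace X" "subspace Y" and x: "x \<in> cwedge X Y"
    and X: "\<And>u v. u \<in> X \<Longrightarrow> B u v \<in> V" and Y: "\<And>u v. v \<in> Y \<Longrightarrow> B u v \<in> V"
  shows "sw B x \<in> V"
proof -
  interpret t: vspace t using t by (simp add: vspace_def)
  obtain P where P: "linear_op P" "\<And>u. P u \<in> X" "\<And>u. u \<in> X \<Longrightarrow> P u = u"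
    using projection_exists[OF XY(1)] by blast
  obtain Q where Q: "linear_op Q" "\<And>u. Q u \<in> Y" "\<And>u. u \<in> Y \<Longrightarrow> Q u = u"
    using projection_exists[OF XY(2)] by blast
  let ?ps = "map (\<lambda>(u,v). (u - P u, v - Q v)) (cop x)"
  have "(\<Sum>(u,v)\<leftarrow>?ps. B u v) = 0"
  proof (rule tensor_zero[OF t _ B])
    fix f g assume f: "linear_form f" and g: "linear_form g"
    have "(\<lambda>u. f (u - P u)) \<in> ann X" "(\<lambda>v. g (v - Q v)) \<in> ann Y"
      by (auto intro!: annI linmap_compose[OF f] linmap_compose[OF g] lin_diff_op lin_id P Q
          simp: P Q linmap_0[OF f] linmap_0[OF g])
    from cwedgeD[OF x this] show "(\<Sum>(u,v)\<leftarrow>?ps. f u * g v) = 0"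
      by (simp add: conv_def sw_def comp_def case_prod_unfold)
  qed
  hence "sw (\<lambda>u v. B (u - P u) (v - Q v)) x = 0"
    by (simp add: sw_def comp_def case_prod_unfold)
  moreover have "B = (\<lambda>u v. B (P u) v + B (u - P u) (Q v) + B (u - P u) (v - Q v))"
    by (intro ext) (simp add: linmap_diff[OF bilin_left[OF B]] linmap_diff[OF bilin_right[OF B]])
  hence "sw B x = sw (\<lambda>u v. B (P u) v + B (u - P u) (Q v) + B (u - P u) (v - Q v)) x"
    by (rule arg_cong)
  ultimately have "sw B x = sw (\<lambda>u v. B (P u) v + B (u - P u) (Q v)) x"
    unfolding sw_add by simp
  also have "\<dots> \<in> V"
    unfolding sw_def case_prod_unfold
    by (intro t.subspace_sum_list[OF V] t.subspace_add[OF V] X Y P Q)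
  finally show ?thesis .
qed

text \<open>Equivalently, the coproduct of L lies in \<open>L \<otimes> H\<close>: these are the
  right subcomodules.\<close>

definition left_stable :: "'b set \<Rightarrow> bool" where
  "left_stable L \<longleftrightarrow> subspace L \<and> (\<forall>f x. linear_form f \<longrightarrow> x \<in> L \<longrightarrow> la f x \<in> L)"

text \<open>\<open>\<Delta> C \<subseteq> C \<otimes> C\<close> holds exactly if \<open>C\<close> is stable under both actions of the dual algebra.\<close>

definition subco :: "'b set \<Rightarrow> bool" where
  "subco C \<longleftrightarrow> subspace C \<and> (\<forall>f x. linear_form f \<longrightarrow> x \<in> C \<longrightarrow> la f x \<in> C \<and> ra f x \<in> C)"

lemma subco_subspace: "subco C \<Longrightarrow> subspace C"
  and subco_la: "subco C \<Longrightarrow> linear_form f \<Longrightarrow> x \<in> C \<Longrightarrow> la f x \<in> C"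
  and subco_ra: "subco C \<Longrightarrow> linear_form f \<Longrightarrow> x \<in> C \<Longrightarrow> ra f x \<in> C"
  and subcoI: "subspace C \<Longrightarrow> (\<And>f x. linear_form f \<Longrightarrow> x \<in> C \<Longrightarrow> la f x \<in> C) \<Longrightarrow>
    (\<And>f x. linear_form f \<Longrightarrow> x \<in> C \<Longrightarrow> ra f x \<in> C) \<Longrightarrow> subco C"
  and subco_left_stable: "subco C \<Longrightarrow> left_stable C"
  by (auto simp: subco_def left_stable_def)

lemma left_stable_subspace: "left_stable L \<Longrightarrow> subspace L"
  and left_stable_la: "left_stable L \<Longrightarrow> linear_form f \<Longrightarrow> x \<in> L \<Longrightarrow> la f x \<in> L"
  by (auto simp: left_stable_def)

text \<open>Since \<open>g (la f x) = f (ra g x)\<close>, the test form g moves to the other side,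
  where stability of C applies.\<close>

lemma la_ann:
  assumes C: "subco C" and f: "f \<in> ann C" and x: "x \<in> C"
  shows "la f x = 0"
proof (rule forms_separate)
  fix g assume g: "linear_form g"
  have "g (la f x) = f (ra g x)" using g ann_linear[OF f] by (simp add: form_la form_ra)
  then show "g (la f x) = g 0" using subco_ra[OF C g x] annD[OF f] linmap_0[OF g] by simp
qed

lemma ra_ann:
  assumes C: "subco C" and f: "f \<in> ann C" and x: "x \<in> C"
  shows "ra f x = 0"
proof (rule forms_separate)
  fix g assume g: "linear_form g"
  have "g (ra f x) = f (la g x)" using g ann_linear[OF f] by (simp add: form_la form_ra)
  then show "g (ra f x) = g 0" using subco_la[OF C g x] annD[OF f] linmap_0[OF g] by simp
qed

lemma la_cong:
  assumes "subco C" "x \<in> C" "linear_form f" "linear_form g" "\<And>y. y \<in> C \<Longrightarrow> f y = g y"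
  shows "la f x = la g x"
  using la_ann[OF assms(1) annI assms(2), of "\<lambda>u. f u - g u"] assms(3,4,5) la_form_diff[of f g x]
  by (simp add: lin_diff_form)

lemma ra_cong:
  assumes "subco C" "x \<in> C" "linear_form f" "linear_form g" "\<And>y. y \<in> C \<Longrightarrow> f y = g y"
  shows "ra f x = ra g x"
  using ra_ann[OF assms(1) annI assms(2), of "\<lambda>u. f u - g u"] assms(3,4,5) ra_form_diff[of f g x]
  by (simp add: lin_diff_form)

lemma conv_ann_left: "subco C \<Longrightarrow> f \<in> ann C \<Longrightarrow> linear_form g \<Longrightarrow> conv f g \<in> ann C"
  by (auto intro!: annI conv_linear simp: ann_linear form_la[of f, symmetric] subco_la annD)

lemma conv_ann_right: "subco C \<Longrightarrow> g \<in> ann C \<Longrightarrow> linear_form f \<Longrightarrow> conv f g \<in> ann C"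
  by (auto intro!: annI conv_linear simp: ann_linear form_ra[of g, symmetric] subco_ra annD)

text \<open>The coproduct of x lies in \<open>H \<otimes> C\<close> and in
  \<open>C \<otimes> H\<close>, which are wedges with the zero space. The two memberships are used
  one after the other.\<close>

lemma sw_in_subco:
  assumes t: "vector_space t" and B: "bilin t B" and V: "module.subspace t V"
    and C: "subco C" and x: "x \<in> C" and BV: "\<And>u v. u \<in> C \<Longrightarrow> v \<in> C \<Longrightarrow> B u v \<in> V"
  shows "sw B x \<in> V"
proof -
  interpret t: vspace t using t by (simp add: vspace_def)
  note sC = subco_subspace[OF C]
  obtain Q where Q: "linear_op Q" "\<And>u. Q u \<in> C" "\<And>u. u \<in> C \<Longrightarrow> Q u = u"
    using projection_exists[OF sC] by blast
  have B': "bilin t (\<lambda>u v. B u (Q v))" "bilin t (\<lambda>u v. B u (v - Q v))"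
    using B by (auto simp: bilin_def intro: linmap_compose[OF _ Q(1)] linmap_compose[OF _ lin_diff_op[OF lin_id Q(1)]])
  have "sw (\<lambda>u v. B u (v - Q v)) x \<in> {0}"
  proof (rule sw_in_cwedge[OF t B'(2) t.subspace_single_0 subspace_single_0 sC])
    show "x \<in> cwedge {0} C"
      using la_ann[OF C _ x] by (auto simp: cwedge_def form_la[OF ann_linear, symmetric] linmap_0[OF ann_linear])
  qed (auto simp: Q linmap_0[OF bilin_left[OF B'(2)]] linmap_0[OF bilin_right[OF B]])
  hence "sw B x = sw (\<lambda>u v. B u (Q v)) x"
    using sw_diff[of B "\<lambda>u v. B u (Q v)" x] by (simp add: linmap_diff[OF bilin_right[OF B]])
  also have "\<dots> \<in> V"
  proof (rule sw_in_cwedge[OF t B'(1) V sC subspace_single_0])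
    show "x \<in> cwedge C {0}"
      using ra_ann[OF C _ x] by (auto simp: cwedge_def form_ra[OF ann_linear, symmetric] linmap_0[OF ann_linear])
  qed (auto simp: BV Q linmap_0[OF bilin_right[OF B'(1)]] linmap_0[OF Q(1)] linmap_0[OF bilin_right[OF B]] t.subspace_0[OF V])
  finally show ?thesis .
qed

lemma sw_cong_subco:
  assumes t: "vector_space t" and B: "bilin t B" "bilin t B'"
    and C: "subco C" and x: "x \<in> C" and eq: "\<And>u v. u \<in> C \<Longrightarrow> v \<in> C \<Longrightarrow> B u v = B' u v"
  shows "sw B x = sw B' x"
proof -
  interpret t: vspace t using t by (simp add: vspace_def)
  have "bilin t (\<lambda>u v. B u v - B' u v)"
    using B by (auto simp: bilin_def linmap_def t.scale_right_diff_distrib)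
  from sw_in_subco[OF t this t.subspace_single_0 C x] eq show ?thesis by (simp add: sw_diff)
qed

lemma subco_Int: "subco C \<Longrightarrow> subco D \<Longrightarrow> subco (C \<inter> D)"
  by (auto simp: subco_def subspace_inter)

lemma subco_span:
  assumes "\<And>X. X \<in> \<X> \<Longrightarrow> subco X"
  shows "subco (span (\<Union>\<X>))"
proof (rule subcoI)
  fix f x assume f: "linear_form f" and x: "x \<in> span (\<Union>\<X>)"
  show "la f x \<in> span (\<Union>\<X>)"
    by (rule span_image_in[OF la_linear[OF f] subspace_span _ x]) (auto intro: span_base subco_la[OF assms f])
  show "ra f x \<in> span (\<Union>\<X>)"
    by (rule span_image_in[OF ra_linear[OF f] subspace_span _ x]) (auto intro: span_base subco_ra[OF assms f])
qed simp

lemma subco_cwedge: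
  assumes "subco C" "subco D"
  shows "subco (cwedge C D)"
proof (rule subcoI)
  show "subspace (cwedge C D)"
    by (rule subspaceI) (auto simp: cwedge_def linmap_0[OF conv_linear[OF ann_linear ann_linear]]
        linmap_add[OF conv_linear[OF ann_linear ann_linear]] linmap_scale[OF conv_linear[OF ann_linear ann_linear]])
next
  fix h x assume h: "linear_form h" and x: "x \<in> cwedge C D"
  show "la h x \<in> cwedge C D"
    using conv_ann_left[OF assms(2) _ h] x h
    by (auto simp: cwedge_def form_la[OF conv_linear[OF ann_linear ann_linear]] conv_assoc ann_linear)
  show "ra h x \<in> cwedge C D"
    using conv_ann_right[OF assms(1) _ h] x h
    by (auto simp: cwedge_def form_ra[OF conv_linear[OF ann_linear ann_linear]] conv_assoc[symmetric] ann_linear)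
qed

text \<open>The fundamental theorem of coalgebras: the bimodule generated by x over the dual algebra
  lies in the span of the finitely many middle factors of an iterated coproduct of x.\<close>

lemma fin_dim_subco_exists: "\<exists>X. subco X \<and> fin_dim X \<and> x \<in> X"
proof -
  define G where "G = {la f (ra g x) | f g. linear_form f \<and> linear_form g}"
  define F where "F = (\<Union>v\<in>set (map snd (cop x)). set (map fst (cop v)))"
  have r: "ra g x \<in> span (set (map snd (cop x)))" for g
    unfolding ra_def sw_def case_prod_unfold
    by (intro subspace_sum_list span_scale) (auto intro!: span_base)
  have l: "la f v \<in> span F" if "v \<in> set (map snd (cop x))" for f v
    unfolding la_def sw_def case_prod_unfold
    by (intro subspace_sum_list span_scale) (use that in \<open>auto simp: F_def intro!: span_base\<close>)
  have "G \<subseteq> span F"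
    unfolding G_def using span_image_in[OF la_linear subspace_span l r] by auto
  hence "span G \<subseteq> span F" by (simp add: span_minimal)
  moreover have "finite F" by (simp add: F_def)
  ultimately have "fin_dim (span G)" unfolding fin_dim_def by blast
  moreover have "subco (span G)"
  proof (rule subcoI)
    fix h y assume h: "linear_form h" and y: "y \<in> span G"
    show "la h y \<in> span G"
    proof (rule span_image_in[OF la_linear[OF h] subspace_span _ y])
      fix z assume "z \<in> G"
      then obtain f g where fg: "z = la f (ra g x)" "linear_form f" "linear_form g" by (auto simp: G_def)
      hence "la h z = la (conv h f) (ra g x)" using h by (simp add: la_la)
      then show "la h z \<in> span G" unfolding G_def using fg conv_linear[OF h fg(2)] by (blast intro: span_base)
    qed
    show "ra h y \<in> span G"
    proof (rule span_image_in[OF ra_linear[OF h] subspace_span _ y])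
      fix z assume "z \<in> G"
      then obtain f g where fg: "z = la f (ra g x)" "linear_form f" "linear_form g" by (auto simp: G_def)
      hence "ra h z = la f (ra (conv g h) x)" using h by (simp add: la_ra[symmetric] ra_ra)
      then show "ra h z \<in> span G" unfolding G_def using fg conv_linear[OF fg(3) h] by (blast intro: span_base)
    qed
  qed simp
  moreover have "x \<in> G" unfolding G_def using eps_linear by (intro CollectI exI[of _ \<epsilon>]) simp
  hence "x \<in> span G" by (rule span_base)
  ultimately show ?thesis by blast
qed

section \<open>Simple subcoalgebras and simple quotients of comodules\<close>

definition simple :: "'b set \<Rightarrow> bool" where
  "simple C \<longleftrightarrow> subco C \<and> C \<noteq> {0} \<and> (\<forall>D. subco D \<and> D \<subseteq> C \<longrightarrow> D = {0} \<or> D = C)"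

lemma simple_subco: "simple C \<Longrightarrow> subco C"
  by (simp add: simple_def)

lemma simple_subspace: "simple C \<Longrightarrow> subspace C"
  by (simp add: simple_def subco_def)

lemma simpleD: "simple C \<Longrightarrow> subco D \<Longrightarrow> D \<subseteq> C \<Longrightarrow> D = {0} \<or> D = C"
  by (simp add: simple_def)

lemma simple_Int: "simple C \<Longrightarrow> subco X \<Longrightarrow> C \<inter> X = {0} \<or> C \<subseteq> X"
  using simpleD[OF _ subco_Int, of C C X] simple_subco by blast

lemma simple_eq: "simple C \<Longrightarrow> simple D \<Longrightarrow> C \<subseteq> D \<Longrightarrow> C = D"
  by (auto simp: simple_def)

lemma simple_nonzero: "simple C \<Longrightarrow> \<exists>x\<in>C. x \<noteq> 0"
  using subspace_0[OF simple_subspace] by (auto simp: simple_def)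

lemma simple_fin_dim:
  assumes "simple C"
  shows "fin_dim C"
proof -
  obtain x where x: "x \<in> C" "x \<noteq> 0" using simple_nonzero[OF assms] by blast
  obtain X where X: "subco X" "fin_dim X" "x \<in> X" using fin_dim_subco_exists by blast
  with simple_Int[OF assms X(1)] x have "C \<subseteq> X" by blast
  with X(2) fin_dim_mono show ?thesis by blast
qed

lemma simple_exists:
  assumes X: "subco X" and nz: "X \<noteq> {0}"
  shows "\<exists>C. simple C \<and> C \<subseteq> X"
proof -
  obtain x where x: "x \<in> X" "x \<noteq> 0" using nz subspace_0[OF subco_subspace[OF X]] by blast
  obtain Y where Y: "subco Y" "fin_dim Y" "x \<in> Y" using fin_dim_subco_exists by blast
  have "\<exists>C. (subco C \<and> C \<noteq> {0} \<and> C \<subseteq> X \<inter> Y) \<and>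
      (\<forall>D. (subco D \<and> D \<noteq> {0} \<and> D \<subseteq> X \<inter> Y) \<longrightarrow> D \<subseteq> C \<longrightarrow> D = C)"
    by (rule minimal_subspace_exists[of _ "X \<inter> Y" Y])
      (use x X Y in \<open>auto simp: subco_Int subco_subspace\<close>)
  then obtain C where C: "subco C" "C \<noteq> {0}" "C \<subseteq> X \<inter> Y"
    and min: "\<And>D. subco D \<Longrightarrow> D \<noteq> {0} \<Longrightarrow> D \<subseteq> X \<inter> Y \<Longrightarrow> D \<subseteq> C \<Longrightarrow> D = C" by metis
  have "simple C" unfolding simple_def using C min by (metis order_trans)
  with C show ?thesis by blast
qed

text \<open>Otherwise, multiplying forms that equal \<epsilon> on E and vanish on one member each
  gives a form acting as the identity on E and killing a prescribed element of the span.\<close>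

lemma simple_in_span_Union:
  assumes E: "simple E" and sub: "E \<subseteq> span (\<Union>\<X>)" and \<X>: "\<And>X. X \<in> \<X> \<Longrightarrow> subco X"
  shows "\<exists>X\<in>\<X>. E \<subseteq> X"
proof (rule ccontr)
  assume "\<not> ?thesis"
  hence disj: "E \<inter> X = {0}" if "X \<in> \<X>" for X using simple_Int[OF E \<X>[OF that]] that by blast
  note sE = simple_subco[OF E]
  have one: "la f y = y" if "linear_form f" "\<And>y. y \<in> E \<Longrightarrow> f y = \<epsilon> y" "y \<in> E" for f y
    using la_cong[OF sE that(3) that(1) eps_linear that(2)] by simp
  have "\<exists>f. linear_form f \<and> (\<forall>y\<in>E. f y = \<epsilon> y) \<and> la f z = 0" if "z \<in> span (\<Union>\<X>)" for z
    using that
  proof (induction rule: span_induct_alt)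
    case base
    then show ?case using eps_linear linmap_0[OF la_linear[OF eps_linear]] by blast
  next
    case (step c x z)
    from step(1) obtain X where X: "X \<in> \<X>" "x \<in> X" by blast
    obtain f where f: "linear_form f" "\<And>y. y \<in> E \<Longrightarrow> f y = \<epsilon> y" "\<And>y. y \<in> X \<Longrightarrow> f y = 0"
      using form_on_direct_sum[OF subco_subspace[OF sE] subco_subspace[OF \<X>[OF X(1)]] _ eps_linear] disj[OF X(1)]
      by blast
    obtain g where g: "linear_form g" "\<And>y. y \<in> E \<Longrightarrow> g y = \<epsilon> y" "la g z = 0" using step(2) by blast
    have "la g x \<in> X" using subco_la[OF \<X>[OF X(1)] g(1) X(2)] .
    hence "la f (la g x) = 0" using la_ann[OF \<X>[OF X(1)] annI] f by blast
    hence "la (conv f g) (scale c x + z) = 0"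
      using g(3) linmap_0[OF la_linear[OF f(1)]] unfolding la_la[OF f(1) g(1), symmetric]
      by (simp add: linmap_add[OF la_linear] linmap_scale[OF la_linear] f g)
    moreover have "conv f g y = \<epsilon> y" if "y \<in> E" for y
      using one[OF g(1,2) that] f(2)[OF that] form_la[OF f(1), of g y] by simp
    ultimately show ?case using conv_linear[OF f(1) g(1)] by blast
  qed
  then have "z = 0" if "z \<in> E" for z using one that sub by (metis subsetD)
  with simple_nonzero[OF E] show False by blast
qed

text \<open>Nonzero vectors chosen from different simple subcoalgebras are linearly
  independent.\<close>

lemma finite_simples:
  assumes X: "fin_dim X"
  shows "finite {C. simple C \<and> C \<subseteq> X}" (is "finite ?\<S>")
proof -
  obtain F where F: "finite F" "X \<subseteq> span F" using X by (auto simp: fin_dim_def)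
  define v where "v C = (SOME x. x \<in> C \<and> x \<noteq> 0)" for C :: "'b set"
  have v: "v C \<in> C" "v C \<noteq> 0" if "simple C" for C
    using someI_ex[of "\<lambda>x. x \<in> C \<and> x \<noteq> 0"] simple_nonzero[OF that] by (auto simp: v_def)
  have inj: "inj_on v ?\<S>"
  proof (rule inj_onI, goal_cases)
    case (1 C D)
    with v[of C] v[of D] simple_Int[of C D] simple_eq[of C D] simple_subco[of D] show ?case by auto
  qed
  have "independent (v ` ?\<S>)"
    unfolding dependent_def
  proof
    assume "\<exists>a\<in>v ` ?\<S>. a \<in> span (v ` ?\<S> - {a})"
    then obtain C where C: "simple C" "C \<subseteq> X" "v C \<in> span (v ` ?\<S> - {v C})" by blast
    have "v ` ?\<S> - {v C} \<subseteq> \<Union>{D. simple D \<and> D \<noteq> C}" using v by blast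
    from span_mono[OF this] have "v C \<in> span (\<Union>{D. simple D \<and> D \<noteq> C})" using C(3) by blast
    moreover have "subco (span (\<Union>{D. simple D \<and> D \<noteq> C}))" by (rule subco_span) (auto simp: simple_subco)
    ultimately have "C \<subseteq> span (\<Union>{D. simple D \<and> D \<noteq> C})"
      using simple_Int[OF C(1)] v[OF C(1)] by blast
    from simple_in_span_Union[OF C(1) this] obtain D where "simple D" "D \<noteq> C" "C \<subseteq> D"
      by (auto simp: simple_subco)
    with simple_eq[OF C(1)] show False by blast
  qed
  moreover have "v ` ?\<S> \<subseteq> span F" using v F(2) by blast
  ultimately have "finite (v ` ?\<S>)" using independent_span_bound[OF F(1)] by blast
  with inj show ?thesis by (simp add: finite_image_iff)
qed

definition corad :: "'b set" where
  "corad = span (\<Union>{C. simple C})"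

lemma subco_corad: "subco corad"
  unfolding corad_def by (rule subco_span) (simp add: simple_subco)

lemma simple_corad: "simple C \<Longrightarrow> C \<subseteq> corad"
  unfolding corad_def by (rule order_trans[OF _ span_superset]) blast

text \<open>\<open>D\<close> is the coefficient coalgebra of the simple comodule \<open>L / L'\<close>.\<close>

lemma left_stable_simple_quotient:
  assumes L: "left_stable L" "fin_dim L" "L \<noteq> {0}"
  shows "\<exists>L' D. left_stable L' \<and> L' \<subset> L \<and> simple D \<and> (\<forall>X. subco X \<longrightarrow> L \<subseteq> X \<longrightarrow> D \<subseteq> X) \<and>
    (\<forall>f\<in>ann D. \<forall>x\<in>L. la f x \<in> L')"
proof -
  note sL = left_stable_subspace[OF L(1)]
  have "\<exists>X. (left_stable X \<and> X \<subset> L) \<and> (\<forall>Y. left_stable Y \<and> Y \<subset> L \<longrightarrow> X \<subseteq> Y \<longrightarrow> Y = X)"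
    by (rule maximal_subspace_exists[of _ "{0}" L])
      (use L subspace_0[OF sL] in \<open>auto simp: left_stable_def linmap_0[OF la_linear]\<close>)
  then obtain L' where L': "left_stable L'" "L' \<subset> L"
    and max': "\<And>Y. left_stable Y \<and> Y \<subset> L \<Longrightarrow> L' \<subseteq> Y \<Longrightarrow> Y = L'" by metis
  have max: "Y = L' \<or> Y = L" if "left_stable Y" "Y \<subseteq> L" "L' \<subseteq> Y" for Y
    using max'[of Y] that by blast
  note sL' = left_stable_subspace[OF L'(1)]
  have lin: "linear_form g" if "g \<in> ann L'" for g using ann_linear[OF that] .
  have ra0: "ra g x = 0" if g: "g \<in> ann L'" and x: "x \<in> L'" for g x
  proof (rule forms_separate)
    fix h assume h: "linear_form h"
    have "h (ra g x) = g (la h x)" using h lin[OF g] by (simp add: form_la form_ra)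
    then show "h (ra g x) = h 0" using left_stable_la[OF L'(1) h x] annD[OF g] linmap_0[OF h] by simp
  qed
  \<comment> \<open>These are the coefficients of the simple comodule \<open>L / L'\<close>, and C
    is their span.\<close>
  define G where "G = {ra g x | g x. g \<in> ann L' \<and> x \<in> L}"
  define C where "C = span G"
  have C: "subco C"
    unfolding C_def
  proof (rule subcoI)
    fix h y assume h: "linear_form h" and y: "y \<in> span G"
    show "la h y \<in> span G"
    proof (rule span_image_in[OF la_linear[OF h] subspace_span _ y])
      fix z assume "z \<in> G"
      then obtain g x where z: "z = ra g x" "g \<in> ann L'" "x \<in> L" by (auto simp: G_def)
      have "la h z = ra g (la h x)" using z h lin by (simp add: la_ra)
      with z left_stable_la[OF L(1) h] show "la h z \<in> span G" by (auto simp: G_def intro!: span_base)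
    qed
    show "ra h y \<in> span G"
    proof (rule span_image_in[OF ra_linear[OF h] subspace_span _ y])
      fix z assume "z \<in> G"
      then obtain g x where z: "z = ra g x" "g \<in> ann L'" "x \<in> L" by (auto simp: G_def)
      have "conv g h \<in> ann L'"
        using z(2) left_stable_la[OF L'(1) h] lin[OF z(2)] h
        by (auto intro!: annI conv_linear simp: form_la[symmetric] annD)
      moreover have "ra h z = ra (conv g h) x" using z h lin by (simp add: ra_ra)
      ultimately show "ra h z \<in> span G" using z(3) by (auto simp: G_def intro!: span_base)
    qed
  qed simp
  have CX: "C \<subseteq> X" if "subco X" "L \<subseteq> X" for X
    unfolding C_def using that lin subco_subspace
    by (intro span_minimal) (auto simp: G_def intro!: subco_ra)
  have GC: "ra g x \<in> C" if "g \<in> ann L'" "x \<in> L" for g x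
    unfolding C_def by (rule span_base) (use that in \<open>auto simp: G_def\<close>)
  obtain x0 where x0: "x0 \<in> L" "x0 \<notin> L'" using L'(2) by blast
  obtain g0 where g0: "g0 \<in> ann L'" "g0 x0 = 1"
    using form_separates_subspace[OF sL' x0(2)] by (auto simp: ann_def)
  have "ra g0 x0 \<noteq> 0" using eps_ra[OF lin[OF g0(1)], of x0] g0(2) linmap_0[OF eps_linear] by auto
  moreover have "ra g0 x0 \<in> C" using GC g0 x0 by blast
  ultimately have "C \<noteq> {0}" by blast
  then obtain D where D: "simple D" "D \<subseteq> C" using simple_exists[OF C] by blast
  have sD: "subspace D" using D(1) simple_subspace by blast
  \<comment> \<open>A finite-dimensional subcoalgebra around L also contains C; finite dimension of
    C is needed for the choice of Z.\<close>
  obtain X where "subco X" "fin_dim X" "C \<subseteq> X"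
  proof -
    define \<X> where "\<X> = (\<lambda>b. SOME X. subco X \<and> fin_dim X \<and> b \<in> X)"
    have \<X>: "subco (\<X> b)" "fin_dim (\<X> b)" "b \<in> \<X> b" for b
      using someI_ex[OF fin_dim_subco_exists[of b]] by (auto simp: \<X>_def)
    obtain B where B: "finite B" "L \<subseteq> span B" using L(2) by (auto simp: fin_dim_def)
    define X where "X = span (\<Union>(\<X> ` B))"
    have sX: "subco X" unfolding X_def by (rule subco_span) (auto simp: \<X>)
    have "B \<subseteq> \<Union>(\<X> ` B)" using \<X>(3) by blast
    hence "L \<subseteq> X" unfolding X_def using span_mono[of B "\<Union>(\<X> ` B)"] B(2) by blast
    moreover have "fin_dim X"
    proof -
      have "\<exists>F. finite F \<and> \<X> b \<subseteq> span F" for b using \<X>(2)[of b] by (simp add: fin_dim_def)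
      then obtain F where F: "\<And>b. finite (F b)" "\<And>b. \<X> b \<subseteq> span (F b)" by metis
      have "\<Union>(\<X> ` B) \<subseteq> span (\<Union>(F ` B))" using F(2) span_mono[of "F _" "\<Union>(F ` B)"] by blast
      hence "X \<subseteq> span (\<Union>(F ` B))" unfolding X_def by (simp add: span_minimal)
      then show ?thesis unfolding fin_dim_def using B(1) F(1) by (intro exI[of _ "\<Union>(F ` B)"]) simp
    qed
    ultimately show ?thesis using that[OF sX] CX[OF sX] by blast
  qed
  hence fC: "fin_dim C" using fin_dim_mono by blast
  \<comment> \<open>Z is a maximal subcomodule of C with zero intersection with D. It serves as a
    substitute for a complement of D.\<close>
  have "\<exists>Z. (left_stable Z \<and> Z \<subseteq> C \<and> Z \<inter> D = {0}) \<and>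
      (\<forall>Y. (left_stable Y \<and> Y \<subseteq> C \<and> Y \<inter> D = {0}) \<longrightarrow> Z \<subseteq> Y \<longrightarrow> Y = Z)"
    by (rule maximal_subspace_exists[of _ "{0}" C])
      (use fC subspace_0[OF sD] subspace_0[OF subco_subspace[OF C]]
        in \<open>auto simp: left_stable_def linmap_0[OF la_linear]\<close>)
  then obtain Z where Z: "left_stable Z" "Z \<subseteq> C" "Z \<inter> D = {0}"
    and Zmax: "\<And>Y. left_stable Y \<Longrightarrow> Y \<subseteq> C \<Longrightarrow> Y \<inter> D = {0} \<Longrightarrow> Z \<subseteq> Y \<Longrightarrow> Y = Z" by metis
  note sZ = left_stable_subspace[OF Z(1)]
  have stable_vimage: "{x \<in> L. ra g x \<in> W} = L' \<or> {x \<in> L. ra g x \<in> W} = L"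
    if g: "g \<in> ann L'" and W: "left_stable W" for g W
  proof (rule max)
    show "left_stable {x \<in> L. ra g x \<in> W}"
      unfolding left_stable_def
      using subspace_linear_vimage[OF ra_linear[OF lin[OF g]] vector_space_axioms left_stable_subspace[OF W] sL]
        left_stable_la[OF L(1)] left_stable_la[OF W]
      by (auto simp: la_ra[symmetric] lin[OF g])
    show "L' \<subseteq> {x \<in> L. ra g x \<in> W}"
      using L'(2) ra0[OF g] subspace_0[OF left_stable_subspace[OF W]] by auto
  qed auto
  define W where "W = {d + z | d z. d \<in> D \<and> z \<in> Z}"
  have W: "left_stable W"
    unfolding left_stable_def
  proof (intro conjI allI impI)
    show "subspace W" unfolding W_def by (rule subspace_sums[OF sD sZ])
    fix f x assume f: "linear_form f" and "x \<in> W"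
    then show "la f x \<in> W"
      using subco_la[OF simple_subco[OF D(1)] f] left_stable_la[OF Z(1) f]
      by (fastforce simp: W_def linmap_add[OF la_linear[OF f]])
  qed
  \<comment> \<open>If the image of \<open>ra g\<close> left W = D + Z, then by simplicity of
    \<open>L / L'\<close> only L' would be mapped into W, so Z could be enlarged by that image
    without meeting D.\<close>
  have GW: "ra g x \<in> W" if g: "g \<in> ann L'" and x: "x \<in> L" for g x
  proof (rule ccontr)
    assume "ra g x \<notin> W"
    with stable_vimage[OF g W] x have eq: "{x \<in> L. ra g x \<in> W} = L'" by blast
    define Y where "Y = {z + y | z y. z \<in> Z \<and> y \<in> ra g ` L}"
    have sY: "left_stable Y"
      unfolding left_stable_def
    proof (intro conjI allI impI)
      show "subspace Y" unfolding Y_def by (rule subspace_sums[OF sZ subspace_linear_image[OF ra_linear[OF lin[OF g]] sL]])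
      fix f y assume f: "linear_form f" and "y \<in> Y"
      then obtain z x where "z \<in> Z" "x \<in> L" "y = z + ra g x" by (auto simp: Y_def)
      then show "la f y \<in> Y"
        using left_stable_la[OF L(1) f] left_stable_la[OF Z(1) f]
        by (auto simp: Y_def linmap_add[OF la_linear[OF f]] la_ra[OF f lin[OF g]])
    qed
    have "Y \<subseteq> C"
      using Z(2) GC[OF g] subspace_add[OF subco_subspace[OF C]] by (auto simp: Y_def)
    moreover have "Y \<inter> D = {0}"
    proof -
      have "y = 0" if y: "y \<in> Y" "y \<in> D" for y
      proof -
        from y(1) obtain z x where zx: "z \<in> Z" "x \<in> L" "y = z + ra g x" by (auto simp: Y_def)
        have "ra g x = y + (- z)" using zx by simp
        hence "ra g x \<in> W" unfolding W_def using y(2) subspace_neg[OF sZ zx(1)] by blast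
        hence "x \<in> L'" using eq zx(2) by blast
        with zx y(2) ra0[OF g] Z(3) show ?thesis by auto
      qed
      moreover have "0 \<in> Y \<inter> D" using subspace_0[OF left_stable_subspace[OF sY]] subspace_0[OF sD] by blast
      ultimately show ?thesis by blast
    qed
    moreover have "Z \<subseteq> Y"
    proof
      fix z assume "z \<in> Z"
      moreover have "0 \<in> ra g ` L" using linmap_0[OF ra_linear[OF lin[OF g]]] subspace_0[OF sL] by force
      ultimately show "z \<in> Y" unfolding Y_def using add_0_right by (metis (mono_tags, lifting) mem_Collect_eq)
    qed
    ultimately have "Y = Z" using Zmax[OF sY] by blast
    moreover have "ra g x \<in> Y" unfolding Y_def using x subspace_0[OF sZ] by force
    moreover have "Z \<subseteq> W" unfolding W_def using subspace_0[OF sD] by force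
    ultimately show False using \<open>ra g x \<notin> W\<close> by blast
  qed
  \<comment> \<open>Otherwise Z would contain C and hence D. For such a g only L' is mapped into Z,
    while a form vanishing on D moves W = D + Z into Z.\<close>
  have "\<exists>g\<in>ann L'. \<exists>x\<in>L. ra g x \<notin> Z"
  proof (rule ccontr)
    assume "\<not> ?thesis"
    hence "G \<subseteq> Z" by (auto simp: G_def)
    hence "C \<subseteq> Z" unfolding C_def using sZ by (rule span_minimal)
    with D Z(3) simple_nonzero[OF D(1)] show False by blast
  qed
  then obtain g x1 where g: "g \<in> ann L'" and x1: "x1 \<in> L" "ra g x1 \<notin> Z" by blast
  with stable_vimage[OF g Z(1)] have eq: "{x \<in> L. ra g x \<in> Z} = L'" by blast
  have "la f x \<in> L'" if f: "f \<in> ann D" and x: "x \<in> L" for f x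
  proof -
    note lf = ann_linear[OF f]
    obtain d z where dz: "d \<in> D" "z \<in> Z" "ra g x = d + z" using GW[OF g x] by (auto simp: W_def)
    have "ra g (la f x) = la f d + la f z"
      using dz(3) by (simp add: la_ra[OF lf lin[OF g], symmetric] linmap_add[OF la_linear[OF lf]])
    also have "\<dots> \<in> Z"
      using la_ann[OF simple_subco[OF D(1)] f dz(1)] left_stable_la[OF Z(1) lf dz(2)] by simp
    finally show ?thesis using eq left_stable_la[OF L(1) lf x] by blast
  qed
  then show ?thesis using L' D CX by blast
qed

text \<open>Forms vanishing on D map L into L', so the coproduct of x lies in
  \<open>L' \<otimes> H + L \<otimes> D\<close>.\<close>

lemma sw_in_left_stable:
  assumes t: "vector_space t" and B: "bilin t B" and V: "module.subspace t V"
    and L: "left_stable L" and L': "left_stable L'" "L' \<subseteq> L" and D: "subspace D" and x: "x \<in> L"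
    and quot: "\<And>f x. f \<in> ann D \<Longrightarrow> x \<in> L \<Longrightarrow> la f x \<in> L'"
    and BL': "\<And>u v. u \<in> L' \<Longrightarrow> B u v \<in> V" and BD: "\<And>u v. u \<in> L \<Longrightarrow> v \<in> D \<Longrightarrow> B u v \<in> V"
  shows "sw B x \<in> V"
proof -
  interpret t: vspace t using t by (simp add: vspace_def)
  note sL = left_stable_subspace[OF L]
  obtain P where P: "linear_op P" "\<And>u. P u \<in> L" "\<And>u. u \<in> L \<Longrightarrow> P u = u"
    using projection_exists[OF sL] by blast
  have B1: "bilin t (\<lambda>u v. B (P u) v)" "bilin t (\<lambda>u v. B (u - P u) v)"
    using linmap_compose[OF bilin_left[OF B]] bilin_right[OF B] P(1) lin_diff_op[OF lin_id P(1)]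
    by (auto simp: bilin_def)
  have "sw (\<lambda>u v. B (u - P u) v) x \<in> {0}"
  proof (rule sw_in_cwedge[OF t B1(2) t.subspace_single_0 sL subspace_single_0])
    show "x \<in> cwedge L {0}"
      using left_stable_la[OF L] x annD ann_linear
      by (auto simp: cwedge_def form_la[OF ann_linear, symmetric])
  qed (auto simp: P linmap_0[OF bilin_left[OF B]] linmap_0[OF bilin_right[OF B]])
  hence "sw B x = sw (\<lambda>u v. B (P u) v) x"
    using sw_diff[of B "\<lambda>u v. B (P u) v" x] by (simp add: linmap_diff[OF bilin_left[OF B]])
  also have "\<dots> \<in> V"
  proof (rule sw_in_cwedge[OF t B1(1) V left_stable_subspace[OF L'(1)] D])
    show "x \<in> cwedge L' D"
      using quot x annD ann_linear by (auto simp: cwedge_def form_la[OF ann_linear, symmetric])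
  next
    fix u v assume "u \<in> L'"
    with L'(2) have "P u = u" using P(3) by blast
    with BL' \<open>u \<in> L'\<close> show "B (P u) v \<in> V" by simp
  qed (use P BD in auto)
  finally show ?thesis .
qed

text \<open>The simple subcoalgebras outside X span a subcoalgebra that meets X in zero, for a
  simple piece of the intersection would be one of them. So only those inside X contribute to
  x.\<close>

lemma subco_Int_corad:
  assumes X: "subco X" and x: "x \<in> X" "x \<in> corad"
  shows "x \<in> span (\<Union>{C. simple C \<and> C \<subseteq> X})"
proof -
  let ?A = "\<Union>{C. simple C \<and> C \<subseteq> X}" and ?B = "\<Union>{C. simple C \<and> \<not> C \<subseteq> X}"
  have "\<Union>{C. simple C} = ?A \<union> ?B" by blast
  with x(2) have "x \<in> span (?A \<union> ?B)" by (simp add: corad_def)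
  then obtain a b where ab: "a \<in> span ?A" "b \<in> span ?B" "x = a + b" by (auto simp: span_Un)
  have "span ?A \<subseteq> X" using subco_subspace[OF X] by (intro span_minimal) auto
  hence "b \<in> X" using ab x(1) subspace_diff[OF subco_subspace[OF X] x(1), of a] by auto
  have sB: "subco (span ?B)" by (rule subco_span) (auto simp: simple_subco)
  have "X \<inter> span ?B = {0}"
  proof (rule ccontr)
    assume "X \<inter> span ?B \<noteq> {0}"
    from simple_exists[OF subco_Int[OF X sB] this] obtain E where E: "simple E" "E \<subseteq> X" "E \<subseteq> span ?B" by blast
    from simple_in_span_Union[OF E(1,3)] obtain C where "simple C" "\<not> C \<subseteq> X" "E \<subseteq> C" by (auto simp: simple_subco)
    with simple_eq[OF E(1)] E(2) show False by blast
  qed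
  with \<open>b \<in> X\<close> ab(2) have "b = 0" by blast
  with ab show ?thesis by simp
qed

lemma eps_nonzero:
  assumes "subco X" "\<And>x. x \<in> X \<Longrightarrow> \<epsilon> x = 0"
  shows "X \<subseteq> {0}"
  using la_ann[OF assms(1) annI[OF eps_linear assms(2)]] by auto

text \<open>The common zeros in C of a two-sided ideal of forms are a subcoalgebra, hence zero by
  simplicity, and then the ideal restricts onto the dual of C.\<close>

lemma ideal_contains_counit:
  assumes C: "simple C" and lin: "\<And>f. f \<in> \<F> \<Longrightarrow> linear_form f"
    and add: "\<And>f g. f \<in> \<F> \<Longrightarrow> g \<in> \<F> \<Longrightarrow> (\<lambda>x. f x + g x) \<in> \<F>"
    and scale: "\<And>c f. f \<in> \<F> \<Longrightarrow> (\<lambda>x. c * f x) \<in> \<F>" and zero: "(\<lambda>x. 0) \<in> \<F>"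
    and conv: "\<And>f h. f \<in> \<F> \<Longrightarrow> linear_form h \<Longrightarrow> conv f h \<in> \<F>"
      "\<And>f h. f \<in> \<F> \<Longrightarrow> linear_form h \<Longrightarrow> conv h f \<in> \<F>"
    and nz: "f \<in> \<F>" "c \<in> C" "f c \<noteq> 0"
  shows "\<exists>f\<in>\<F>. \<forall>x\<in>C. f x = \<epsilon> x"
proof (rule separating_forms_exhaust[OF _ lin add scale zero simple_subspace[OF C] simple_fin_dim[OF C] eps_linear])
  define N where "N = {c \<in> C. \<forall>f\<in>\<F>. f c = 0}"
  note sC = simple_subco[OF C]
  have "subco N"
  proof (rule subcoI)
    show "subspace N"
      unfolding N_def
      by (rule subspaceI) (auto simp: linmap_0[OF lin] linmap_add[OF lin] linmap_scale[OF lin]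
          subspace_0[OF subco_subspace[OF sC]] subspace_add[OF subco_subspace[OF sC]] subspace_scale[OF subco_subspace[OF sC]])
  next
    fix h x assume "linear_form h" "x \<in> N"
    then show "la h x \<in> N" "ra h x \<in> N"
      using conv subco_la[OF sC] subco_ra[OF sC] by (auto simp: N_def form_la[OF lin] form_ra[OF lin])
  qed
  moreover have "N \<noteq> C" "N \<subseteq> C" using nz by (auto simp: N_def)
  ultimately have N: "N = {0}" using simpleD[OF C] by blast
  fix x assume "x \<in> C" "\<And>f. f \<in> \<F> \<Longrightarrow> f x = 0"
  with N show "x = 0" by (auto simp: N_def)
qed

section \<open>Behaviour of the notions under passage to the co-opposite coalgebra\<close>

lemma sw_cop: "coalg.sw (\<lambda>x. map prod.swap (cop x)) B x = sw (\<lambda>u v. B v u) x"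
  by (simp add: coalg.sw_def[OF coalg_cop] sw_def comp_def case_prod_unfold)

lemma la_cop: "coalg.la scale (\<lambda>x. map prod.swap (cop x)) = ra"
  by (simp add: fun_eq_iff coalg.la_def[OF coalg_cop] ra_def sw_cop)

lemma ra_cop: "coalg.ra scale (\<lambda>x. map prod.swap (cop x)) = la"
  by (simp add: fun_eq_iff coalg.ra_def[OF coalg_cop] la_def sw_cop)

lemma conv_cop: "coalg.conv (\<lambda>x. map prod.swap (cop x)) f g = conv g f"
  by (simp add: fun_eq_iff coalg.conv_def[OF coalg_cop] conv_def sw_cop mult.commute)

lemma subco_cop: "coalg.subco scale (\<lambda>x. map prod.swap (cop x)) = subco"
  by (auto simp: fun_eq_iff coalg.subco_def[OF coalg_cop] subco_def la_cop ra_cop)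

lemma simple_cop: "coalg.simple scale (\<lambda>x. map prod.swap (cop x)) = simple"
  by (auto simp: fun_eq_iff coalg.simple_def[OF coalg_cop] simple_def subco_cop)

lemma corad_cop: "coalg.corad scale (\<lambda>x. map prod.swap (cop x)) = corad"
  by (simp add: coalg.corad_def[OF coalg_cop] corad_def simple_cop)

lemma cwedge_cop: "coalg.cwedge scale (\<lambda>x. map prod.swap (cop x)) X Y = cwedge Y X"
  by (auto simp: coalg.cwedge_def[OF coalg_cop] cwedge_def conv_cop)

text \<open>Such a form acts like an element of the radical: it moves L into a proper subcomodule
  L', and the dimension drops.\<close>

lemma la_nilpotent:
  assumes X: "subco X" and \<nu>: "\<And>D. simple D \<Longrightarrow> D \<subseteq> X \<Longrightarrow> \<nu> \<in> ann D"
    and "left_stable L" "fin_dim L" "L \<subseteq> X" "x \<in> L"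
  shows "\<exists>n. (la \<nu> ^^ n) x = 0"
  using assms(3-)
proof (induction "dim L" arbitrary: L x rule: less_induct)
  case less
  show ?case
  proof (cases "L = {0}")
    case True
    with less.prems show ?thesis by (intro exI[of _ 0]) simp
  next
    case False
    from left_stable_simple_quotient[OF less.prems(1,2) False]
    obtain L' D where L': "left_stable L'" "L' \<subset> L" "simple D" "D \<subseteq> X" "\<And>f x. f \<in> ann D \<Longrightarrow> x \<in> L \<Longrightarrow> la f x \<in> L'"
      using X less.prems(3) by metis
    have "la \<nu> x \<in> L'" using L'(5)[OF \<nu>[OF L'(3,4)] less.prems(4)] .
    moreover have "dim L' < dim L" using dim_less[OF left_stable_subspace[OF L'(1)] L'(2) less.prems(2)] .
    moreover have "fin_dim L'" "L' \<subseteq> X" using fin_dim_mono[OF _ less.prems(2)] L'(2) less.prems(3) by blast+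
    ultimately obtain n where "(la \<nu> ^^ n) (la \<nu> x) = 0" using less.hyps L'(1) by blast
    hence "(la \<nu> ^^ Suc n) x = 0" by (simp add: funpow_swap1)
    then show ?thesis by blast
  qed
qed

text \<open>The annihilator of D is an ideal, so the images of X under it span a subcoalgebra. It is
  proper because it stays in the maximal subcomodule L' of X.\<close>

lemma la_proper:
  assumes X: "subco X" "fin_dim X" "X \<noteq> {0}"
  shows "\<exists>D Y. simple D \<and> D \<subseteq> X \<and> subco Y \<and> Y \<subset> X \<and> (\<forall>f\<in>ann D. \<forall>x\<in>X. la f x \<in> Y)"
proof -
  from left_stable_simple_quotient[OF subco_left_stable[OF X(1)] X(2,3)]
  obtain L' D where L': "left_stable L'" "L' \<subset> X" "simple D"
    "\<And>Z. subco Z \<Longrightarrow> X \<subseteq> Z \<Longrightarrow> D \<subseteq> Z" "\<And>f x. f \<in> ann D \<Longrightarrow> x \<in> X \<Longrightarrow> la f x \<in> L'"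
    by metis
  define G where "G = {la f x | f x. f \<in> ann D \<and> x \<in> X}"
  have "G \<subseteq> L'" using L'(5) by (auto simp: G_def)
  hence "span G \<subseteq> L'" using left_stable_subspace[OF L'(1)] by (rule span_minimal)
  moreover have "subco (span G)"
  proof (rule subcoI)
    fix h y assume h: "linear_form h" and y: "y \<in> span G"
    show "la h y \<in> span G"
    proof (rule span_image_in[OF la_linear[OF h] subspace_span _ y])
      fix z assume "z \<in> G"
      then obtain f x where fx: "z = la f x" "f \<in> ann D" "x \<in> X" by (auto simp: G_def)
      have "la h z = la (conv h f) x" using fx h by (simp add: la_la ann_linear)
      moreover have "conv h f \<in> ann D" using conv_ann_right[OF simple_subco[OF L'(3)] fx(2) h] .
      ultimately show "la h z \<in> span G" using fx(3) by (intro span_base) (auto simp: G_def)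
    qed
    show "ra h y \<in> span G"
    proof (rule span_image_in[OF ra_linear[OF h] subspace_span _ y])
      fix z assume "z \<in> G"
      then obtain f x where fx: "z = la f x" "f \<in> ann D" "x \<in> X" by (auto simp: G_def)
      have "ra h z = la f (ra h x)" using fx h by (simp add: la_ra ann_linear)
      with fx subco_ra[OF X(1) h fx(3)] show "ra h z \<in> span G" by (intro span_base) (auto simp: G_def)
    qed
  qed simp
  moreover have "la f x \<in> span G" if "f \<in> ann D" "x \<in> X" for f x
    by (rule span_base) (use that in \<open>auto simp: G_def\<close>)
  ultimately show ?thesis using L'(2,3) L'(4)[OF X(1) order_refl]
    by (intro exI[of _ D] exI[of _ "span G"]) auto
qed

lemma ra_proper:
  assumes X: "subco X" "fin_dim X" "X \<noteq> {0}"
  shows "\<exists>D Y. simple D \<and> D \<subseteq> X \<and> subco Y \<and> Y \<subset> X \<and> (\<forall>f\<in>ann D. \<forall>x\<in>X. ra f x \<in> Y)"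
  using coalg.la_proper[OF coalg_cop, of X] X by (simp add: subco_cop simple_cop la_cop)

subsection \<open>Decomposition along links\<close>

text \<open>
  The coradical meets \<open>C \<and> D\<close> in \<open>C + D\<close>, so that for simple \<open>C\<close> and \<open>D\<close> this says that \<open>C \<and> D\<close> or
  \<open>D \<and> C\<close> is larger than \<open>C + D\<close>.
\<close>

definition clinked :: "'b set \<Rightarrow> 'b set \<Rightarrow> bool" where
  "clinked C D \<longleftrightarrow> \<not> cwedge C D \<subseteq> corad \<or> \<not> cwedge D C \<subseteq> corad"

lemma clinked_sym: "clinked C D \<longleftrightarrow> clinked D C"
  by (auto simp: clinked_def)

text \<open>Among simple subcoalgebras, an arbitrary union of linkage classes, so that the
  complement is of the same kind.\<close>

definition saturated :: "'b set set \<Rightarrow> bool" where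
  "saturated \<A> \<longleftrightarrow> (\<forall>C D. simple C \<longrightarrow> simple D \<longrightarrow> clinked C D \<longrightarrow> C \<in> \<A> \<longrightarrow> D \<in> \<A>)"

lemma saturated_compl: "saturated \<A> \<Longrightarrow> saturated (- \<A>)"
  using clinked_sym by (auto simp: saturated_def)

definition part :: "'b set set \<Rightarrow> 'b set" where
  "part \<A> = span (\<Union>{X. subco X \<and> (\<forall>C. simple C \<longrightarrow> C \<subseteq> X \<longrightarrow> C \<in> \<A>)})"

lemma subco_part: "subco (part \<A>)"
  unfolding part_def by (rule subco_span) simp

lemma subco_subset_part: "subco X \<Longrightarrow> (\<And>C. simple C \<Longrightarrow> C \<subseteq> X \<Longrightarrow> C \<in> \<A>) \<Longrightarrow> X \<subseteq> part \<A>"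
  unfolding part_def by (rule order_trans[OF _ span_superset]) auto

text \<open>By \<open>simple_in_span_Union\<close>, a sum of subcoalgebras contains no simple ones
  beyond those of its summands.\<close>

lemma simple_part: "simple C \<Longrightarrow> C \<subseteq> part \<A> \<longleftrightarrow> C \<in> \<A>"
proof
  assume C: "simple C" "C \<subseteq> part \<A>"
  from simple_in_span_Union[OF C(1) C(2)[unfolded part_def]] show "C \<in> \<A>" using C(1) by blast
next
  assume C: "simple C" "C \<in> \<A>"
  have "D \<in> \<A>" if "simple D" "D \<subseteq> C" for D using simple_eq[OF that(1) C(1) that(2)] C(2) by simp
  then show "C \<subseteq> part \<A>" using subco_subset_part[OF simple_subco[OF C(1)]] by blast
qed

lemma part_disjoint: "part \<A> \<inter> part (- \<A>) = {0}"
proof (rule ccontr)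
  assume "part \<A> \<inter> part (- \<A>) \<noteq> {0}"
  from simple_exists[OF subco_Int[OF subco_part subco_part] this]
  obtain C where "simple C" "C \<subseteq> part \<A>" "C \<subseteq> part (- \<A>)" by blast
  then show False using simple_part by auto
qed

lemma clinked_cop: "coalg.clinked scale (\<lambda>x. map prod.swap (cop x)) = clinked"
  by (auto simp: fun_eq_iff coalg.clinked_def[OF coalg_cop] clinked_def cwedge_cop corad_cop)

lemma saturated_cop: "coalg.saturated scale (\<lambda>x. map prod.swap (cop x)) = saturated"
  by (simp add: fun_eq_iff coalg.saturated_def[OF coalg_cop] saturated_def simple_cop clinked_cop)

lemma part_cop: "coalg.part scale (\<lambda>x. map prod.swap (cop x)) = part"
  by (simp add: fun_eq_iff coalg.part_def[OF coalg_cop] part_def simple_cop subco_cop)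

text \<open>
  If \<open>C\<close> and \<open>D\<close> are the simple coalgebras through which the dual algebra acts from the two sides on the
  top of \<open>X\<close>, then \<open>e X e'\<close> is contained in \<open>C \<and> D\<close> or in a proper subcoalgebra of \<open>X\<close>.
\<close>

lemma mixed_component_zero:
  assumes sat: "saturated \<A>" and X: "subco X" "fin_dim X" and W: "subco W" "corad \<subseteq> W"
    and proper: "\<And>Y. subco Y \<Longrightarrow> Y \<subset> X \<Longrightarrow> Y \<subseteq> W"
    and lin: "linear_form e" "linear_form e'"
    and central: "\<And>y. y \<in> W \<Longrightarrow> la e y = ra e y" "\<And>y. y \<in> W \<Longrightarrow> la e' y = ra e' y"
    and idem: "\<And>y. y \<in> X \<Longrightarrow> conv e e y = e y" "\<And>y. y \<in> X \<Longrightarrow> conv e' e' y = e' y"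
    and orth: "conv e e' \<in> ann X" "conv e' e \<in> ann X"
    and e: "\<And>C. simple C \<Longrightarrow> C \<notin> \<A> \<Longrightarrow> e \<in> ann C" and e': "\<And>C. simple C \<Longrightarrow> C \<in> \<A> \<Longrightarrow> e' \<in> ann C"
    and x: "x \<in> X"
  shows "ra e (la e' x) = 0"
proof (cases "X = {0}")
  case True
  with x show ?thesis by (simp add: linmap_0[OF la_linear] linmap_0[OF ra_linear] lin)
next
  case False
  define y where "y = ra e (la e' x)"
  have yX: "y \<in> X" unfolding y_def by (intro subco_ra[OF X(1)] subco_la[OF X(1)] x lin)
  \<comment> \<open>On W the actions of e' from the two sides agree, so y =
    \<open>ra e (ra e' y)\<close>, which vanishes as \<open>conv e' e\<close> does on X.\<close>
  have y0: "y = 0" if "y \<in> W"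
  proof -
    have "la e' (la e' x) = la e' x"
      using la_cong[OF X(1) x conv_linear lin(2) idem(2)] lin by (simp add: la_la)
    hence "la e' y = y" by (simp add: y_def la_ra lin)
    hence "y = ra e' y" using central(2)[OF that] by simp
    moreover have "ra e (ra e' y) = 0" using ra_ann[OF X(1) orth(2) yX] by (simp add: ra_ra lin)
    moreover have "ra e y = y"
    proof -
      have "ra e (ra e (la e' x)) = ra e (la e' x)"
        using ra_cong[OF X(1) subco_la[OF X(1) lin(2) x] conv_linear[OF lin(1) lin(1)] lin(1) idem(1)]
        by (simp add: ra_ra lin)
      then show ?thesis by (simp add: y_def)
    qed
    ultimately show "y = 0" by simp
  qed
  obtain D YD where D: "simple D" "subco YD" "YD \<subset> X" "\<And>f x. f \<in> ann D \<Longrightarrow> x \<in> X \<Longrightarrow> la f x \<in> YD"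
    using la_proper[OF X False] by metis
  obtain C YC where C: "simple C" "subco YC" "YC \<subset> X" "\<And>f x. f \<in> ann C \<Longrightarrow> x \<in> X \<Longrightarrow> ra f x \<in> YC"
    using ra_proper[OF X False] by metis
  have DW: "la f x \<in> W" if "f \<in> ann D" "x \<in> X" for f x using D(4)[OF that] proper[OF D(2,3)] by blast
  have CW: "ra f x \<in> W" if "f \<in> ann C" "x \<in> X" for f x using C(4)[OF that] proper[OF C(2,3)] by blast
  have "y \<in> W"
  proof (cases "D \<in> \<A> \<or> C \<notin> \<A>")
    case True
    then show ?thesis
    proof
      assume "D \<in> \<A>"
      from DW[OF e'[OF D(1) this] x] show ?thesis unfolding y_def by (rule subco_ra[OF W(1) lin(1)])
    next
      assume "C \<notin> \<A>"
      from CW[OF e[OF C(1) this] x] show ?thesis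
        unfolding y_def la_ra[OF lin(2,1), symmetric] by (rule subco_la[OF W(1) lin(2)])
    qed
  next
    case False
    \<comment> \<open>The remaining case has C in \<A> and D outside, where saturation excludes a
      link.\<close>
    hence "cwedge C D \<subseteq> corad" using sat C(1) D(1) by (auto simp: saturated_def clinked_def)
    moreover have "y \<in> cwedge C D"
      unfolding cwedge_def
    proof (intro CollectI ballI)
      fix f g assume f: "f \<in> ann C" and g: "g \<in> ann D"
      note l = ann_linear[OF f] ann_linear[OF g] lin conv_linear
      define z where "z = la (conv g e') x"
      define w where "w = ra (conv f e) x"
      have z: "z \<in> W" unfolding z_def
        by (rule DW[OF conv_ann_left[OF simple_subco[OF D(1)] g lin(2)] x])
      have w: "w \<in> W" unfolding w_def
        by (rule CW[OF conv_ann_left[OF simple_subco[OF C(1)] f lin(1)] x])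
      \<comment> \<open>The idea is to exchange e with f and g with e'. This is allowed because g
        puts z and f puts w into W, where e and e' are central. In the end e and e' stand next to
        each other and cancel.\<close>
      have "conv f g y = conv e (conv f g) (la e' x)" unfolding y_def by (simp add: form_ra l)
      also have "\<dots> = conv (conv e (conv f g)) e' x" by (simp add: form_la l)
      also have "\<dots> = conv (conv e f) (conv g e') x" by (simp add: conv_assoc_fun l)
      also have "\<dots> = conv e f z" unfolding z_def by (simp add: form_la l)
      also have "\<dots> = f (ra e z)" by (simp add: form_ra l)
      also have "\<dots> = f (la e z)" by (simp add: central(1)[OF z])
      also have "\<dots> = conv f e z" by (simp add: form_la l)
      also have "\<dots> = conv (conv f e) (conv g e') x" unfolding z_def by (simp add: form_la l)
      also have "\<dots> = conv g e' w" unfolding w_def by (simp add: form_ra l)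
      also have "\<dots> = g (la e' w)" by (simp add: form_la l)
      also have "\<dots> = g (ra e' w)" by (simp add: central(2)[OF w])
      also have "\<dots> = conv e' g w" by (simp add: form_ra l)
      also have "\<dots> = conv (conv f e) (conv e' g) x" unfolding w_def by (simp add: form_ra l)
      also have "\<dots> = conv f (conv e (conv e' g)) x" by (simp add: conv_assoc_fun l)
      also have "conv e (conv e' g) = conv (conv e e') g" by (simp add: conv_assoc_fun l)
      also have "conv f (conv (conv e e') g) x = 0"
        using conv_ann_right[OF X(1) conv_ann_left[OF X(1) orth(1) l(2)] l(1)] x by (rule annD)
      finally show "conv f g y = 0" .
    qed
    ultimately show ?thesis using W(2) by blast
  qed
  with y0 show ?thesis by (simp add: y_def)
qed

lemma conv_add_left: "conv (\<lambda>u. f u + g u) h x = conv f h x + conv g h x"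
  and conv_diff_left: "conv (\<lambda>u. f u - g u) h x = conv f h x - conv g h x"
  and conv_diff_right: "conv h (\<lambda>u. f u - g u) x = conv h f x - conv h g x"
  by (simp_all add: conv_def sw_add[symmetric] sw_diff[symmetric] algebra_simps)

lemma conv_scale_left: "conv (\<lambda>u. c * f u) h x = c * conv f h x"
  and conv_scale_right: "conv h (\<lambda>u. c * f u) x = c * conv h f x"
  by (simp_all add: conv_def sw_app[OF lin_times] algebra_simps)

text \<open>Lifting modulo a square-zero defect: as polynomials in e0,
  \<open>e^2 - e = (4 e0^2 - 4 e0 - 3) (e0^2 - e0)^2\<close>.\<close>

lemma lift_idempotent:
  assumes X: "subco X" and e0: "linear_form e0"
    and n: "conv (\<lambda>u. conv e0 e0 u - e0 u) (\<lambda>u. conv e0 e0 u - e0 u) \<in> ann X"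
  defines "e \<equiv> \<lambda>u. 3 * conv e0 e0 u - 2 * conv e0 (conv e0 e0) u"
  shows "x \<in> X \<Longrightarrow> conv e e x = e x"
proof -
  assume x: "x \<in> X"
  define p where "p k = (conv e0 ^^ k) \<epsilon>" for k
  have lp: "linear_form (p k)" for k
    by (induction k) (simp_all add: p_def eps_linear conv_linear e0)
  have p_Suc: "p (Suc k) = conv e0 (p k)" for k by (simp add: p_def)
  have p_add: "conv (p i) (p j) = p (i + j)" for i j
  proof (induction i)
    case 0
    then show ?case using lp[of j] by (simp add: p_def)
  next
    case (Suc i)
    then show ?case by (simp add: p_Suc conv_assoc_fun e0 lp)
  qed
  have p1: "p 1 = e0" and p2: "p 2 = conv e0 e0" and p3: "p 3 = conv e0 (conv e0 e0)"
    using e0 by (simp_all add: p_def numeral_2_eq_2 numeral_3_eq_3)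
  have "conv (\<lambda>u. p 2 u - p 1 u) (\<lambda>u. p 2 u - p 1 u) = (\<lambda>u. p 4 u - 2 * p 3 u + p 2 u)"
    by (rule ext) (simp add: conv_diff_left conv_diff_right p_add eval_nat_numeral)
  hence n': "(\<lambda>u. p 4 u - 2 * p 3 u + p 2 u) \<in> ann X" using n unfolding p1 p2 by simp
  \<comment> \<open>The vanishing square times a power of e0 gives a recurrence that expresses the
    powers 4, 5 and 6 through 2 and 3.\<close>
  have rec: "p (4 + k) x - 2 * p (3 + k) x + p (2 + k) x = 0" for k
  proof -
    have "conv (\<lambda>u. p 4 u - 2 * p 3 u + p 2 u) (p k) x = 0"
      using conv_ann_left[OF X n' lp] x by (rule annD)
    then show ?thesis by (simp add: conv_add_left conv_diff_left conv_scale_left p_add)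
  qed
  have r: "p 4 x = 2 * p 3 x - p 2 x" "p 5 x = 2 * p 4 x - p 3 x" "p 6 x = 2 * p 5 x - p 4 x"
    using rec[of 0] rec[of 1] rec[of 2] by (simp_all add: algebra_simps eq_diff_eq eval_nat_numeral)
  have e: "e = (\<lambda>u. 3 * p 2 u - 2 * p 3 u)" by (simp add: e_def p2 p3)
  have "conv e e x = 9 * p 4 x - 12 * p 5 x + 4 * p 6 x"
    unfolding e by (simp add: conv_diff_left conv_diff_right conv_scale_left conv_scale_right p_add algebra_simps)
  also have "\<dots> = e x" unfolding e r by (simp add: algebra_simps)
  finally show "conv e e x = e x" .
qed

lemma part_form_exists: "\<exists>e. linear_form e \<and> (\<forall>x\<in>part \<A>. e x = \<epsilon> x) \<and> (\<forall>x\<in>part (- \<A>). e x = 0)"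
  by (rule form_on_direct_sum[OF _ _ _ eps_linear])
    (simp_all add: subco_subspace[OF subco_part] part_disjoint)

lemma part_form_action:
  assumes e: "linear_form e" "\<And>x. x \<in> part \<A> \<Longrightarrow> e x = \<epsilon> x" "\<And>x. x \<in> part (- \<A>) \<Longrightarrow> e x = 0"
    and a: "a \<in> part \<A>" and b: "b \<in> part (- \<A>)"
  shows "la e (a + b) = a" "ra e (a + b) = a"
proof -
  have "la e a = a" using la_cong[OF subco_part a e(1) eps_linear e(2)] by simp
  moreover have "la e b = 0" using la_ann[OF subco_part annI[OF e(1,3)] b] .
  ultimately show "la e (a + b) = a" by (simp add: linmap_add[OF la_linear[OF e(1)]])
  have "ra e a = a" using ra_cong[OF subco_part a e(1) eps_linear e(2)] by simp
  moreover have "ra e b = 0" using ra_ann[OF subco_part annI[OF e(1,3)] b] .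
  ultimately show "ra e (a + b) = a" by (simp add: linmap_add[OF ra_linear[OF e(1)]])
qed

text \<open>Centrality makes the image of X a subcoalgebra, idempotence makes \<open>la e\<close>
  the identity on it, and e kills every simple subcoalgebra outside \<A>.\<close>

lemma central_image_part:
  assumes X: "subco X" and e: "linear_form e" and central: "\<And>x. x \<in> X \<Longrightarrow> la e x = ra e x"
    and idem: "\<And>x. x \<in> X \<Longrightarrow> conv e e x = e x"
    and ann: "\<And>C. simple C \<Longrightarrow> C \<notin> \<A> \<Longrightarrow> e \<in> ann C" and x: "x \<in> X"
  shows "la e x \<in> part \<A>"
proof -
  have "la e ` X \<subseteq> part \<A>"
  proof (rule subco_subset_part)
    show "subco (la e ` X)"
    proof (rule subcoI)
      show "subspace (la e ` X)" by (rule subspace_linear_image[OF la_linear[OF e] subco_subspace[OF X]])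
    next
      fix f y assume f: "linear_form f" and "y \<in> la e ` X"
      then obtain x where x: "x \<in> X" "y = la e x" by blast
      have "la f y = la e (la f x)"
        using x f e central[OF x(1)] central[OF subco_la[OF X f x(1)]] by (simp add: la_ra)
      then show "la f y \<in> la e ` X" using subco_la[OF X f x(1)] by blast
      have "ra f y = la e (ra f x)" using x f e by (simp add: la_ra)
      then show "ra f y \<in> la e ` X" using subco_ra[OF X f x(1)] by blast
    qed
  next
    fix C assume C: "simple C" "C \<subseteq> la e ` X"
    show "C \<in> \<A>"
    proof (rule ccontr)
      assume "C \<notin> \<A>"
      hence ac: "e \<in> ann C" using ann C(1) by blast
      have "c = 0" if c: "c \<in> C" for c
      proof -
        obtain x where x: "x \<in> X" "c = la e x" using C(2) c by blast
        have "la e c = c" using la_cong[OF X x(1) conv_linear[OF e e] e idem] x e by (simp add: la_la)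
        then show ?thesis using la_ann[OF simple_subco[OF C(1)] ac c] by simp
      qed
      then show False using simple_nonzero[OF C(1)] by blast
    qed
  qed
  with x show ?thesis by blast
qed

theorem part_decomposition:
  assumes sat: "saturated \<A>"
  shows "\<exists>a b. a \<in> part \<A> \<and> b \<in> part (- \<A>) \<and> x = a + b"
proof -
  define W where "W = {a + b | a b. a \<in> part \<A> \<and> b \<in> part (- \<A>)}"
  have W: "subco W"
    unfolding W_def
  proof (rule subcoI)
    show "subspace {a + b |a b. a \<in> part \<A> \<and> b \<in> part (- \<A>)}"
      by (intro subspace_sums subco_subspace subco_part)
  next
    fix f x assume f: "linear_form f" and "x \<in> {a + b |a b. a \<in> part \<A> \<and> b \<in> part (- \<A>)}"
    then obtain a b where ab: "a \<in> part \<A>" "b \<in> part (- \<A>)" "x = a + b" by blast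
    have "la f x = la f a + la f b" "ra f x = ra f a + ra f b"
      using f ab(3) by (simp_all add: linmap_add[OF la_linear] linmap_add[OF ra_linear])
    then show "la f x \<in> {a + b |a b. a \<in> part \<A> \<and> b \<in> part (- \<A>)}"
      "ra f x \<in> {a + b |a b. a \<in> part \<A> \<and> b \<in> part (- \<A>)}"
      using subco_la[OF subco_part f] subco_ra[OF subco_part f] ab(1,2) by blast+
  qed
  have partW: "part \<A> \<subseteq> W" "part (- \<A>) \<subseteq> W"
    unfolding W_def using subspace_0[OF subco_subspace[OF subco_part]] by force+
  have simpleW: "C \<subseteq> W" if "simple C" for C
    using simple_part[OF that, of \<A>] simple_part[OF that, of "- \<A>"] partW by blast
  have coradW: "corad \<subseteq> W"
    unfolding corad_def using simpleW by (intro span_minimal subco_subspace W) blast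
  obtain e0 where e0: "linear_form e0" "\<And>x. x \<in> part \<A> \<Longrightarrow> e0 x = \<epsilon> x" "\<And>x. x \<in> part (- \<A>) \<Longrightarrow> e0 x = 0"
    using part_form_exists[of \<A>] by blast
  have act0: "la e0 (a + b) = a" if "a \<in> part \<A>" "b \<in> part (- \<A>)" for a b
    using part_form_action(1)[of e0 \<A> a b] e0 that by blast
  \<comment> \<open>Local finiteness reduces the claim to finite-dimensional X, where by induction
    all proper subcoalgebras already lie in W.\<close>
  have XW: "X \<subseteq> W" if "subco X" "fin_dim X" for X
    using that
  proof (induction "dim X" arbitrary: X rule: less_induct)
    case less
    note X = less.prems
    have proper: "Y \<subseteq> W" if "subco Y" "Y \<subset> X" for Y
      using less.hyps[OF dim_less[OF subco_subspace[OF that(1)] that(2) X(2)] that(1)]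
        fin_dim_mono[OF _ X(2)] that(2) by blast
    show ?case
    proof (cases "X = {0}")
      case True
      then show ?thesis using subspace_0[OF subco_subspace[OF W]] by blast
    next
      case False
      define n where "n = (\<lambda>u. conv e0 e0 u - e0 u)"
      have ln: "linear_form n" unfolding n_def by (intro lin_diff_form conv_linear e0)
      have nW: "n \<in> ann W"
      proof (rule annI[OF ln])
        fix w assume "w \<in> W"
        then obtain a b where ab: "a \<in> part \<A>" "b \<in> part (- \<A>)" "w = a + b" by (auto simp: W_def)
        have "conv e0 e0 w = e0 (la e0 w)" by (simp add: form_la e0)
        also have "\<dots> = e0 a" using act0[OF ab(1,2)] ab(3) by simp
        also have "\<dots> = e0 w" using ab e0 by (simp add: linmap_add[OF e0(1)])
        finally show "n w = 0" by (simp add: n_def)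
      qed
      \<comment> \<open>The defect n vanishes on every simple subcoalgebra, so \<open>la n\<close>
        moves X into a proper subcoalgebra, hence into W, where n vanishes again.\<close>
      have nn: "conv n n \<in> ann X"
      proof (rule annI[OF conv_linear[OF ln ln]])
        fix x assume x: "x \<in> X"
        obtain D YD where D: "simple D" "subco YD" "YD \<subset> X" "\<And>f x. f \<in> ann D \<Longrightarrow> x \<in> X \<Longrightarrow> la f x \<in> YD"
          using la_proper[OF X False] by metis
        have "n \<in> ann D" using nW ann_mono[OF simpleW[OF D(1)]] by blast
        hence "la n x \<in> W" using D(4)[OF _ x] proper[OF D(2,3)] by blast
        then show "conv n n x = 0" using annD[OF nW] by (simp add: form_la[OF ln, symmetric])
      qed
      define e where "e = (\<lambda>u. 3 * conv e0 e0 u - 2 * conv e0 (conv e0 e0) u)"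
      define e' where "e' = (\<lambda>u. \<epsilon> u - e u)"
      have le: "linear_form e" unfolding e_def by (intro lin_diff_form lin_mult_right conv_linear e0)
      have le': "linear_form e'" unfolding e'_def by (intro lin_diff_form eps_linear le)
      have idem: "conv e e x = e x" if "x \<in> X" for x
        using lift_idempotent[OF X(1) e0(1) nn[unfolded n_def] that] by (simp add: e_def)
      \<comment> \<open>Lifting leaves e0 unchanged on W, because e0 is already idempotent
        there.\<close>
      have eW: "e w = e0 w" if w: "w \<in> W" for w
      proof -
        have 1: "conv e0 e0 w = e0 w" if "w \<in> W" for w using annD[OF nW that] by (simp add: n_def)
        have "conv e0 (conv e0 e0) w = conv e0 e0 (ra e0 w)" by (simp add: form_ra conv_linear e0)
        also have "\<dots> = e0 (ra e0 w)" using 1 subco_ra[OF W e0(1) w] by blast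
        also have "\<dots> = e0 w" using 1[OF w] by (simp add: form_ra e0)
        finally show ?thesis using 1[OF w] by (simp add: e_def)
      qed
      have e: "e x = \<epsilon> x" if "x \<in> part \<A>" for x using eW e0(2)[OF that] partW that by auto
      have e_0: "e x = 0" if "x \<in> part (- \<A>)" for x using eW e0(3)[OF that] partW that by auto
      have act: "la e (a + b) = a" "ra e (a + b) = a" if "a \<in> part \<A>" "b \<in> part (- \<A>)" for a b
        using part_form_action[of e \<A> a b] le e e_0 that by blast+
      have central: "la e w = ra e w" if "w \<in> W" for w
        using that act by (auto simp: W_def)
      have la_e': "la e' w = w - la e w" "ra e' w = w - ra e w" for w
        unfolding e'_def by (simp_all add: la_form_diff ra_form_diff)
      have central': "la e' w = ra e' w" if "w \<in> W" for w
        using central[OF that] by (simp add: la_e')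
      have idem': "conv e' e' x = e' x" if "x \<in> X" for x
        using idem[OF that] by (simp add: e'_def conv_diff_left conv_diff_right le eps_linear)
      have orth: "conv e e' \<in> ann X" "conv e' e \<in> ann X"
        by (rule annI[OF conv_linear[OF le le']], simp add: e'_def conv_diff_left conv_diff_right le eps_linear idem)
          (rule annI[OF conv_linear[OF le' le]], simp add: e'_def conv_diff_left conv_diff_right le eps_linear idem)
      have ann: "e \<in> ann C" if "simple C" "C \<notin> \<A>" for C
        by (rule annI[OF le]) (use e_0 simple_part[OF that(1), of "- \<A>"] that in auto)
      have ann': "e' \<in> ann C" if "simple C" "C \<in> \<A>" for C
        by (rule annI[OF le']) (use e simple_part[OF that(1), of \<A>] that in \<open>auto simp: e'_def\<close>)
      have ann'': "e' \<in> ann C" if "simple C" "C \<notin> - \<A>" for C using ann' that by blast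
      have ann''': "e \<in> ann C" if "simple C" "C \<in> - \<A>" for C using ann that by blast
      \<comment> \<open>With both mixed Peirce components zero, \<open>la e\<close> and
        \<open>ra e\<close> agree on all of X, and X splits into the images of e and e'.\<close>
      have m1: "ra e (la e' x) = 0" if "x \<in> X" for x
        by (rule mixed_component_zero[OF sat X W coradW proper le le' central central' idem idem' orth ann ann' that])
      have m2: "ra e' (la e x) = 0" if "x \<in> X" for x
        by (rule mixed_component_zero[OF saturated_compl[OF sat] X W coradW proper le' le central' central idem' idem
            orth(2,1) ann'' ann''' that])
      have cX: "la e x = ra e x" if "x \<in> X" for x
        using m1[OF that] m2[OF that] by (simp add: la_e' linmap_diff[OF ra_linear[OF le]])
      have cX': "la e' x = ra e' x" if "x \<in> X" for x using cX[OF that] by (simp add: la_e')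
      show ?thesis
      proof
        fix x assume x: "x \<in> X"
        have "la e x \<in> part \<A>" by (rule central_image_part[OF X(1) le cX idem ann x])
        moreover have "la e' x \<in> part (- \<A>)" by (rule central_image_part[OF X(1) le' cX' idem' ann'' x])
        moreover have "x = la e x + la e' x" by (simp add: la_e')
        ultimately show "x \<in> W" unfolding W_def by blast
      qed
    qed
  qed
  obtain X where "subco X" "fin_dim X" "x \<in> X" using fin_dim_subco_exists by blast
  with XW have "x \<in> W" by blast
  then show ?thesis by (auto simp: W_def)
qed

definition part_form :: "'b set set \<Rightarrow> 'b \<Rightarrow> 'a" where
  "part_form \<A> = (SOME e. linear_form e \<and> (\<forall>x\<in>part \<A>. e x = \<epsilon> x) \<and> (\<forall>x\<in>part (- \<A>). e x = 0))"

lemma part_form: "linear_form (part_form \<A>)" "x \<in> part \<A> \<Longrightarrow> part_form \<A> x = \<epsilon> x"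
  "x \<in> part (- \<A>) \<Longrightarrow> part_form \<A> x = 0"
  using someI_ex[OF part_form_exists[of \<A>]] by (auto simp: part_form_def)

definition part_proj :: "'b set set \<Rightarrow> 'b \<Rightarrow> 'b" where
  "part_proj \<A> = la (part_form \<A>)"

lemma part_proj_linear: "linear_op (part_proj \<A>)"
  unfolding part_proj_def by (rule la_linear[OF part_form(1)])

lemma part_proj_sum: "a \<in> part \<A> \<Longrightarrow> b \<in> part (- \<A>) \<Longrightarrow> part_proj \<A> (a + b) = a"
  using part_form_action(1)[of "part_form \<A>" \<A> a b] part_form by (simp add: part_proj_def)

lemma part_proj_id: "a \<in> part \<A> \<Longrightarrow> part_proj \<A> a = a"
  using part_proj_sum[of a \<A> 0] subspace_0[OF subco_subspace[OF subco_part]] by simp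

context
  fixes \<A> assumes sat: "saturated \<A>"
begin

lemma part_proj_in: "part_proj \<A> x \<in> part \<A>"
  using part_decomposition[OF sat, of x] part_proj_sum by auto

text \<open>Both summands are subcoalgebras, so the form acts equally from the two sides. The link
  argument needs to switch between the sides.\<close>

lemma part_proj_ra: "part_proj \<A> x = sw (\<lambda>u v. scale (part_form \<A> u) v) x"
proof -
  obtain a b where "a \<in> part \<A>" "b \<in> part (- \<A>)" "x = a + b" using part_decomposition[OF sat] by blast
  then show ?thesis using part_form_action[of "part_form \<A>" \<A> a b] part_form
    by (simp add: part_proj_def ra_def[symmetric])
qed

lemma eps_part_proj: "\<epsilon> (part_proj \<A> x) = part_form \<A> x"
  by (simp add: part_proj_def part_form(1))

end

lemma subset_cwedge_left:
  assumes "subco C"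
  shows "C \<subseteq> cwedge C D"
  using ra_ann[OF assms] by (auto simp: cwedge_def form_ra[OF ann_linear, symmetric] linmap_0[OF ann_linear])

lemma subset_cwedge_right:
  assumes "subco D"
  shows "D \<subseteq> cwedge C D"
  using la_ann[OF assms] by (auto simp: cwedge_def form_la[OF ann_linear, symmetric] linmap_0[OF ann_linear])

text \<open>For any other E there would be forms equal to \<epsilon> on E and zero on C and on D,
  respectively. Their product is \<epsilon> on E but zero on the wedge.\<close>

lemma simple_in_cwedge:
  assumes C: "simple C" and D: "simple D" and E: "simple E" "E \<subseteq> cwedge C D"
  shows "E = C \<or> E = D"
proof (rule ccontr)
  assume neq: "\<not> ?thesis"
  note sE = simple_subco[OF E(1)]
  have "E \<inter> C = {0}" "E \<inter> D = {0}"
    using simple_Int[OF E(1) simple_subco[OF C]] simple_Int[OF E(1) simple_subco[OF D]] simple_eq[OF E(1)] C D neq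
    by blast+
  then obtain u v where u: "linear_form u" "\<And>x. x \<in> E \<Longrightarrow> u x = \<epsilon> x" "\<And>x. x \<in> C \<Longrightarrow> u x = 0"
    and v: "linear_form v" "\<And>x. x \<in> E \<Longrightarrow> v x = \<epsilon> x" "\<And>x. x \<in> D \<Longrightarrow> v x = 0"
    using form_on_direct_sum[OF simple_subspace[OF E(1)] simple_subspace[OF C] _ eps_linear]
      form_on_direct_sum[OF simple_subspace[OF E(1)] simple_subspace[OF D] _ eps_linear] by (metis order_refl)
  have "\<epsilon> x = 0" if x: "x \<in> E" for x
  proof -
    have "u \<in> ann C" "v \<in> ann D" using u(1,3) v(1,3) by (auto simp: ann_def)
    hence "conv u v x = 0" using E(2) x cwedgeD[of x C D u v] by blast
    moreover have "conv u v x = u x"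
      using la_cong[OF sE x v(1) eps_linear v(2)] by (simp add: form_la[OF u(1), symmetric])
    ultimately show ?thesis using u(2)[OF x] by simp
  qed
  with eps_nonzero[OF sE] simple_nonzero[OF E(1)] show False by blast
qed

text \<open>This justifies comparing wedges with the coradical, instead of C + D, in
  \<open>clinked\<close>.\<close>

lemma cwedge_Int_corad:
  assumes C: "simple C" and D: "simple D" and x: "x \<in> cwedge C D" "x \<in> corad"
  shows "\<exists>c\<in>C. \<exists>d\<in>D. x = c + d"
proof -
  have "\<Union>{E. simple E \<and> E \<subseteq> cwedge C D} \<subseteq> C \<union> D" using simple_in_cwedge[OF C D] by blast
  hence "x \<in> span (C \<union> D)"
    using subco_Int_corad[OF subco_cwedge[OF simple_subco[OF C] simple_subco[OF D]] x] span_mono by blast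
  moreover have "span C = C" "span D = D" using simple_subspace C D by simp_all
  ultimately show ?thesis by (auto simp: span_Un)
qed

subsection \<open>Linkage classes\<close>

definition link_class :: "'b set \<Rightarrow> 'b set set" where
  "link_class C = {D. (\<lambda>X Y. simple X \<and> simple Y \<and> clinked X Y)\<^sup>*\<^sup>* C D}"

lemma link_class_refl [simp]: "C \<in> link_class C"
  by (simp add: link_class_def)

lemma link_class_sym: "D \<in> link_class C \<Longrightarrow> C \<in> link_class D"
proof -
  have "symp (\<lambda>X Y. simple X \<and> simple Y \<and> clinked X Y)" using clinked_sym by (auto simp: symp_def)
  from symp_rtranclp[OF this] show "D \<in> link_class C \<Longrightarrow> C \<in> link_class D"
    by (auto simp: link_class_def symp_def)
qed

lemma link_class_trans: "D \<in> link_class C \<Longrightarrow> E \<in> link_class D \<Longrightarrow> E \<in> link_class C"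
  by (auto simp: link_class_def)

lemma saturated_link_class: "saturated (link_class C)"
  unfolding saturated_def link_class_def by (auto intro: rtranclp.rtrancl_into_rtrancl)

lemma saturated_closed:
  assumes "saturated \<A>" "C \<in> \<A>" "D \<in> link_class C"
  shows "D \<in> \<A>"
  using assms(3,2) unfolding link_class_def mem_Collect_eq
  by (induction rule: rtranclp_induct) (use assms(1) in \<open>auto simp: saturated_def\<close>)

lemma link_class_cop: "coalg.link_class scale (\<lambda>x. map prod.swap (cop x)) = link_class"
  by (simp add: fun_eq_iff coalg.link_class_def[OF coalg_cop] link_class_def simple_cop clinked_cop)

end

section \<open>Hopf algebras\<close>

text \<open>The product is a parameter and not the ring operation of a type, so that the opposite
  algebra is an instance as well.\<close>

locale hopf = coalg scale cop \<epsilon>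
  for scale :: "'a::field \<Rightarrow> 'b::ab_group_add \<Rightarrow> 'b" and cop \<epsilon> +
  fixes mul :: "'b \<Rightarrow> 'b \<Rightarrow> 'b" (infixl \<open>\<cdot>\<close> 70) and one :: 'b and S :: "'b \<Rightarrow> 'b"
  assumes mul_linear_left: "linear_op (\<lambda>x. x \<cdot> y)"
    and mul_linear_right: "linear_op (\<lambda>y. x \<cdot> y)"
    and mul_assoc: "(x \<cdot> y) \<cdot> z = x \<cdot> (y \<cdot> z)"
    and one_left [simp]: "one \<cdot> x = x"
    and one_right [simp]: "x \<cdot> one = x"
    and cop_one_form: "bilin (*) \<beta> \<Longrightarrow> (\<Sum>(u,v)\<leftarrow>cop one. \<beta> u v) = \<beta> one one"
    and cop_mul_form: "bilin (*) \<beta> \<Longrightarrow>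
      (\<Sum>(u,v)\<leftarrow>cop (x \<cdot> y). \<beta> u v) = (\<Sum>(a,b)\<leftarrow>cop x. \<Sum>(c,d)\<leftarrow>cop y. \<beta> (a \<cdot> c) (b \<cdot> d))"
    and eps_one [simp]: "\<epsilon> one = 1"
    and eps_mul [simp]: "\<epsilon> (x \<cdot> y) = \<epsilon> x * \<epsilon> y"
    and S_linear: "linear_op S"
    and antipode_l: "(\<Sum>(a,b)\<leftarrow>cop x. S a \<cdot> b) = scale (\<epsilon> x) one"
    and antipode_r: "(\<Sum>(a,b)\<leftarrow>cop x. a \<cdot> S b) = scale (\<epsilon> x) one"
begin

lemma lin_mul_left: "linear_op f \<Longrightarrow> linear_op (\<lambda>x. f x \<cdot> c)"
  by (rule linmap_compose[OF mul_linear_left])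

lemma lin_mul_right: "linear_op f \<Longrightarrow> linear_op (\<lambda>x. c \<cdot> f x)"
  by (rule linmap_compose[OF mul_linear_right])

lemma lin_S: "linear_op f \<Longrightarrow> linear_op (\<lambda>x. S (f x))"
  by (rule linmap_compose[OF S_linear])

lemmas lin_rules = lin_mul_left lin_mul_right lin_S lin_intros

lemma mul_scale_left: "scale c x \<cdot> y = scale c (x \<cdot> y)"
  and mul_scale_right: "x \<cdot> scale c y = scale c (x \<cdot> y)"
  using linmap_scale[OF mul_linear_left] linmap_scale[OF mul_linear_right] by auto

lemma mul_zero_left [simp]: "0 \<cdot> y = 0"
  and mul_zero_right [simp]: "x \<cdot> 0 = 0"
  using linmap_0[OF mul_linear_left] linmap_0[OF mul_linear_right] by auto

lemma mul_add_left: "(x + y) \<cdot> z = x \<cdot> z + y \<cdot> z"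
  and mul_add_right: "x \<cdot> (y + z) = x \<cdot> y + x \<cdot> z"
  using linmap_add[OF mul_linear_left] linmap_add[OF mul_linear_right] by auto

lemma sw_one:
  assumes t: "vector_space t" and B: "bilin t B"
  shows "sw B one = B one one"
proof -
  interpret t: vspace t using t by (simp add: vspace_def)
  show ?thesis
  proof (rule t.forms_separate)
    fix f assume f: "t.linear_form f"
    show "f (sw B one) = f (B one one)"
      unfolding sw_app[OF f] unfolding sw_def by (rule cop_one_form[OF bilin_linmap[OF f B]])
  qed
qed

lemma sw_mul:
  assumes t: "vector_space t" and B: "bilin t B"
  shows "sw B (x \<cdot> y) = sw (\<lambda>a b. sw (\<lambda>c d. B (a \<cdot> c) (b \<cdot> d)) y) x"
proof -
  interpret t: vspace t using t by (simp add: vspace_def)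
  show ?thesis
  proof (rule t.forms_separate)
    fix f assume f: "t.linear_form f"
    show "f (sw B (x \<cdot> y)) = f (sw (\<lambda>a b. sw (\<lambda>c d. B (a \<cdot> c) (b \<cdot> d)) y) x)"
      unfolding sw_app[OF f] unfolding sw_def by (rule cop_mul_form[OF bilin_linmap[OF f B]])
  qed
qed

lemma antipode_left: "linmap scale t G \<Longrightarrow> sw (\<lambda>a b. G (S a \<cdot> b)) x = t (\<epsilon> x) (G one)"
  using sw_app[of scale t G "\<lambda>a b. S a \<cdot> b" x] antipode_l[of x] by (simp add: sw_def linmap_scale)

lemma antipode_right: "linmap scale t G \<Longrightarrow> sw (\<lambda>a b. G (a \<cdot> S b)) x = t (\<epsilon> x) (G one)"
  using sw_app[of scale t G "\<lambda>a b. a \<cdot> S b" x] antipode_r[of x] by (simp add: sw_def linmap_scale)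

lemma S_one [simp]: "S one = one"
proof -
  have "sw (\<lambda>a b. S a \<cdot> b) one = S one \<cdot> one"
    by (rule sw_one[OF vector_space_axioms bilinI]) (intro lin_rules)+
  then show ?thesis using antipode_left[OF lin_id, of one] by simp
qed

text \<open>Evaluate S(x_1 y_1) x_2 y_2 S(y_3) S(x_3) twice: cancelling y_2 S(y_3) and then x_2
  S(x_3) leaves the left side, cancelling S(x_1 y_1) x_2 y_2 the right side.\<close>

lemma S_mul: "S (x \<cdot> y) = S y \<cdot> S x"
proof -
  let ?F = "\<lambda>a r1 r2 c s1 s2. S (a \<cdot> c) \<cdot> ((r1 \<cdot> (s1 \<cdot> S s2)) \<cdot> S r2)"
  let ?L = "sw (\<lambda>a r. sw (\<lambda>r1 r2. sw (\<lambda>c s. sw (\<lambda>s1 s2. ?F a r1 r2 c s1 s2) s) y) r) x"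
  have 1: "sw (\<lambda>c s. sw (\<lambda>s1 s2. ?F a r1 r2 c s1 s2) s) y = S (a \<cdot> y) \<cdot> (r1 \<cdot> S r2)" for a r1 r2
  proof -
    have "sw (\<lambda>s1 s2. ?F a r1 r2 c s1 s2) s = scale (\<epsilon> s) (S (a \<cdot> c) \<cdot> ((r1 \<cdot> one) \<cdot> S r2))" for c s
      by (rule antipode_right[where G = "\<lambda>z. S (a \<cdot> c) \<cdot> ((r1 \<cdot> z) \<cdot> S r2)"]) (intro lin_rules)
    then show ?thesis
      using counit_right[of scale "\<lambda>c. S (a \<cdot> c) \<cdot> (r1 \<cdot> S r2)" y] by (simp add: lin_rules)
  qed
  have "?L = S (x \<cdot> y)"
  proof -
    have "sw (\<lambda>r1 r2. S (a \<cdot> y) \<cdot> (r1 \<cdot> S r2)) r = scale (\<epsilon> r) (S (a \<cdot> y) \<cdot> one)" for a r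
      by (rule antipode_right[where G = "\<lambda>z. S (a \<cdot> y) \<cdot> z"]) (intro lin_rules)
    then show ?thesis unfolding 1
      using counit_right[of scale "\<lambda>a. S (a \<cdot> y)" x] by (simp add: lin_rules)
  qed
  moreover have "?L = sw (\<lambda>p r2. sw (\<lambda>a r1. sw (\<lambda>c s. sw (\<lambda>s1 s2. ?F a r1 r2 c s1 s2) s) y) p) x"
    by (rule coassoc_op[symmetric], rule trilinI) (intro lin_rules)+
  moreover have "\<dots> = sw (\<lambda>p r2. sw (\<lambda>a r1. sw (\<lambda>q s2. sw (\<lambda>c s1. ?F a r1 r2 c s1 s2) q) y) p) x"
    by (subst coassoc_op, rule trilinI) (intro lin_rules refl)+
  moreover have "\<dots> = S y \<cdot> S x"
  proof -
    have "sw (\<lambda>a r1. sw (\<lambda>q s2. sw (\<lambda>c s1. ?F a r1 r2 c s1 s2) q) y) p = scale (\<epsilon> p) (S y \<cdot> S r2)" for p r2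
    proof -
      have 2: "sw (\<lambda>a r1. sw (\<lambda>c s1. ?F a r1 r2 c s1 s2) q) p = scale (\<epsilon> p * \<epsilon> q) (S s2 \<cdot> S r2)" for q s2
      proof -
        have "sw (\<lambda>a r1. sw (\<lambda>c s1. ?F a r1 r2 c s1 s2) q) p =
            sw (\<lambda>a r1. sw (\<lambda>c s1. (S (a \<cdot> c) \<cdot> (r1 \<cdot> s1)) \<cdot> (S s2 \<cdot> S r2)) q) p"
          by (simp add: mul_assoc)
        also have "\<dots> = sw (\<lambda>u v. (S u \<cdot> v) \<cdot> (S s2 \<cdot> S r2)) (p \<cdot> q)"
          by (rule sw_mul[OF vector_space_axioms, symmetric], rule bilinI) (intro lin_rules)+
        also have "\<dots> = scale (\<epsilon> (p \<cdot> q)) (one \<cdot> (S s2 \<cdot> S r2))"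
          by (rule antipode_left[where G = "\<lambda>z. z \<cdot> (S s2 \<cdot> S r2)"]) (intro lin_rules)
        finally show ?thesis by simp
      qed
      have "sw (\<lambda>a r1. sw (\<lambda>q s2. sw (\<lambda>c s1. ?F a r1 r2 c s1 s2) q) y) p =
          sw (\<lambda>q s2. scale (\<epsilon> p * \<epsilon> q) (S s2 \<cdot> S r2)) y"
        by (subst sw_swap) (simp only: 2)
      also have "\<dots> = scale (\<epsilon> p) (S y \<cdot> S r2)"
        using counit_left[of scale "\<lambda>s. scale (\<epsilon> p) (S s \<cdot> S r2)" y]
        by (simp add: lin_rules mult.commute)
      finally show ?thesis .
    qed
    then show ?thesis using counit_left[of scale "\<lambda>r. S y \<cdot> S r" x] by (simp add: lin_rules)
  qed
  ultimately show ?thesis by metis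
qed

text \<open>Evaluate \<Delta>(S x_1) \<open>(x_2 \<otimes> x_3)\<close>
  \<open>(S x_5 \<otimes> S x_4)\<close> twice. From the inside, x_3 S(x_4) and x_2 S(x_5) cancel;
  from the left, \<Delta>(S x_1) \<Delta>(x_2) collapses to the counit. \<open>K a u v\<close> is B
  on \<Delta>(S a) \<open>(u \<otimes> v)\<close>.\<close>

lemma sw_S:
  assumes t: "vector_space t" and B: "bilin t B"
  shows "sw B (S x) = sw (\<lambda>a b. B (S b) (S a)) x"
proof -
  note lB = linmap_compose[OF bilin_left[OF B]] linmap_compose[OF bilin_right[OF B]]
  note lin = lB lin_sw_body[OF t] lin_sw_arg[OF t] lin_rules
  define K where "K a u v = sw (\<lambda>s1 s2. B (s1 \<cdot> u) (s2 \<cdot> v)) (S a)" for a u v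
  have lK: "linear_op f \<Longrightarrow> linmap scale t (\<lambda>z. K (f z) u v)"
    "linear_op f \<Longrightarrow> linmap scale t (\<lambda>z. K a (f z) v)"
    "linear_op f \<Longrightarrow> linmap scale t (\<lambda>z. K a u (f z))" for f a u v
    unfolding K_def by (intro lin, assumption)+
  note lin = lK lin
  let ?L = "sw (\<lambda>p z. sw (\<lambda>a y. sw (\<lambda>r1 r2. sw (\<lambda>r3 r4. K a (r1 \<cdot> S r4) (r2 \<cdot> S r3)) z) y) p) x"
  have "?L = sw (\<lambda>a r. sw (\<lambda>y z. sw (\<lambda>r1 r2. sw (\<lambda>r3 r4. K a (r1 \<cdot> S r4) (r2 \<cdot> S r3)) z) y) r) x"
    by (rule coassoc[OF t], rule trilinI) (intro lin)+
  moreover have "sw (\<lambda>y z. sw (\<lambda>r1 r2. sw (\<lambda>r3 r4. K a (r1 \<cdot> S r4) (r2 \<cdot> S r3)) z) y) r = t (\<epsilon> r) (K a one one)"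
    for a r
  proof -
    have inner: "sw (\<lambda>r2 z. sw (\<lambda>r3 r4. K a (r1 \<cdot> S r4) (r2 \<cdot> S r3)) z) w = K a (r1 \<cdot> S w) one" for r1 w
    proof -
      have collapse: "sw (\<lambda>r2 r3. K a (r1 \<cdot> S r4) (r2 \<cdot> S r3)) m = t (\<epsilon> m) (K a (r1 \<cdot> S r4) one)" for m r4
        by (rule antipode_right) (intro lin)
      have "sw (\<lambda>r2 z. sw (\<lambda>r3 r4. K a (r1 \<cdot> S r4) (r2 \<cdot> S r3)) z) w =
          sw (\<lambda>m r4. sw (\<lambda>r2 r3. K a (r1 \<cdot> S r4) (r2 \<cdot> S r3)) m) w"
        by (rule coassoc[OF t, symmetric], rule trilinI) (intro lin)+
      also have "\<dots> = K a (r1 \<cdot> S w) one"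
        unfolding collapse by (rule counit_left) (intro lin)
      finally show ?thesis .
    qed
    have "sw (\<lambda>y z. sw (\<lambda>r1 r2. sw (\<lambda>r3 r4. K a (r1 \<cdot> S r4) (r2 \<cdot> S r3)) z) y) r =
        sw (\<lambda>r1 w. sw (\<lambda>r2 z. sw (\<lambda>r3 r4. K a (r1 \<cdot> S r4) (r2 \<cdot> S r3)) z) w) r"
      by (rule coassoc[OF t], rule trilinI) (intro lin)+
    also have "\<dots> = t (\<epsilon> r) (K a one one)"
      unfolding inner by (rule antipode_right[where G = "\<lambda>z. K a z one"]) (intro lin)
    finally show ?thesis .
  qed
  moreover have "sw (\<lambda>a r. t (\<epsilon> r) (K a one one)) x = K x one one"
    by (rule counit_right) (intro lin)
  moreover have "K x one one = sw B (S x)" by (simp add: K_def)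
  moreover have "?L = sw (\<lambda>a b. B (S b) (S a)) x"
  proof -
    have "sw (\<lambda>a y. sw (\<lambda>r1 r2. sw (\<lambda>r3 r4. K a (r1 \<cdot> S r4) (r2 \<cdot> S r3)) z) y) p =
        t (\<epsilon> p) (sw (\<lambda>r3 r4. B (S r4) (S r3)) z)" for p z
    proof -
      have "sw (\<lambda>r1 r2. sw (\<lambda>r3 r4. K a (r1 \<cdot> S r4) (r2 \<cdot> S r3)) z) y =
          sw (\<lambda>s1 s2. sw (\<lambda>r3 r4. B (s1 \<cdot> S r4) (s2 \<cdot> S r3)) z) (S a \<cdot> y)" for a y
      proof -
        have "sw (\<lambda>s1 s2. sw (\<lambda>r3 r4. B (s1 \<cdot> S r4) (s2 \<cdot> S r3)) z) (S a \<cdot> y) =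
          sw (\<lambda>s1 s2. sw (\<lambda>r1 r2. sw (\<lambda>r3 r4. B ((s1 \<cdot> r1) \<cdot> S r4) ((s2 \<cdot> r2) \<cdot> S r3)) z) y) (S a)"
          by (rule sw_mul[OF t], rule bilinI) (intro lin)+
        also have "\<dots> = sw (\<lambda>r1 r2. sw (\<lambda>s1 s2. sw (\<lambda>r3 r4. B ((s1 \<cdot> r1) \<cdot> S r4) ((s2 \<cdot> r2) \<cdot> S r3)) z) (S a)) y"
          by (rule sw_swap)
        also have "\<dots> = sw (\<lambda>r1 r2. sw (\<lambda>r3 r4. K a (r1 \<cdot> S r4) (r2 \<cdot> S r3)) z) y"
          unfolding K_def mul_assoc by (subst sw_swap) (rule refl)
        finally show ?thesis by simp
      qed
      then show ?thesis
        using antipode_left[of t "\<lambda>h. sw (\<lambda>s1 s2. sw (\<lambda>r3 r4. B (s1 \<cdot> S r4) (s2 \<cdot> S r3)) z) h" p]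
          sw_one[OF t, of "\<lambda>s1 s2. sw (\<lambda>r3 r4. B (s1 \<cdot> S r4) (s2 \<cdot> S r3)) z"]
        by (simp add: lin bilinI)
    qed
    moreover have "sw (\<lambda>p z. t (\<epsilon> p) (sw (\<lambda>r3 r4. B (S r4) (S r3)) z)) x = sw (\<lambda>r3 r4. B (S r4) (S r3)) x"
      by (rule counit_left) (intro lin)
    ultimately show ?thesis by simp
  qed
  ultimately show ?thesis by simp
qed

lemma sw_mul_S:
  assumes t: "vector_space t" and B: "bilin t B"
  shows "sw B (x \<cdot> S y) = sw (\<lambda>a b. sw (\<lambda>c d. B (a \<cdot> S d) (b \<cdot> S c)) y) x"
proof -
  note lB = linmap_compose[OF bilin_left[OF B]] linmap_compose[OF bilin_right[OF B]]
  note lin = lB lin_sw_body[OF t] lin_sw_arg[OF t] lin_rules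
  have "sw (\<lambda>c d. B (a \<cdot> c) (b \<cdot> d)) (S y) = sw (\<lambda>c d. B (a \<cdot> S d) (b \<cdot> S c)) y" for a b
    by (rule sw_S[OF t], rule bilinI) (intro lin)+
  then show ?thesis by (simp only: sw_mul[OF t B])
qed

text \<open>Reversing product and coproduct together keeps S as antipode; reversing only one of them
  would call for an inverse of S.\<close>

lemma hopf_op_cop: "hopf scale (\<lambda>x. map prod.swap (cop x)) \<epsilon> (\<lambda>x y. y \<cdot> x) one S"
proof -
  interpret c: coalg scale "\<lambda>x. map prod.swap (cop x)" \<epsilon> by (rule coalg_cop)
  have sw: "(\<Sum>(u,v)\<leftarrow>map prod.swap (cop x). B u v) = sw (\<lambda>u v. B v u) x" for B :: "'b \<Rightarrow> 'b \<Rightarrow> 'u::ab_group_add" and x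
    by (simp add: sw_def comp_def case_prod_unfold)
  show ?thesis
  proof (unfold_locales, goal_cases)
    case (6 \<beta>)
    then show ?case unfolding sw using sw_one[OF vector_space_times, of "\<lambda>u v. \<beta> v u"] by (auto simp: bilin_def)
  next
    case (7 \<beta> x y)
    then have "bilin (*) (\<lambda>u v. \<beta> v u)" by (auto simp: bilin_def)
    then show ?case unfolding sw
      by (subst sw_mul[OF vector_space_times]) (simp_all add: sw_swap[of _ x y])
  next
    case (11 x)
    then show ?case unfolding sw using antipode_right[OF lin_id] by simp
  next
    case (12 x)
    then show ?case unfolding sw using antipode_left[OF lin_id] by simp
  qed (simp_all add: mul_linear_left mul_linear_right mul_assoc S_linear mult.commute)
qed

subsection \<open>Products of subcoalgebras\<close>

definition prodsp :: "'b set \<Rightarrow> 'b set \<Rightarrow> 'b set" where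
  "prodsp X Y = span {x \<cdot> y | x y. x \<in> X \<and> y \<in> Y}"

lemma prodspI: "x \<in> X \<Longrightarrow> y \<in> Y \<Longrightarrow> x \<cdot> y \<in> prodsp X Y"
  unfolding prodsp_def by (rule span_base) blast

lemma prodsp_subset: "subspace V \<Longrightarrow> (\<And>x y. x \<in> X \<Longrightarrow> y \<in> Y \<Longrightarrow> x \<cdot> y \<in> V) \<Longrightarrow> prodsp X Y \<subseteq> V"
  unfolding prodsp_def by (rule span_minimal) blast+

lemma subspace_prodsp: "subspace (prodsp X Y)"
  by (simp add: prodsp_def)

lemma sw_mul_in_subco:
  assumes t: "vector_space t" and B: "bilin t B" and V: "module.subspace t V"
    and X: "subco X" and Y: "subco Y" and x: "x \<in> X" and y: "y \<in> Y"
    and BV: "\<And>a b c d. a \<in> X \<Longrightarrow> b \<in> X \<Longrightarrow> c \<in> Y \<Longrightarrow> d \<in> Y \<Longrightarrow> B (a \<cdot> c) (b \<cdot> d) \<in> V"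
  shows "sw B (x \<cdot> y) \<in> V"
proof -
  note lin = linmap_compose[OF bilin_left[OF B]] linmap_compose[OF bilin_right[OF B]]
    lin_sw_body[OF t] lin_sw_arg[OF t] lin_rules
  show ?thesis
    unfolding sw_mul[OF t B]
  proof (rule sw_in_subco[OF t _ V X x])
    show "bilin t (\<lambda>a b. sw (\<lambda>c d. B (a \<cdot> c) (b \<cdot> d)) y)" by (rule bilinI) (intro lin)+
    fix a b assume ab: "a \<in> X" "b \<in> X"
    show "sw (\<lambda>c d. B (a \<cdot> c) (b \<cdot> d)) y \<in> V"
      by (rule sw_in_subco[OF t _ V Y y], rule bilinI) (intro lin BV ab | assumption)+
  qed
qed

lemma subco_prodsp:
  assumes X: "subco X" and Y: "subco Y"
  shows "subco (prodsp X Y)"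
proof (rule subcoI)
  fix f z assume f: "linear_form f" and z: "z \<in> prodsp X Y"
  have bil: "bilin scale (\<lambda>u v. scale (f v) u)" "bilin scale (\<lambda>u v. scale (f u) v)"
    by (rule bilinI; intro lin_rules f)+
  show "la f z \<in> prodsp X Y"
  proof (rule span_image_in[OF la_linear[OF f] subspace_prodsp _ z[unfolded prodsp_def]])
    fix w assume "w \<in> {x \<cdot> y |x y. x \<in> X \<and> y \<in> Y}"
    then obtain x y where "x \<in> X" "y \<in> Y" "w = x \<cdot> y" by blast
    then show "la f w \<in> prodsp X Y" unfolding la_def
      using sw_mul_in_subco[OF vector_space_axioms bil(1) subspace_prodsp X Y]
        subspace_scale[OF subspace_prodsp] prodspI by simp
  qed
  show "ra f z \<in> prodsp X Y"
  proof (rule span_image_in[OF ra_linear[OF f] subspace_prodsp _ z[unfolded prodsp_def]])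
    fix w assume "w \<in> {x \<cdot> y |x y. x \<in> X \<and> y \<in> Y}"
    then obtain x y where "x \<in> X" "y \<in> Y" "w = x \<cdot> y" by blast
    then show "ra f w \<in> prodsp X Y" unfolding ra_def
      using sw_mul_in_subco[OF vector_space_axioms bil(2) subspace_prodsp X Y]
        subspace_scale[OF subspace_prodsp] prodspI by simp
  qed
qed (rule subspace_prodsp)

lemma nilpotent_add:
  assumes f: "linear_form f" and "(la f ^^ n) x = 0" "(la f ^^ m) y = 0"
  shows "(la f ^^ (n + m)) (scale c x + y) = 0"
proof -
  have lin: "linear_op (la f ^^ k)" for k
  proof (induction k)
    case 0
    then show ?case by (simp add: id_def lin_id)
  next
    case (Suc k)
    from linmap_compose[OF la_linear[OF f] this] show ?case by (simp add: comp_def)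
  qed
  have "(la f ^^ (n + m)) x = (la f ^^ m) ((la f ^^ n) x)" by (subst add.commute) (simp add: funpow_add)
  moreover have "(la f ^^ (n + m)) y = (la f ^^ n) ((la f ^^ m) y)" by (simp add: funpow_add)
  ultimately show ?thesis using assms(2,3)
    by (simp add: linmap_add[OF lin] linmap_scale[OF lin] linmap_0[OF lin])
qed

text \<open>For x in L and y in M the coproduct of x y lies in
  \<open>L' M \<otimes> H + L M' \<otimes> H + L M \<otimes> D D'\<close>. As f vanishes on D D',
  one application leads to L' M + L M', where the induction applies.\<close>

lemma la_nilpotent_prod:
  assumes X: "subco X" and Y: "subco Y" and f: "f \<in> ann (prodsp (X \<inter> corad) (Y \<inter> corad))"
    and "left_stable L" "fin_dim L" "L \<subseteq> X" "left_stable M" "fin_dim M" "M \<subseteq> Y" "z \<in> prodsp L M"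
  shows "\<exists>n. (la f ^^ n) z = 0"
  using assms(4-)
proof (induction "dim L + dim M" arbitrary: L M z rule: less_induct)
  case less
  note lf = ann_linear[OF f]
  show ?case
  proof (cases "L = {0} \<or> M = {0}")
    case True
    hence "prodsp L M \<subseteq> {0}" by (intro prodsp_subset) auto
    with less.prems(7) show ?thesis by (intro exI[of _ 0]) auto
  next
    case False
    obtain L' D where L': "left_stable L'" "L' \<subset> L" "simple D" "D \<subseteq> X"
      and quotL: "\<And>f x. f \<in> ann D \<Longrightarrow> x \<in> L \<Longrightarrow> la f x \<in> L'"
      using left_stable_simple_quotient[OF less.prems(1,2)] False X less.prems(3) by metis
    obtain M' D' where M': "left_stable M'" "M' \<subset> M" "simple D'" "D' \<subseteq> Y"
      and quotM: "\<And>f x. f \<in> ann D' \<Longrightarrow> x \<in> M \<Longrightarrow> la f x \<in> M'"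
      using left_stable_simple_quotient[OF less.prems(4,5)] False Y less.prems(6) by metis
    have IH1: "\<exists>n. (la f ^^ n) z = 0" if "z \<in> prodsp L' M" for z
      using less.hyps[OF _ L'(1) _ _ less.prems(4-6) that] dim_less[OF left_stable_subspace[OF L'(1)] L'(2) less.prems(2)]
        fin_dim_mono[OF _ less.prems(2), of L'] L'(2) less.prems(3) by force
    have IH2: "\<exists>n. (la f ^^ n) z = 0" if "z \<in> prodsp L M'" for z
      using less.hyps[OF _ less.prems(1-3) M'(1) _ _ that] dim_less[OF left_stable_subspace[OF M'(1)] M'(2) less.prems(5)]
        fin_dim_mono[OF _ less.prems(5), of M'] M'(2) less.prems(6) by force
    define V where "V = span (prodsp L' M \<union> prodsp L M')"
    have V: "subspace V" by (simp add: V_def)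
    have V1: "x \<cdot> y \<in> V" if "x \<in> L'" "y \<in> M" for x y
      unfolding V_def using prodspI[OF that] by (intro span_base) blast
    have V2: "x \<cdot> y \<in> V" if "x \<in> L" "y \<in> M'" for x y
      unfolding V_def using prodspI[OF that] by (intro span_base) blast
    have nil: "\<exists>n. (la f ^^ n) w = 0" if "w \<in> V" for w
      using that unfolding V_def
    proof (induction rule: span_induct_alt)
      case base
      show ?case by (intro exI[of _ 0]) simp
    next
      case (step c x y)
      then obtain n m where "(la f ^^ n) x = 0" "(la f ^^ m) y = 0" using IH1 IH2 by blast
      then show ?case using nilpotent_add[OF lf] by blast
    qed
    have "la f (x \<cdot> y) \<in> V" if x: "x \<in> L" and y: "y \<in> M" for x y
    proof -
      have "la f (x \<cdot> y) = sw (\<lambda>a b. sw (\<lambda>c d. scale (f (b \<cdot> d)) (a \<cdot> c)) y) x"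
        unfolding la_def by (rule sw_mul[OF vector_space_axioms], rule bilinI) (intro lin_rules lf)+
      also have "\<dots> \<in> V"
      proof (rule sw_in_left_stable[OF vector_space_axioms _ V less.prems(1) L'(1) _ simple_subspace[OF L'(3)] x quotL])
        show "bilin scale (\<lambda>a b. sw (\<lambda>c d. scale (f (b \<cdot> d)) (a \<cdot> c)) y)"
          by (rule bilinI; intro lin_rules linmap_compose[OF lf])
        have bil: "bilin scale (\<lambda>c d. scale (f (b \<cdot> d)) (a \<cdot> c))" for a b
          by (rule bilinI; intro lin_rules linmap_compose[OF lf])
        show "L' \<subseteq> L" using L'(2) by blast
        show "sw (\<lambda>c d. scale (f (b \<cdot> d)) (a \<cdot> c)) y \<in> V" if a: "a \<in> L'" for a b
        proof (rule sw_in_left_stable[OF vector_space_axioms bil V less.prems(4) M'(1) _ simple_subspace[OF M'(3)] y quotM])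
          show "M' \<subseteq> M" using M'(2) by blast
        next
          fix c d
          show "scale (f (b \<cdot> d)) (a \<cdot> c) \<in> V" if "c \<in> M'"
            using a that M'(2) by (intro subspace_scale[OF V] V1) auto
          show "scale (f (b \<cdot> d)) (a \<cdot> c) \<in> V" if "c \<in> M"
            using a that by (intro subspace_scale[OF V] V1) auto
        qed
        show "sw (\<lambda>c d. scale (f (b \<cdot> d)) (a \<cdot> c)) y \<in> V" if a: "a \<in> L" and b: "b \<in> D" for a b
        proof (rule sw_in_left_stable[OF vector_space_axioms bil V less.prems(4) M'(1) _ simple_subspace[OF M'(3)] y quotM])
          show "M' \<subseteq> M" using M'(2) by blast
        next
          fix c d assume d: "d \<in> D'"
          have "b \<cdot> d \<in> prodsp (X \<inter> corad) (Y \<inter> corad)"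
            using b d L'(4) M'(4) simple_corad[OF L'(3)] simple_corad[OF M'(3)] by (intro prodspI) auto
          then show "scale (f (b \<cdot> d)) (a \<cdot> c) \<in> V" using annD[OF f] subspace_0[OF V] by simp
        qed (use a in \<open>auto intro!: subspace_scale[OF V] V2\<close>)
      qed
      finally show ?thesis .
    qed
    hence "la f z \<in> V"
      using span_image_in[OF la_linear[OF lf] V _ less.prems(7)[unfolded prodsp_def]] by blast
    then obtain n where "(la f ^^ n) (la f z) = 0" using nil by blast
    hence "(la f ^^ Suc n) z = 0" by (simp add: funpow_swap1)
    then show ?thesis by blast
  qed
qed

text \<open>If E were not inside the product of the coradicals of X and Y, a form equal to
  \<epsilon> on E and zero on that product would be the identity on E and yet locally
  nilpotent.\<close>

lemma simple_in_prodsp: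
  assumes X: "subco X" and Y: "subco Y" and E: "simple E" "E \<subseteq> prodsp X Y"
  shows "\<exists>C D. simple C \<and> C \<subseteq> X \<and> simple D \<and> D \<subseteq> Y \<and> E \<subseteq> prodsp C D"
proof -
  let ?P = "prodsp (X \<inter> corad) (Y \<inter> corad)"
  have sP: "subco ?P" by (intro subco_prodsp subco_Int X Y subco_corad)
  have "E \<subseteq> ?P"
  proof (rule ccontr)
    assume "\<not> E \<subseteq> ?P"
    hence "E \<inter> ?P = {0}" using simple_Int[OF E(1) sP] by blast
    then obtain f where f: "linear_form f" "\<And>x. x \<in> E \<Longrightarrow> f x = \<epsilon> x" "\<And>x. x \<in> ?P \<Longrightarrow> f x = 0"
      using form_on_direct_sum[OF simple_subspace[OF E(1)] subspace_prodsp _ eps_linear] by blast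
    have fa: "f \<in> ann ?P" using f by (intro annI)
    have nil: "\<exists>n. (la f ^^ n) z = 0" if "z \<in> prodsp X Y" for z
      using that unfolding prodsp_def
    proof (induction rule: span_induct_alt)
      case base
      show ?case by (intro exI[of _ 0]) simp
    next
      case (step c w z)
      then obtain x y where xy: "x \<in> X" "y \<in> Y" "w = x \<cdot> y" by blast
      obtain X' where X': "subco X'" "fin_dim X'" "x \<in> X'" using fin_dim_subco_exists by blast
      obtain Y' where Y': "subco Y'" "fin_dim Y'" "y \<in> Y'" using fin_dim_subco_exists by blast
      have "w \<in> prodsp (X \<inter> X') (Y \<inter> Y')" using xy X' Y' by (auto intro: prodspI)
      from la_nilpotent_prod[OF X Y fa subco_left_stable[OF subco_Int[OF X X'(1)]] fin_dim_mono[OF _ X'(2)] _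
          subco_left_stable[OF subco_Int[OF Y Y'(1)]] fin_dim_mono[OF _ Y'(2)] _ this]
      obtain n where "(la f ^^ n) w = 0" by auto
      moreover from step obtain m where "(la f ^^ m) z = 0" by blast
      ultimately show ?case using nilpotent_add[OF f(1)] by blast
    qed
    have "z = 0" if z: "z \<in> E" for z
    proof -
      have "la f z = z" using la_cong[OF simple_subco[OF E(1)] z f(1) eps_linear f(2)] by simp
      hence "(la f ^^ n) z = z" for n by (induction n) auto
      with nil[of z] E(2) z show ?thesis by auto
    qed
    then show False using simple_nonzero[OF E(1)] by blast
  qed
  \<comment> \<open>The product of the coradicals is spanned by the products of simple pairs, and a
    simple E in such a sum lies in one of them.\<close>
  let ?\<P> = "{prodsp C D | C D. simple C \<and> C \<subseteq> X \<and> simple D \<and> D \<subseteq> Y}"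
  have "?P \<subseteq> span (\<Union>?\<P>)"
  proof (rule prodsp_subset)
    fix x y assume "x \<in> X \<inter> corad" "y \<in> Y \<inter> corad"
    hence x: "x \<in> span (\<Union>{C. simple C \<and> C \<subseteq> X})" and y: "y \<in> span (\<Union>{C. simple C \<and> C \<subseteq> Y})"
      using subco_Int_corad X Y by auto
    have "x \<cdot> d \<in> span (\<Union>?\<P>)" if "simple D" "D \<subseteq> Y" "d \<in> D" for D d
    proof (rule span_image_in[OF mul_linear_left subspace_span _ x])
      fix c assume "c \<in> \<Union>{C. simple C \<and> C \<subseteq> X}"
      then obtain C where "simple C" "C \<subseteq> X" "c \<in> C" by blast
      with that prodspI[of c C d D] show "c \<cdot> d \<in> span (\<Union>?\<P>)" by (intro span_base) blast
    qed
    then show "x \<cdot> y \<in> span (\<Union>?\<P>)"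
      by (intro span_image_in[OF mul_linear_right subspace_span _ y]) blast
  qed simp
  with \<open>E \<subseteq> ?P\<close> have "E \<subseteq> span (\<Union>?\<P>)" by blast
  from simple_in_span_Union[OF E(1) this] subco_prodsp simple_subco show ?thesis by blast
qed

lemma la_S: "linear_form f \<Longrightarrow> la f (S x) = S (ra (\<lambda>u. f (S u)) x)"
  unfolding la_def ra_def
  by (subst sw_S[OF vector_space_axioms], rule bilinI)
    (intro lin_rules | assumption | simp add: sw_app[OF S_linear] linmap_scale[OF S_linear])+

lemma ra_S: "linear_form f \<Longrightarrow> ra f (S x) = S (la (\<lambda>u. f (S u)) x)"
  unfolding la_def ra_def
  by (subst sw_S[OF vector_space_axioms], rule bilinI)
    (intro lin_rules | assumption | simp add: sw_app[OF S_linear] linmap_scale[OF S_linear])+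

lemma subco_S:
  assumes "subco X"
  shows "subco (S ` X)"
proof (rule subcoI)
  show "subspace (S ` X)" by (rule subspace_linear_image[OF S_linear subco_subspace[OF assms]])
  fix f y assume f: "linear_form f" and "y \<in> S ` X"
  then obtain x where x: "x \<in> X" "y = S x" by blast
  have fS: "linear_form (\<lambda>u. f (S u))" by (rule linmap_compose[OF f S_linear])
  show "la f y \<in> S ` X" "ra f y \<in> S ` X"
    using x subco_la[OF assms fS] subco_ra[OF assms fS] by (auto simp: la_S[OF f] ra_S[OF f])
qed

subsection \<open>Sweedler identities\<close>

lemma lin_part_form: "linear_op f \<Longrightarrow> linear_form (\<lambda>x. part_form \<A> (f x))"
  by (rule linmap_compose[OF part_form(1)])

lemma lin_part_proj: "linear_op f \<Longrightarrow> linear_op (\<lambda>x. part_proj \<A> (f x))"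
  by (rule linmap_compose[OF part_proj_linear])

lemma lin_la_form: "linear_form f \<Longrightarrow> linear_op g \<Longrightarrow> linear_op (\<lambda>x. la f (g x))"
  by (rule linmap_compose[OF la_linear])

lemma lin_ra_form: "linear_form f \<Longrightarrow> linear_op g \<Longrightarrow> linear_op (\<lambda>x. ra f (g x))"
  by (rule linmap_compose[OF ra_linear])

lemmas lin_all = lin_part_form lin_part_proj lin_la_form lin_ra_form lin_rules

lemma la_mul_S:
  assumes e: "linear_form e"
  shows "la e (x \<cdot> S y) = sw (\<lambda>a b. sw (\<lambda>c d. scale (e (b \<cdot> S c)) (a \<cdot> S d)) y) x"
  unfolding la_def
  by (rule sw_mul_S[OF vector_space_axioms], rule bilinI) (intro lin_all e)+

lemma ra_mul_S:
  assumes e: "linear_form e"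
  shows "ra e (x \<cdot> S y) = sw (\<lambda>a b. sw (\<lambda>c d. scale (e (a \<cdot> S d)) (b \<cdot> S c)) y) x"
  unfolding ra_def
  by (rule sw_mul_S[OF vector_space_axioms], rule bilinI) (intro lin_all e)+

lemma ra_mul:
  assumes e: "linear_form e"
  shows "ra e (x \<cdot> y) = sw (\<lambda>a b. sw (\<lambda>c d. scale (e (a \<cdot> c)) (b \<cdot> d)) y) x"
  unfolding ra_def
  by (rule sw_mul[OF vector_space_axioms], rule bilinI) (intro lin_all e)+

text \<open>Spelled out, the left side is x_1 e(x_2 S(b_1)) S(b_2) b_3. For e = \<lambda> this is
  the dual basis identity.\<close>

lemma sw_la_mul_S_mul:
  assumes e: "linear_form e"
  shows "sw (\<lambda>b1 b2. la e (x \<cdot> S b1) \<cdot> b2) b = la (\<lambda>u. e (u \<cdot> S b)) x"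
proof -
  note lin = linmap_compose[OF e] lin_all
  have collapse: "sw (\<lambda>b1 b2. sw (\<lambda>c d. scale (e (a' \<cdot> S c)) ((a \<cdot> S d) \<cdot> b2)) b1) b = scale (e (a' \<cdot> S b)) a" for a a'
  proof -
    have "sw (\<lambda>b1 b2. sw (\<lambda>c d. scale (e (a' \<cdot> S c)) ((a \<cdot> S d) \<cdot> b2)) b1) b =
        sw (\<lambda>c r. sw (\<lambda>d b2. scale (e (a' \<cdot> S c)) ((a \<cdot> S d) \<cdot> b2)) r) b"
      by (rule coassoc_op, rule trilinI) (intro lin)+
    also have "\<dots> = sw (\<lambda>c r. scale (\<epsilon> r) (scale (e (a' \<cdot> S c)) (a \<cdot> one))) b"
      unfolding mul_assoc
      by (subst antipode_left[where t = scale and G = "\<lambda>z. scale (e (a' \<cdot> S _)) (a \<cdot> z)"]) (intro lin refl)+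
    also have "\<dots> = scale (e (a' \<cdot> S b)) (a \<cdot> one)"
      by (rule counit_right) (intro lin)
    finally show ?thesis by simp
  qed
  have "sw (\<lambda>b1 b2. la e (x \<cdot> S b1) \<cdot> b2) b =
      sw (\<lambda>b1 b2. sw (\<lambda>a a'. sw (\<lambda>c d. scale (e (a' \<cdot> S c)) ((a \<cdot> S d) \<cdot> b2)) b1) x) b"
    by (simp add: la_mul_S[OF e] sw_app[OF mul_linear_left] mul_scale_left)
  also have "\<dots> = sw (\<lambda>a a'. sw (\<lambda>b1 b2. sw (\<lambda>c d. scale (e (a' \<cdot> S c)) ((a \<cdot> S d) \<cdot> b2)) b1) b) x"
    by (rule sw_swap)
  finally show ?thesis by (simp add: collapse la_def)
qed

text \<open>Here d_2 S(d_3) cancels in e(x_1 d_1) x_2 d_2 S(d_3). It recovers x from a product with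
  d, as the link argument requires.\<close>

lemma sw_ra_mul_mul_S:
  assumes e: "linear_form e"
  shows "sw (\<lambda>d1 d2. ra e (x \<cdot> d1) \<cdot> S d2) d = ra (\<lambda>u. e (u \<cdot> d)) x"
proof -
  note lin = linmap_compose[OF e] lin_all
  have collapse: "sw (\<lambda>d1 d2. sw (\<lambda>c c'. scale (e (a \<cdot> c)) ((a' \<cdot> c') \<cdot> S d2)) d1) d = scale (e (a \<cdot> d)) a'" for a a'
  proof -
    have "sw (\<lambda>d1 d2. sw (\<lambda>c c'. scale (e (a \<cdot> c)) ((a' \<cdot> c') \<cdot> S d2)) d1) d =
        sw (\<lambda>c r. sw (\<lambda>c' d2. scale (e (a \<cdot> c)) ((a' \<cdot> c') \<cdot> S d2)) r) d"
      by (rule coassoc_op, rule trilinI) (intro lin)+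
    also have "\<dots> = sw (\<lambda>c r. scale (\<epsilon> r) (scale (e (a \<cdot> c)) (a' \<cdot> one))) d"
      unfolding mul_assoc
      by (subst antipode_right[where t = scale and G = "\<lambda>z. scale (e (a \<cdot> _)) (a' \<cdot> z)"]) (intro lin refl)+
    also have "\<dots> = scale (e (a \<cdot> d)) (a' \<cdot> one)"
      by (rule counit_right) (intro lin)
    finally show ?thesis by simp
  qed
  have "sw (\<lambda>d1 d2. ra e (x \<cdot> d1) \<cdot> S d2) d =
      sw (\<lambda>d1 d2. sw (\<lambda>a a'. sw (\<lambda>c c'. scale (e (a \<cdot> c)) ((a' \<cdot> c') \<cdot> S d2)) d1) x) d"
    by (simp add: ra_mul[OF e] sw_app[OF mul_linear_left] mul_scale_left)
  also have "\<dots> = sw (\<lambda>a a'. sw (\<lambda>d1 d2. sw (\<lambda>c c'. scale (e (a \<cdot> c)) ((a' \<cdot> c') \<cdot> S d2)) d1) d) x"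
    by (rule sw_swap)
  finally show ?thesis by (simp add: collapse ra_def)
qed

text \<open>In e(x_1 S(b_3)) x_2 S(b_2) S(S(b_1)) the last two factors are S(S(b_1) b_2). The square
  of S that appears is the source of \<open>S_S_simple\<close>.\<close>

lemma sw_ra_mul_S_mul_SS:
  assumes e: "linear_form e"
  shows "sw (\<lambda>b1 b2. ra e (x \<cdot> S b2) \<cdot> S (S b1)) b = ra (\<lambda>u. e (u \<cdot> S b)) x"
proof -
  note lin = linmap_compose[OF e] lin_all
  have collapse: "sw (\<lambda>b1 b2. sw (\<lambda>c d. scale (e (a \<cdot> S d)) (a' \<cdot> S (S b1 \<cdot> c))) b2) b = scale (e (a \<cdot> S b)) a'" for a a'
  proof -
    have "sw (\<lambda>b1 b2. sw (\<lambda>c d. scale (e (a \<cdot> S d)) (a' \<cdot> S (S b1 \<cdot> c))) b2) b =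
        sw (\<lambda>p d. sw (\<lambda>b1 c. scale (e (a \<cdot> S d)) (a' \<cdot> S (S b1 \<cdot> c))) p) b"
      by (rule coassoc_op[symmetric], rule trilinI) (intro lin)+
    also have "\<dots> = sw (\<lambda>p d. scale (\<epsilon> p) (scale (e (a \<cdot> S d)) (a' \<cdot> S one))) b"
      by (subst antipode_left[where t = scale and G = "\<lambda>z. scale (e (a \<cdot> S _)) (a' \<cdot> S z)"]) (intro lin refl)+
    also have "\<dots> = scale (e (a \<cdot> S b)) (a' \<cdot> S one)"
      by (rule counit_left) (intro lin)
    finally show ?thesis by simp
  qed
  have "sw (\<lambda>b1 b2. ra e (x \<cdot> S b2) \<cdot> S (S b1)) b =
      sw (\<lambda>b1 b2. sw (\<lambda>a a'. sw (\<lambda>c d. scale (e (a \<cdot> S d)) (a' \<cdot> S (S b1 \<cdot> c))) b2) x) b"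
    by (simp add: ra_mul_S[OF e] sw_app[OF mul_linear_left] mul_scale_left mul_assoc S_mul)
  also have "\<dots> = sw (\<lambda>a a'. sw (\<lambda>b1 b2. sw (\<lambda>c d. scale (e (a \<cdot> S d)) (a' \<cdot> S (S b1 \<cdot> c))) b2) b) x"
    by (rule sw_swap)
  finally show ?thesis by (simp add: collapse ra_def)
qed

text \<open>Here S(y_1) y_2 cancels in S(y_1) y_2 e(y_3 S(b_1)) S(b_2).\<close>

lemma sw_S_mul_la_mul_S:
  assumes e: "linear_form e"
  shows "sw (\<lambda>y1 y2. S y1 \<cdot> la e (y2 \<cdot> S b)) y = sw (\<lambda>b1 b2. scale (e (y \<cdot> S b1)) (S b2)) b"
proof -
  note lin = linmap_compose[OF e] lin_all
  have collapse: "sw (\<lambda>y1 y2. sw (\<lambda>p q. scale (e (q \<cdot> S c)) ((S y1 \<cdot> p) \<cdot> S d)) y2) y = scale (e (y \<cdot> S c)) (S d)" for c d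
  proof -
    have "sw (\<lambda>y1 y2. sw (\<lambda>p q. scale (e (q \<cdot> S c)) ((S y1 \<cdot> p) \<cdot> S d)) y2) y =
        sw (\<lambda>r q. sw (\<lambda>y1 p. scale (e (q \<cdot> S c)) ((S y1 \<cdot> p) \<cdot> S d)) r) y"
      by (rule coassoc_op[symmetric], rule trilinI) (intro lin)+
    also have "\<dots> = sw (\<lambda>r q. scale (\<epsilon> r) (scale (e (q \<cdot> S c)) (one \<cdot> S d))) y"
      by (subst antipode_left[where t = scale and G = "\<lambda>z. scale (e (_ \<cdot> S c)) (z \<cdot> S d)"]) (intro lin refl)+
    also have "\<dots> = scale (e (y \<cdot> S c)) (one \<cdot> S d)"
      by (rule counit_left) (intro lin)
    finally show ?thesis by simp
  qed
  have "sw (\<lambda>y1 y2. S y1 \<cdot> la e (y2 \<cdot> S b)) y =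
      sw (\<lambda>y1 y2. sw (\<lambda>p q. sw (\<lambda>c d. scale (e (q \<cdot> S c)) ((S y1 \<cdot> p) \<cdot> S d)) b) y2) y"
    by (simp add: la_mul_S[OF e] sw_app[OF mul_linear_right] mul_scale_right mul_assoc)
  also have "\<dots> = sw (\<lambda>y1 y2. sw (\<lambda>c d. sw (\<lambda>p q. scale (e (q \<cdot> S c)) ((S y1 \<cdot> p) \<cdot> S d)) y2) b) y"
    by (subst sw_swap) (rule refl)
  also have "\<dots> = sw (\<lambda>c d. sw (\<lambda>y1 y2. sw (\<lambda>p q. scale (e (q \<cdot> S c)) ((S y1 \<cdot> p) \<cdot> S d)) y2) y) b"
    by (rule sw_swap)
  finally show ?thesis by (simp add: collapse)
qed

subsection \<open>The averaging operator\<close>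

text \<open>
  Let \<open>\<pi>\<close> be a projection of the Hopf algebra onto a part \<open>K\<close> and \<open>\<lambda> = \<epsilon> \<circ> \<pi>\<close>. The map
  \<open>average\<close> sends an endomorphism \<open>a\<close> of a comodule \<open>V\<close>, seen as an element of \<open>V \<otimes> V\<^sup>*\<close>,
  to its component in the \<open>K\<close>-part of the comodule \<open>V \<otimes> V\<^sup>*\<close>. That part is a subalgebra of the endomorphism
  algebra, and \<open>average\<close> is a bimodule map over it.
\<close>

definition tw :: "('b \<Rightarrow> 'a) \<Rightarrow> 'b \<Rightarrow> 'b \<Rightarrow> 'b" where
  "tw e p = ra (\<lambda>u. e (p \<cdot> S u))"

definition average :: "('b \<Rightarrow> 'a) \<Rightarrow> ('b \<Rightarrow> 'b) \<Rightarrow> 'b \<Rightarrow> 'b" where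
  "average e a = sw (\<lambda>d1 d2. tw e d1 (a d2))"

lemma tw_sw: "tw e p y = sw (\<lambda>u v. scale (e (p \<cdot> S u)) v) y"
  by (simp add: tw_def ra_def)

lemma lin_tw_left:
  assumes e: "linear_form e" and f: "linear_op f"
  shows "linear_op (\<lambda>x. tw e (f x) y)"
  unfolding tw_sw by (intro lin_all linmap_compose[OF e] f)

lemma lin_tw_right:
  assumes e: "linear_form e" and f: "linear_op f"
  shows "linear_op (\<lambda>x. tw e p (f x))"
  unfolding tw_def by (intro lin_all linmap_compose[OF e] f)

lemma average_linear: "linear_form e \<Longrightarrow> linear_op a \<Longrightarrow> linear_op (average e a)"
  unfolding average_def
  by (rule sw_linear[OF vector_space_axioms bilinI]) (intro lin_tw_left lin_tw_right lin_id, assumption)+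

text \<open>For the identity the average is e(d_1 S(d_2)) d_3, where the antipode axiom
  applies.\<close>

lemma average_id:
  assumes e: "linear_form e" "e one = 1"
  shows "average e (\<lambda>x. x) d = d"
proof -
  note lin = linmap_compose[OF e(1)] lin_all
  have "average e (\<lambda>x. x) d = sw (\<lambda>d1 r. sw (\<lambda>d2 d3. scale (e (d1 \<cdot> S d2)) d3) r) d"
    by (simp add: average_def tw_sw)
  also have "\<dots> = sw (\<lambda>p d3. sw (\<lambda>d1 d2. scale (e (d1 \<cdot> S d2)) d3) p) d"
    by (rule coassoc_op[symmetric], rule trilinI) (intro lin)+
  also have "\<dots> = sw (\<lambda>p d3. scale (\<epsilon> p) (scale (e one) d3)) d"
    by (subst antipode_right[where t = scale and G = "\<lambda>z. scale (e z) _"]) (intro lin refl)+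
  also have "\<dots> = d" using counit_left[OF lin_id] e(2) by simp
  finally show ?thesis .
qed

text \<open>When \<open>la e\<close> is the projection onto K, the two assumptions say that e(k h)
  and e(h k) equal \<epsilon>(k) e(h) for k in K, because \<epsilon> composed with
  \<open>la e\<close> is e.\<close>

context
  fixes e :: "'b \<Rightarrow> 'a"
  assumes e: "linear_form e"
    and inv_left: "\<And>x h. e (la e x \<cdot> h) = e x * e h"
    and inv_right: "\<And>x h. e (h \<cdot> la e x) = e h * e x"
begin

private lemmas lin_avg = linmap_compose[OF e] lin_tw_left[OF e] lin_tw_right[OF e] lin_all

lemma tw_scale: "tw e (scale c p) y = scale c (tw e p y)" "tw e p (scale c y) = scale c (tw e p y)"
  using linmap_scale[OF lin_tw_left[OF e lin_id]] linmap_scale[OF lin_tw_right[OF e lin_id]] by auto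

lemma tw_la_mul: "tw e (la e x \<cdot> h) y = scale (e x) (tw e h y)"
  unfolding tw_sw by (simp add: mul_assoc inv_left sw_app[OF lin_scale[OF lin_id]])

text \<open>The coefficients of \<open>tw e d2\<close> act on p as forms.
  \<open>sw_la_mul_S_mul\<close> rewrites that action through \<open>la e (p S(b_1))\<close>, and
  \<open>tw_la_mul\<close> pulls this factor out as a scalar.\<close>

lemma sw_tw_tw:
  assumes a: "linear_op a"
  shows "sw (\<lambda>d1 d2. tw e d1 (a (tw e d2 z))) p = average e a (tw e p z)"
proof -
  note lina = linmap_compose[OF a] lin_avg
  have inner: "sw (\<lambda>d1 d2. scale (e (d2 \<cdot> S w)) (tw e d1 (a z'))) p = sw (\<lambda>b1 b2. scale (e (p \<cdot> S b1)) (tw e b2 (a z'))) w"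
    for w z'
  proof -
    have "sw (\<lambda>d1 d2. scale (e (d2 \<cdot> S w)) (tw e d1 (a z'))) p = tw e (la (\<lambda>u. e (u \<cdot> S w)) p) (a z')"
      unfolding la_def by (subst sw_app[OF lin_tw_left[OF e lin_id]]) (simp add: tw_scale)
    also have "\<dots> = tw e (sw (\<lambda>b1 b2. la e (p \<cdot> S b1) \<cdot> b2) w) (a z')"
      by (simp only: sw_la_mul_S_mul[OF e])
    also have "\<dots> = sw (\<lambda>b1 b2. scale (e (p \<cdot> S b1)) (tw e b2 (a z'))) w"
      by (subst sw_app[OF lin_tw_left[OF e lin_id]]) (simp add: tw_la_mul)
    finally show ?thesis .
  qed
  have "sw (\<lambda>d1 d2. tw e d1 (a (tw e d2 z))) p =
      sw (\<lambda>d1 d2. sw (\<lambda>z1 z'. scale (e (d2 \<cdot> S z1)) (tw e d1 (a z'))) z) p"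
    unfolding tw_sw[of e _ z]
    by (simp add: sw_app[OF lin_tw_right[OF e a]] linmap_scale[OF a] tw_scale)
  also have "\<dots> = sw (\<lambda>w z'. sw (\<lambda>d1 d2. scale (e (d2 \<cdot> S w)) (tw e d1 (a z'))) p) z"
    by (rule sw_swap)
  also have "\<dots> = sw (\<lambda>w z'. sw (\<lambda>b1 b2. scale (e (p \<cdot> S b1)) (tw e b2 (a z'))) w) z"
    by (simp only: inner)
  also have "\<dots> = sw (\<lambda>b1 r. sw (\<lambda>b2 z'. scale (e (p \<cdot> S b1)) (tw e b2 (a z'))) r) z"
    by (rule coassoc_op, rule trilinI) (intro lina)+
  also have "\<dots> = sw (\<lambda>b1 r. scale (e (p \<cdot> S b1)) (average e a r)) z"
    by (simp add: average_def sw_app[OF lin_scale[OF lin_id]])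
  also have "\<dots> = average e a (tw e p z)"
    unfolding tw_sw by (simp add: sw_app[OF average_linear[OF e a]] linmap_scale[OF average_linear[OF e a]])
  finally show ?thesis .
qed

text \<open>The coefficients of z combine to e(y S(z_1)) S(z_2), which
  \<open>sw_S_mul_la_mul_S\<close> exchanges for S(y_1) times a projected element;
  \<open>inv_right\<close> splits that off.\<close>

lemma tw_tw: "tw e p (tw e y z) = sw (\<lambda>p1 p2. scale (e (p \<cdot> S p1)) (tw e p2 z)) y"
proof -
  have inner: "sw (\<lambda>z1 z2. scale (e (y \<cdot> S z1) * e (p \<cdot> S z2)) z3) w =
      sw (\<lambda>p1 p2. scale (e (p \<cdot> S p1) * e (p2 \<cdot> S w)) z3) y" for w z3
  proof -
    have "sw (\<lambda>z1 z2. scale (e (y \<cdot> S z1) * e (p \<cdot> S z2)) z3) w =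
        scale (e (p \<cdot> sw (\<lambda>z1 z2. scale (e (y \<cdot> S z1)) (S z2)) w)) z3"
      by (subst sw_app[OF lin_scale_left[OF linmap_compose[OF e mul_linear_right]]])
        (simp add: mul_scale_right linmap_scale[OF e])
    also have "\<dots> = scale (e (p \<cdot> sw (\<lambda>y1 y2. S y1 \<cdot> la e (y2 \<cdot> S w)) y)) z3"
      by (simp only: sw_S_mul_la_mul_S[OF e])
    also have "\<dots> = sw (\<lambda>p1 p2. scale (e (p \<cdot> S p1) * e (p2 \<cdot> S w)) z3) y"
      by (subst sw_app[OF lin_scale_left[OF linmap_compose[OF e mul_linear_right]]])
        (simp add: mul_assoc[symmetric] inv_right)
    finally show ?thesis .
  qed
  have "tw e p (tw e y z) = sw (\<lambda>z1 r. sw (\<lambda>z2 z3. scale (e (y \<cdot> S z1) * e (p \<cdot> S z2)) z3) r) z"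
    unfolding tw_sw[of e y z]
    by (simp add: sw_app[OF lin_tw_right[OF e lin_id]] tw_scale)
      (simp add: tw_sw sw_app[OF lin_scale[OF lin_id]])
  also have "\<dots> = sw (\<lambda>w z3. sw (\<lambda>z1 z2. scale (e (y \<cdot> S z1) * e (p \<cdot> S z2)) z3) w) z"
    by (rule coassoc_op[symmetric], rule trilinI) (intro lin_avg)+
  also have "\<dots> = sw (\<lambda>w z3. sw (\<lambda>p1 p2. scale (e (p \<cdot> S p1) * e (p2 \<cdot> S w)) z3) y) z"
    by (simp only: inner)
  also have "\<dots> = sw (\<lambda>p1 p2. sw (\<lambda>w z3. scale (e (p \<cdot> S p1) * e (p2 \<cdot> S w)) z3) z) y"
    by (rule sw_swap)
  finally show ?thesis by (simp add: tw_sw sw_app[OF lin_scale[OF lin_id]])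
qed

text \<open>\<open>tw_tw\<close> and coassociativity move the outer coefficient past the inner one.
  This invariance of averages is what \<open>average_average_comp\<close> rests on.\<close>

lemma tw_average:
  assumes c: "linear_op c"
  shows "tw e p (average e c y) = average e c (tw e p y)"
proof -
  note linc = linmap_compose[OF c] lin_avg
  have "tw e p (average e c y) = sw (\<lambda>y' y3. tw e p (tw e y' (c y3))) y"
    unfolding average_def by (rule sw_app[OF lin_tw_right[OF e lin_id]])
  also have "\<dots> = sw (\<lambda>y' y3. sw (\<lambda>p1 p2. scale (e (p \<cdot> S p1)) (tw e p2 (c y3))) y') y"
    by (simp only: tw_tw)
  also have "\<dots> = sw (\<lambda>p1 r. sw (\<lambda>p2 y3. scale (e (p \<cdot> S p1)) (tw e p2 (c y3))) r) y"
    by (rule coassoc_op, rule trilinI) (intro linc)+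
  also have "\<dots> = sw (\<lambda>p1 r. scale (e (p \<cdot> S p1)) (average e c r)) y"
    by (simp add: average_def sw_app[OF lin_scale[OF lin_id]])
  also have "\<dots> = average e c (tw e p y)"
    unfolding tw_sw by (simp add: sw_app[OF average_linear[OF e c]] linmap_scale[OF average_linear[OF e c]])
  finally show ?thesis .
qed

lemma average_comp_average:
  assumes a: "linear_op a" and c: "linear_op c"
  shows "average e (\<lambda>x. a (average e c x)) d = average e a (average e c d)"
proof -
  note linc = linmap_compose[OF a] linmap_compose[OF c] lin_avg
  have "average e (\<lambda>x. a (average e c x)) d = sw (\<lambda>d1 r. sw (\<lambda>d2 d3. tw e d1 (a (tw e d2 (c d3)))) r) d"
    by (simp add: average_def sw_app[OF lin_tw_right[OF e a]])
  also have "\<dots> = sw (\<lambda>p d3. sw (\<lambda>d1 d2. tw e d1 (a (tw e d2 (c d3)))) p) d"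
    by (rule coassoc_op[symmetric], rule trilinI) (intro linc)+
  also have "\<dots> = sw (\<lambda>p d3. average e a (tw e p (c d3))) d"
    by (simp only: sw_tw_tw[OF a])
  also have "\<dots> = average e a (average e c d)"
    unfolding average_def[of e c] by (rule sw_app[OF average_linear[OF e a], symmetric])
  finally show ?thesis .
qed

lemma average_average_comp:
  assumes a: "linear_op a" and c: "linear_op c"
  shows "average e (\<lambda>x. average e c (a x)) d = average e c (average e a d)"
proof -
  have "average e (\<lambda>x. average e c (a x)) d = sw (\<lambda>d1 d2. average e c (tw e d1 (a d2))) d"
    by (simp only: average_def[of e "\<lambda>x. average e c (a x)"] tw_average[OF c])
  also have "\<dots> = average e c (average e a d)"
    unfolding average_def[of e a] by (rule sw_app[OF average_linear[OF e c], symmetric])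
  finally show ?thesis .
qed

end

lemma sw_SS:
  assumes t: "vector_space t" and B: "bilin t B"
  shows "sw B (S (S x)) = sw (\<lambda>a b. B (S (S a)) (S (S b))) x"
proof -
  note lin = linmap_compose[OF bilin_left[OF B]] linmap_compose[OF bilin_right[OF B]] lin_rules
  have "sw B (S (S x)) = sw (\<lambda>a b. B (S b) (S a)) (S x)" by (rule sw_S[OF t B])
  also have "\<dots> = sw (\<lambda>a b. B (S (S a)) (S (S b))) x"
    by (rule sw_S[OF t], rule bilinI) (intro lin)+
  finally show ?thesis .
qed

context
  fixes e :: "'b \<Rightarrow> 'a" and D :: "'b set"
  assumes e: "linear_form e" "e one = 1"
    and inv_left: "\<And>x h. e (la e x \<cdot> h) = e x * e h"
    and inv_right: "\<And>x h. e (h \<cdot> la e x) = e h * e x"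
    and D: "simple D" and SSD: "S ` S ` D = D"
begin

private lemmas lin = linmap_compose[OF e(1)] lin_tw_left[OF e(1)] lin_tw_right[OF e(1)] lin_all
private lemmas sD = simple_subco[OF D] subco_subspace[OF simple_subco[OF D]]

private definition \<phi> :: "'b \<Rightarrow> 'b \<Rightarrow> 'a" where "\<phi> b = (\<lambda>u. e (u \<cdot> S b))"

lemma lin_phi: "linear_form (\<phi> b)"
  unfolding \<phi>_def by (intro lin)

lemma lin_phi': "linear_form (\<lambda>b. \<phi> b u)"
  unfolding \<phi>_def by (intro lin)

text \<open>So the forms \<open>\<epsilon> - \<phi> c\<close> are closed under convolution: the
  product for c1 and c is the one for \<open>c + c1 - la (\<phi> c1) c\<close>.\<close>

lemma conv_phi: "conv (\<phi> c) (\<phi> b) x = \<phi> (la (\<phi> c) b) x"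
proof -
  have "conv (\<phi> c) (\<phi> b) x = \<phi> c (sw (\<lambda>b1 b2. la e (x \<cdot> S b1) \<cdot> b2) b)"
    unfolding form_la[OF lin_phi, symmetric] by (subst sw_la_mul_S_mul[OF e(1)]) (simp add: \<phi>_def)
  also have "\<dots> = sw (\<lambda>b1 b2. e (x \<cdot> S b1) * \<phi> c b2) b"
    unfolding sw_app[OF lin_phi] by (simp add: \<phi>_def mul_assoc inv_left)
  also have "\<dots> = \<phi> (la (\<phi> c) b) x"
    unfolding la_def sw_app[OF lin_phi'] linmap_scale[OF lin_phi'] by (simp add: \<phi>_def mult.commute)
  finally show ?thesis .
qed

private definition r1 :: "('b \<Rightarrow> 'a) \<Rightarrow> 'b \<Rightarrow> 'b \<Rightarrow> 'b" where "r1 f b = (\<lambda>y. scale (f y) b)"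

private lemma lin_r1: "linear_form f \<Longrightarrow> linear_op (r1 f b)"
  unfolding r1_def by (rule lin_scale_left)

text \<open>The larger this space, the less of f survives averaging. Once it is all of D, f vanishes
  on D.\<close>

private definition N :: "('b \<Rightarrow> 'a) \<Rightarrow> 'b set" where "N f = {b \<in> D. \<forall>x\<in>D. average e (r1 f b) x = 0}"

private lemma average_in: "linear_op a \<Longrightarrow> (\<And>x. a x \<in> D) \<Longrightarrow> average e a x \<in> D"
  unfolding average_def sw_def case_prod_unfold
  by (intro subspace_sum_list sD) (simp add: tw_def subco_ra[OF sD(1)] lin)

private lemma average_cong:
  assumes "linear_op a" "linear_op a'" "\<And>x. x \<in> D \<Longrightarrow> a x = a' x" "x \<in> D"
  shows "average e a x = average e a' x"
  unfolding average_def
proof (rule sw_cong_subco[OF vector_space_axioms _ _ sD(1) assms(4)])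
  show "bilin scale (\<lambda>d1 d2. tw e d1 (a d2))" "bilin scale (\<lambda>d1 d2. tw e d1 (a' d2))"
    by (rule bilinI; intro lin assms(1,2))+
qed (simp add: assms(3))

private lemma average_r1: "linear_form f \<Longrightarrow> average e (r1 f b) x = sw (\<lambda>x1 x2. scale (f x2) (tw e x1 b)) x"
  unfolding average_def r1_def by (simp add: tw_scale[OF e(1) inv_left inv_right])

text \<open>
  Among the forms \<open>f = \<epsilon> - \<phi> c\<close> we choose one with \<open>N f\<close> maximal. If there is \<open>b0\<close> outside of \<open>N f\<close>, the
  average \<open>w\<close> of \<open>f(_) b0\<close> has a generalized inverse \<open>y\<close>, whose average \<open>y'\<close> is again one as averaging is a
  bimodule map. The idempotent \<open>e1 = y' \<circ> w\<close> is the average of \<open>f(_) b1\<close>, and \<open>f - f \<circ> e1\<close> contradicts the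
  choice of \<open>f\<close>.
\<close>

lemma counit_represented: "\<exists>b\<in>D. \<forall>d\<in>D. e (d \<cdot> S b) = \<epsilon> d"
proof -
  note avg_lin = average_linear[OF e(1)]
  note comp1 = average_comp_average[OF e(1) inv_left inv_right]
  note comp2 = average_average_comp[OF e(1) inv_left inv_right]
  have lf: "linear_form (\<lambda>u. \<epsilon> u - \<phi> c u)" for c by (intro lin_diff_form eps_linear lin_phi)
  have subN: "subspace (N f)" if f: "linear_form f" for f
  proof (rule subspaceI)
    have l: "linear_op (\<lambda>b. average e (r1 f b) x)" for x
      unfolding average_r1[OF f] by (intro lin)
    show "0 \<in> N f" using linmap_0[OF l] subspace_0[OF sD(2)] by (simp add: N_def)
    show "a + b \<in> N f" if "a \<in> N f" "b \<in> N f" for a b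
      using that linmap_add[OF l, of a b] subspace_add[OF sD(2)] by (simp add: N_def)
    show "scale c a \<in> N f" if "a \<in> N f" for c a
      using that linmap_scale[OF l, of c a] subspace_scale[OF sD(2)] by (simp add: N_def)
  qed
  have "\<exists>X. (\<exists>c\<in>D. X = N (\<lambda>u. \<epsilon> u - \<phi> c u)) \<and>
      (\<forall>Y. (\<exists>c\<in>D. Y = N (\<lambda>u. \<epsilon> u - \<phi> c u)) \<longrightarrow> X \<subseteq> Y \<longrightarrow> Y = X)"
    by (rule maximal_subspace_exists[of _ "N (\<lambda>u. \<epsilon> u - \<phi> 0 u)" D])
      (use simple_fin_dim[OF D] subspace_0[OF sD(2)] subN[OF lf] in \<open>auto simp: N_def\<close>)
  then obtain c where c: "c \<in> D"
    and max: "\<And>c'. c' \<in> D \<Longrightarrow> N (\<lambda>u. \<epsilon> u - \<phi> c u) \<subseteq> N (\<lambda>u. \<epsilon> u - \<phi> c' u) \<Longrightarrow>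
      N (\<lambda>u. \<epsilon> u - \<phi> c' u) = N (\<lambda>u. \<epsilon> u - \<phi> c u)" by metis
  define f where "f = (\<lambda>u. \<epsilon> u - \<phi> c u)"
  have f: "linear_form f" unfolding f_def by (rule lf)
  have DN: "D \<subseteq> N f"
  proof (rule ccontr)
    assume "\<not> D \<subseteq> N f"
    then obtain b0 where b0: "b0 \<in> D" "b0 \<notin> N f" by blast
    define w where "w = average e (r1 f b0)"
    have w: "linear_op w" unfolding w_def by (rule avg_lin[OF lin_r1[OF f]])
    have r1D: "r1 f b x \<in> D" if "b \<in> D" for f b x
      unfolding r1_def using subspace_scale[OF sD(2) that] .
    have wD: "w x \<in> D" for x
      unfolding w_def by (rule average_in[OF lin_r1[OF f] r1D[OF b0(1)]])
    \<comment> \<open>Any linear right inverse of w on its image, with values in D, is a generalized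
      inverse.\<close>
    obtain y where y: "linear_op y" "\<And>x. y x \<in> D" "\<And>x. x \<in> D \<Longrightarrow> w (y (w x)) = w x"
    proof -
      interpret vector_space_pair scale scale
        using vector_space_axioms by (simp add: vector_space_pair_def)
      have "Vector_Spaces.linear scale scale w"
        using w linmap_iff_linear[OF vector_space_axioms vector_space_axioms] by blast
      from linear_exists_right_inverse_on[OF this sD(2)] obtain g
        where g: "range g \<subseteq> D" "Vector_Spaces.linear scale scale g" "\<And>v. v \<in> w ` D \<Longrightarrow> w (g v) = v" by blast
      have "linear_op g" using g(2) linmap_iff_linear[OF vector_space_axioms vector_space_axioms] by blast
      with g that[of g] show ?thesis by blast
    qed
    define y' where "y' = average e y"
    have y': "linear_op y'" unfolding y'_def by (rule avg_lin[OF y(1)])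
    define b1 where "b1 = y' b0"
    have b1: "b1 \<in> D" unfolding b1_def y'_def by (rule average_in[OF y(1,2)])
    define e1 where "e1 = average e (r1 f b1)"
    have le1: "linear_op e1" unfolding e1_def by (rule avg_lin[OF lin_r1[OF f]])
    have e1D: "e1 x \<in> D" for x unfolding e1_def by (rule average_in[OF lin_r1[OF f] r1D[OF b1]])
    have e1_eq: "e1 x = y' (w x)" for x
    proof -
      have "e1 x = average e (\<lambda>x. y' (r1 f b0 x)) x"
        unfolding e1_def r1_def b1_def by (simp add: linmap_scale[OF y'])
      also have "\<dots> = y' (w x)" unfolding y'_def w_def by (rule comp2[OF lin_r1[OF f] y(1)])
      finally show ?thesis .
    qed
    \<comment> \<open>The bimodule property pulls w into the average: w y' w is the average of w y w
      = w, and that is w times the average of the identity.\<close>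
    have we1: "w (e1 x) = w x" if x: "x \<in> D" for x
    proof -
      have "w (e1 x) = w (average e (\<lambda>x. y (w x)) x)"
        unfolding e1_eq y'_def unfolding w_def by (simp only: comp1[OF y(1) lin_r1[OF f]])
      also have "\<dots> = average e (\<lambda>x. w (y (w x))) x"
        unfolding w_def
        by (rule comp2[symmetric, OF linmap_compose[OF y(1) avg_lin[OF lin_r1[OF f]]] lin_r1[OF f]])
      also have "\<dots> = average e (\<lambda>x. w x) x"
        by (rule average_cong[OF linmap_compose[OF w linmap_compose[OF y(1) w]] w y(3) x])
      also have "\<dots> = w (average e (\<lambda>x. x) x)"
        unfolding w_def by (rule comp2[OF lin_id lin_r1[OF f]])
      finally show ?thesis by (simp add: average_id[OF e])
    qed
    have idem: "e1 (e1 x) = e1 x" if "x \<in> D" for x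
      unfolding e1_eq[of "e1 x"] we1[OF that] by (simp add: e1_eq)
    define c1 where "c1 = la f b1"
    \<comment> \<open>The index of the convolution product of \<open>\<epsilon> - \<phi> c1\<close>
      and f; by the choice of c1, convolution of \<open>\<phi> c1\<close> with f is f composed with
      e1.\<close>
    define c' where "c' = c + c1 - la (\<phi> c1) c"
    have c1D: "c1 \<in> D" unfolding c1_def by (rule subco_la[OF sD(1) f b1])
    have c'D: "c' \<in> D" unfolding c'_def
      by (intro subspace_diff[OF sD(2)] subspace_add[OF sD(2)] c c1D subco_la[OF sD(1) lin_phi])
    define f' where "f' = (\<lambda>u. \<epsilon> u - \<phi> c' u)"
    have f'_eq: "f' u = f u - f (e1 u)" for u
    proof -
      have "f (e1 u) = sw (\<lambda>x1 x2. f x2 * sw (\<lambda>p q. e (x1 \<cdot> S p) * f q) b1) u"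
        unfolding e1_def average_r1[OF f] tw_sw
        by (simp add: sw_app[OF f] linmap_scale[OF f])
      also have "\<dots> = sw (\<lambda>x1 x2. \<phi> c1 x1 * f x2) u"
        unfolding c1_def la_def sw_app[OF lin_phi'] linmap_scale[OF lin_phi'] by (simp add: \<phi>_def mult.commute)
      also have "\<dots> = conv (\<phi> c1) f u" by (simp add: conv_def)
      also have "\<dots> = \<phi> c1 u - \<phi> (la (\<phi> c1) c) u"
        unfolding f_def conv_diff_right by (simp add: lin_phi conv_phi)
      finally show ?thesis
        unfolding f'_def f_def c'_def by (simp add: linmap_diff[OF lin_phi'] linmap_add[OF lin_phi'])
    qed
    have avg': "average e (r1 f' b) x = average e (r1 f b) x - average e (r1 f b) (e1 x)" for b x
    proof -
      have "average e (r1 f' b) x = average e (r1 f b) x - average e (\<lambda>x. r1 f b (e1 x)) x"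
        unfolding average_def r1_def f'_eq
        by (simp add: scale_left_diff_distrib linmap_diff[OF lin_tw_right[OF e(1) lin_id]] sw_diff)
      also have "average e (\<lambda>x. r1 f b (e1 x)) x = average e (r1 f b) (e1 x)"
        unfolding e1_def by (rule comp1[OF lin_r1[OF f] lin_r1[OF f]])
      finally show ?thesis .
    qed
    have "N f \<subseteq> N f'" unfolding N_def avg' using e1D by auto
    hence "N f' = N f" using max[OF c'D] unfolding f_def f'_def by blast
    \<comment> \<open>Idempotence of e1 puts b1 into the new space, so by maximality into the old
      one. Then e1 = 0 and w = w e1 = 0 on D.\<close>
    moreover have "b1 \<in> N f'"
      unfolding N_def avg' using b1 idem by (simp add: e1_def)
    ultimately have "e1 x = 0" if "x \<in> D" for x using that by (simp add: N_def e1_def)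
    hence "w x = 0" if "x \<in> D" for x using we1[OF that] that linmap_0[OF w] by simp
    with b0 show False by (simp add: N_def w_def)
  qed
  have zero: "sw (\<lambda>x1 x2. f x2 * e (x1 \<cdot> S b)) x = 0" if "x \<in> D" "b \<in> D" for x b
  proof -
    have "\<epsilon> (average e (r1 f b) x) = sw (\<lambda>x1 x2. f x2 * e (x1 \<cdot> S b)) x"
      unfolding average_r1[OF f] by (simp add: sw_app[OF eps_linear] linmap_scale[OF eps_linear] tw_def lin)
    with DN that show ?thesis by (auto simp: N_def linmap_0[OF eps_linear])
  qed
  \<comment> \<open>Use the vanishing for \<open>S (S r)\<close> in place of x. Then e(S(S(r_1))
    S(b_1)) is e(S(b_1 S(r_1))), which the antipode axiom collapses, and only f at
    \<open>S (S b)\<close> is left.\<close>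
  have f0: "f (S (S b)) = 0" if b: "b \<in> D" for b
  proof -
    have bil: "bilin (*) (\<lambda>x1 x2. f x2 * e (x1 \<cdot> S b1))" for b1
      by (rule bilinI; intro lin f)
    have "sw (\<lambda>b1 r. sw (\<lambda>r1 r2. f (S (S r2)) * e (S (S r1) \<cdot> S b1)) r) b =
        sw (\<lambda>b1 r. sw (\<lambda>x1 x2. f x2 * e (x1 \<cdot> S b1)) (S (S r))) b"
      by (simp only: sw_SS[OF vector_space_times bil])
    also have "\<dots> \<in> {0}"
    proof (rule sw_in_subco[OF vector_space_times _ _ sD(1) b])
      show "bilin (*) (\<lambda>b1 r. sw (\<lambda>x1 x2. f x2 * e (x1 \<cdot> S b1)) (S (S r)))"
        by (rule bilinI; intro linmap_compose[OF f] lin f)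
      show "module.subspace (*) {0::'a}"
        by (rule module.subspace_single_0[OF module_iff_vector_space[THEN iffD2, OF vector_space_times]])
      fix u v assume "u \<in> D" "v \<in> D"
      then show "sw (\<lambda>x1 x2. f x2 * e (x1 \<cdot> S u)) (S (S v)) \<in> {0}" using zero SSD by blast
    qed
    finally have "sw (\<lambda>b1 r. sw (\<lambda>r1 r2. f (S (S r2)) * e (S (S r1) \<cdot> S b1)) r) b = 0" by simp
    moreover have "sw (\<lambda>b1 r. sw (\<lambda>r1 r2. f (S (S r2)) * e (S (S r1) \<cdot> S b1)) r) b =
        sw (\<lambda>p r2. sw (\<lambda>b1 r1. f (S (S r2)) * e (S (S r1) \<cdot> S b1)) p) b"
      by (rule coassoc_scalar[symmetric], rule trilinI) (intro linmap_compose[OF f] lin f)+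
    moreover have "sw (\<lambda>b1 r1. f (S (S r2)) * e (S (S r1) \<cdot> S b1)) p = \<epsilon> p * f (S (S r2))" for p r2
    proof -
      have "sw (\<lambda>b1 r1. f (S (S r2)) * e (S (b1 \<cdot> S r1))) p = \<epsilon> p * (f (S (S r2)) * e (S one))"
        by (rule antipode_right) (intro lin)
      then show ?thesis by (simp add: S_mul e(2))
    qed
    moreover have "sw (\<lambda>p r2. \<epsilon> p * f (S (S r2))) b = f (S (S b))"
      by (rule counit_left) (intro linmap_compose[OF f] lin)
    ultimately show ?thesis by simp
  qed
  have "e (d \<cdot> S c) = \<epsilon> d" if "d \<in> D" for d
  proof -
    have "d \<in> S ` S ` D" unfolding SSD by (rule that)
    then obtain b where b: "b \<in> D" "d = S (S b)" by (elim imageE) simp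
    have "f d = 0" unfolding b(2) by (rule f0[OF b(1)])
    then show ?thesis unfolding f_def \<phi>_def eq_iff_diff_eq_0[of "e (d \<cdot> S c)"]
      by (metis eq_iff_diff_eq_0)
  qed
  with c show ?thesis by blast
qed

end

end

section \<open>The dual Chevalley property\<close>

locale hopf_dual_chevalley = hopf +
  assumes corad_mul: "x \<in> corad \<Longrightarrow> y \<in> corad \<Longrightarrow> x \<cdot> y \<in> corad"
    and corad_S: "x \<in> corad \<Longrightarrow> S x \<in> corad"
begin

lemma op_cop: "hopf_dual_chevalley scale (\<lambda>x. map prod.swap (cop x)) \<epsilon> (\<lambda>x y. y \<cdot> x) one S"
proof -
  interpret c: hopf scale "\<lambda>x. map prod.swap (cop x)" \<epsilon> "\<lambda>x y. y \<cdot> x" one S by (rule hopf_op_cop)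
  show ?thesis by unfold_locales (simp_all add: corad_cop corad_mul corad_S)
qed

lemma la_one: "linear_form f \<Longrightarrow> la f one = scale (f one) one"
  unfolding la_def by (rule sw_one[OF vector_space_axioms bilinI]) (intro lin_all, assumption?)+

lemma ra_one: "linear_form f \<Longrightarrow> ra f one = scale (f one) one"
  unfolding ra_def by (rule sw_one[OF vector_space_axioms bilinI]) (intro lin_all, assumption?)+

lemma one_nonzero: "one \<noteq> 0"
  using eps_one linmap_0[OF eps_linear] by force

lemma simple_one: "simple (span {one})"
  unfolding simple_def
proof (intro conjI allI impI)
  show "subco (span {one})"
  proof (rule subcoI)
    fix f x assume f: "linear_form f" and "x \<in> span {one}"
    then obtain c where "x = scale c one" by (auto simp: span_singleton)
    then show "la f x \<in> span {one}" "ra f x \<in> span {one}"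
      using f by (auto simp: linmap_scale[OF la_linear] linmap_scale[OF ra_linear] la_one ra_one span_singleton)
  qed simp
  show "span {one} \<noteq> {0}" using span_base[of one "{one}"] one_nonzero by auto
  fix D assume D: "subco D \<and> D \<subseteq> span {one}"
  show "D = {0} \<or> D = span {one}"
  proof (cases "D = {0}")
    case False
    then obtain x where x: "x \<in> D" "x \<noteq> 0" using subspace_0[OF subco_subspace] D by blast
    then obtain c where c: "x = scale c one" using D by (auto simp: span_singleton)
    with x have "c \<noteq> 0" by auto
    hence "one = scale (1 / c) x" using c by simp
    hence "one \<in> D" using subspace_scale[OF subco_subspace x(1)] D by metis
    hence "span {one} \<subseteq> D" using D subco_subspace by (intro span_minimal) auto
    with D show ?thesis by blast
  qed simp
qed

text \<open>The restriction of \<open>u\<close> to the coradical is the Haar integral.\<close>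

lemma integral_exists:
  "\<exists>u. linear_form u \<and> u one = 1 \<and> (\<forall>h\<in>corad. ra u h = scale (u h) one)"
proof -
  let ?\<B> = "{C. simple C \<and> C \<noteq> span {one}}"
  let ?B = "span (\<Union>?\<B>)"
  have sB: "subco ?B" by (rule subco_span) (simp add: simple_subco)
  have "span {one} \<inter> ?B = {0}"
  proof (rule ccontr)
    assume "span {one} \<inter> ?B \<noteq> {0}"
    hence "span {one} \<subseteq> ?B" using simple_Int[OF simple_one sB] by blast
    from simple_in_span_Union[OF simple_one this] obtain C where "simple C" "C \<noteq> span {one}" "span {one} \<subseteq> C"
      by (auto simp: simple_subco)
    with simple_eq[OF simple_one] show False by blast
  qed
  then obtain u where u: "linear_form u" "\<And>x. x \<in> span {one} \<Longrightarrow> u x = \<epsilon> x" "\<And>x. x \<in> ?B \<Longrightarrow> u x = 0"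
    using form_on_direct_sum[OF _ subco_subspace[OF sB] _ eps_linear, of "span {one}"] by auto
  have u1: "u one = 1" using u(2)[OF span_base] by simp
  have "ra u h = scale (u h) one" if "h \<in> corad" for h
  proof -
    have "\<Union>{C. simple C} = span {one} \<union> \<Union>?\<B>" using simple_one by blast
    hence "corad = span (span {one} \<union> \<Union>?\<B>)" unfolding corad_def by (rule arg_cong)
    with that obtain a b where ab: "a \<in> span {one}" "b \<in> ?B" "h = a + b"
      by (auto simp: span_Un span_span)
    then obtain c where c: "a = scale c one" by (auto simp: span_singleton)
    have "ra u b = 0" using ra_ann[OF sB annI[OF u(1,3)] ab(2)] .
    then show ?thesis using ab(3) c u(3)[OF ab(2)]
      by (simp add: linmap_add[OF ra_linear[OF u(1)]] linmap_scale[OF ra_linear[OF u(1)]] ra_one[OF u(1)] u1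
          linmap_add[OF u(1)] linmap_scale[OF u(1)])
  qed
  with u(1) u1 show ?thesis by blast
qed

text \<open>For the Haar integral u, the element z = u(a_1 S(b)) a_2 of D equals u(a S(b_2))
  S(S(b_1)). A nonzero such z forces D into \<open>S^2 D\<close>, and dimensions give
  equality.\<close>

lemma S_S_simple:
  assumes D: "simple D"
  shows "S ` S ` D = D"
proof -
  note sD = simple_subco[OF D]
  obtain u where u: "linear_form u" "u one = 1" "\<And>h. h \<in> corad \<Longrightarrow> ra u h = scale (u h) one"
    using integral_exists by blast
  have cor: "a \<cdot> S b \<in> corad" if "a \<in> D" "b \<in> D" for a b
    using that simple_corad[OF D] by (intro corad_mul corad_S) auto
  \<comment> \<open>If u vanished on all a S(b), then \<epsilon>(a) = u(a_1 S(a_2)) would be zero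
    throughout D.\<close>
  have "\<exists>a\<in>D. \<exists>b\<in>D. u (a \<cdot> S b) \<noteq> 0"
  proof (rule ccontr)
    assume *: "\<not> ?thesis"
    have "\<epsilon> a = 0" if "a \<in> D" for a
    proof -
      have "sw (\<lambda>a1 a2. u (a1 \<cdot> S a2)) a \<in> {0}"
      proof (rule sw_in_subco[OF vector_space_times _ _ sD that])
        show "bilin (*) (\<lambda>a1 a2. u (a1 \<cdot> S a2))" by (rule bilinI) (intro linmap_compose[OF u(1)] lin_all)+
        show "module.subspace (*) {0::'a}"
          by (rule module.subspace_single_0[OF module_iff_vector_space[THEN iffD2, OF vector_space_times]])
      qed (use * in auto)
      then show ?thesis using antipode_right[OF u(1), of a] u(2) by simp
    qed
    with eps_nonzero[OF sD] simple_nonzero[OF D] show False by blast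
  qed
  then obtain a b where ab: "a \<in> D" "b \<in> D" "u (a \<cdot> S b) \<noteq> 0" by blast
  have luS: "linear_form (\<lambda>x. u (x \<cdot> S b))" by (intro linmap_compose[OF u(1)] lin_all)
  define z where "z = ra (\<lambda>x. u (x \<cdot> S b)) a"
  have zD: "z \<in> D" unfolding z_def by (rule subco_ra[OF sD luS ab(1)])
  have "\<epsilon> z \<noteq> 0" using ab(3) by (simp add: z_def luS)
  hence z0: "z \<noteq> 0" using linmap_0[OF eps_linear] by auto
  have sSS: "subco (S ` S ` D)" by (intro subco_S sD)
  have "z = sw (\<lambda>b1 b2. ra u (a \<cdot> S b2) \<cdot> S (S b1)) b"
    unfolding z_def by (rule sw_ra_mul_S_mul_SS[OF u(1), symmetric])
  also have "\<dots> \<in> S ` S ` D"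
  proof (rule sw_in_subco[OF vector_space_axioms _ subco_subspace[OF sSS] sD ab(2)])
    show "bilin scale (\<lambda>b1 b2. ra u (a \<cdot> S b2) \<cdot> S (S b1))"
      by (rule bilinI) (intro lin_all u(1))+
    fix b1 b2 assume b: "b1 \<in> D" "b2 \<in> D"
    have "ra u (a \<cdot> S b2) \<cdot> S (S b1) = scale (u (a \<cdot> S b2)) (S (S b1))"
      using u(3)[OF cor[OF ab(1) b(2)]] by (simp add: mul_scale_left)
    also have "\<dots> \<in> S ` S ` D" using subspace_scale[OF subco_subspace[OF sSS]] b(1) by blast
    finally show "ra u (a \<cdot> S b2) \<cdot> S (S b1) \<in> S ` S ` D" .
  qed
  finally have "D \<subseteq> S ` S ` D" using simple_Int[OF D sSS] zD z0 by blast
  moreover have "fin_dim (S ` S ` D)" "dim (S ` S ` D) \<le> dim D"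
    using fin_dim_image[OF S_linear] simple_fin_dim[OF D] by (auto intro: order_trans)
  ultimately show ?thesis using subspace_eq_if_dim_le[OF simple_subspace[OF D]] by blast
qed

text \<open>
  The forms \<open>\<gamma> = e(_ d)\<close> with \<open>d \<in> D\<close> vanish on \<open>C'\<close>, not all of them vanish on \<open>C\<close>, and by the Sweedler
  identities above they act on \<open>C \<and> C'\<close> from one side and on \<open>C' \<and> C\<close> from the other side with
  values in the coradical.
\<close>

lemma linked_product:
  assumes sat: "saturated \<A>" and C: "simple C" "simple C'" "clinked C C'" and D: "simple D"
    and E: "simple E" "E \<subseteq> prodsp C D" "E \<in> \<A>"
  shows "\<exists>E'. simple E' \<and> E' \<subseteq> prodsp C' D \<and> E' \<in> \<A>"
proof (rule ccontr)
  assume neg: "\<not> ?thesis"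
  define e where "e = part_form \<A>"
  have e: "linear_form e" unfolding e_def by (rule part_form(1))
  have la_ra_e: "la e x = ra e x" for x
    using part_proj_ra[OF sat, of x] by (simp add: part_proj_def e_def ra_def)
  note lin = linmap_compose[OF e] lin_all
  note sC = simple_subco[OF C(1)] and sC' = simple_subco[OF C(2)] and sD = simple_subco[OF D]
  note sc = subco_subspace[OF subco_corad]
  \<comment> \<open>Without simple subcoalgebras from \<A>, the product C' D lies in the
    complementary part, where e vanishes. On C D it does not vanish, as e is \<epsilon> on
    E.\<close>
  have "prodsp C' D \<subseteq> part (- \<A>)"
    using neg by (intro subco_subset_part subco_prodsp sC' sD) auto
  hence e0: "e (x \<cdot> d) = 0" if "x \<in> C'" "d \<in> D" for x d
    using prodspI[OF that] part_form(3)[of _ \<A>] by (auto simp: e_def)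
  obtain c0 d0 where c0: "c0 \<in> C" "d0 \<in> D" "e (c0 \<cdot> d0) \<noteq> 0"
  proof (rule ccontr)
    assume "\<not> thesis"
    with that have "e (x \<cdot> d) = 0" if "x \<in> C" "d \<in> D" for x d using that by blast
    hence "e \<in> ann {x \<cdot> d | x d. x \<in> C \<and> d \<in> D}" using e by (auto intro: annI)
    hence "e \<in> ann (prodsp C D)" unfolding prodsp_def ann_span .
    hence "e x = 0" if "x \<in> E" for x using that E(2) annD by blast
    moreover have "e x = \<epsilon> x" if "x \<in> E" for x
      using part_form(2)[of x \<A>] simple_part[OF E(1), of \<A>] E(3) that by (auto simp: e_def)
    ultimately show False using eps_nonzero[OF simple_subco[OF E(1)]] simple_nonzero[OF E(1)] by fastforce
  qed
  have corC: "x \<cdot> d \<in> corad" if "x \<in> C" "d \<in> D" for x d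
    using that simple_corad[OF C(1)] simple_corad[OF D] by (intro corad_mul) auto
  have C'cor: "C' \<subseteq> corad" by (rule simple_corad[OF C(2)])
  have "cwedge C C' \<subseteq> corad"
  proof
    fix f assume f: "f \<in> cwedge C C'"
    note sW = subco_cwedge[OF sC sC']
    \<comment> \<open>A two-sided ideal of forms. It contains one that is nonzero on C, hence one
      that equals \<epsilon> on C.\<close>
    define \<F> where "\<F> = {\<gamma>. \<gamma> \<in> ann C' \<and> (\<forall>f\<in>cwedge C C'. ra \<gamma> f \<in> corad)}"
    have "(\<lambda>x. e (x \<cdot> d0)) \<in> \<F>"
      unfolding \<F>_def
    proof (intro CollectI conjI ballI)
      show "(\<lambda>x. e (x \<cdot> d0)) \<in> ann C'" by (intro annI lin) (simp add: e0 c0(2))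
      fix f assume f: "f \<in> cwedge C C'"
      have "ra (\<lambda>x. e (x \<cdot> d0)) f = sw (\<lambda>d1 d2. ra e (f \<cdot> d1) \<cdot> S d2) d0"
        by (rule sw_ra_mul_mul_S[OF e, symmetric])
      also have "\<dots> \<in> corad"
      proof (rule sw_in_subco[OF vector_space_axioms _ sc sD c0(2)])
        show "bilin scale (\<lambda>d1 d2. ra e (f \<cdot> d1) \<cdot> S d2)" by (rule bilinI) (intro lin e)+
        fix d1 d2 assume d: "d1 \<in> D" "d2 \<in> D"
        \<comment> \<open>The two actions of e agree, and with \<open>la\<close> the form e meets
          the second factors: terms with second factor in C' vanish, those with first factor in C
          lie in C D, hence in the coradical.\<close>
        have "la e (f \<cdot> d1) = sw (\<lambda>a b. sw (\<lambda>c c'. scale (e (b \<cdot> c')) (a \<cdot> c)) d1) f"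
          unfolding la_def by (rule sw_mul[OF vector_space_axioms], rule bilinI) (intro lin)+
        also have "\<dots> \<in> corad"
        proof (rule sw_in_cwedge[OF vector_space_axioms _ sc subco_subspace[OF sC] subco_subspace[OF sC'] f])
          show "bilin scale (\<lambda>a b. sw (\<lambda>c c'. scale (e (b \<cdot> c')) (a \<cdot> c)) d1)" by (rule bilinI) (intro lin)+
          have bil: "bilin scale (\<lambda>c c'. scale (e (b \<cdot> c')) (a \<cdot> c))" for a b by (rule bilinI) (intro lin)+
          show "sw (\<lambda>c c'. scale (e (b \<cdot> c')) (a \<cdot> c)) d1 \<in> corad" if "a \<in> C" for a b
            by (rule sw_in_subco[OF vector_space_axioms bil sc sD d(1)]) (intro subspace_scale[OF sc] corC that)
          show "sw (\<lambda>c c'. scale (e (b \<cdot> c')) (a \<cdot> c)) d1 \<in> corad" if "b \<in> C'" for a b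
            by (rule sw_in_subco[OF vector_space_axioms bil sc sD d(1)]) (simp add: e0 that subspace_0[OF sc])
        qed
        finally show "ra e (f \<cdot> d1) \<cdot> S d2 \<in> corad"
          unfolding la_ra_e using d simple_corad[OF D] by (intro corad_mul corad_S) auto
      qed
      finally show "ra (\<lambda>x. e (x \<cdot> d0)) f \<in> corad" .
    qed
    moreover have "conv g h \<in> \<F>" "conv h g \<in> \<F>" if "g \<in> \<F>" "linear_form h" for g h
      using that conv_ann_left[OF sC'] conv_ann_right[OF sC'] subco_ra[OF subco_corad] subco_ra[OF sW]
      by (auto simp: \<F>_def ra_ra[symmetric] ann_linear)
    ultimately have "\<exists>g\<in>\<F>. \<forall>x\<in>C. g x = \<epsilon> x"
      by (intro ideal_contains_counit[OF C(1) _ _ _ _ _ _ _ c0(1), of \<F> "\<lambda>x. e (x \<cdot> d0)"])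
        (use c0(3) subspace_0[OF sc] subspace_add[OF sc] subspace_scale[OF sc] in
          \<open>auto simp: \<F>_def ann_def ra_form_add ra_form_scale lin_add_form lin_mult_right lin_zero_form\<close>)
    then obtain g where g: "g \<in> \<F>" "\<And>x. x \<in> C \<Longrightarrow> g x = \<epsilon> x" by blast
    have lg: "linear_form g" using g(1) ann_linear by (auto simp: \<F>_def)
    \<comment> \<open>As \<open>\<epsilon> - g\<close> is zero on C, it moves the wedge into C'; the
      other part \<open>ra g f\<close> is in the coradical since g is in \<F>.\<close>
    have "ra (\<lambda>x. \<epsilon> x - g x) f \<in> C'"
      unfolding ra_def
    proof (rule sw_in_cwedge[OF vector_space_axioms _ subco_subspace[OF sC'] subco_subspace[OF sC] subco_subspace[OF sC'] f])
      show "bilin scale (\<lambda>u v. scale (\<epsilon> u - g u) v)" by (rule bilinI) (intro lin lg)+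
    qed (simp_all add: g(2) subspace_0[OF subco_subspace[OF sC']] subspace_scale[OF subco_subspace[OF sC']])
    moreover have "ra g f \<in> corad" using g(1) f by (auto simp: \<F>_def)
    moreover have "f = ra (\<lambda>x. \<epsilon> x - g x) f + ra g f" by (simp add: ra_form_diff)
    ultimately show "f \<in> corad" using C'cor subspace_add[OF sc] by (metis subsetD)
  qed
  moreover have "cwedge C' C \<subseteq> corad"
  proof
    fix f assume f: "f \<in> cwedge C' C"
    note sW = subco_cwedge[OF sC' sC]
    \<comment> \<open>The mirrored argument uses \<open>sw_la_mul_S_mul\<close>, which needs the
      factor in the form S d'.\<close>
    have "d0 \<in> S ` S ` D" unfolding S_S_simple[OF D] by (rule c0(2))
    then obtain d' where d': "d' \<in> S ` D" "d0 = S d'" by blast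
    have sSD: "subco (S ` D)" by (rule subco_S[OF sD])
    have SD: "S x \<in> D" if "x \<in> S ` D" for x using that S_S_simple[OF D] by blast
    define \<F> where "\<F> = {\<gamma>. \<gamma> \<in> ann C' \<and> (\<forall>f\<in>cwedge C' C. la \<gamma> f \<in> corad)}"
    have "(\<lambda>x. e (x \<cdot> S d')) \<in> \<F>"
      unfolding \<F>_def
    proof (intro CollectI conjI ballI)
      show "(\<lambda>x. e (x \<cdot> S d')) \<in> ann C'" using e0 c0(2) d'(2) by (intro annI lin) simp
      fix f assume f: "f \<in> cwedge C' C"
      have "la (\<lambda>x. e (x \<cdot> S d')) f = sw (\<lambda>b1 b2. la e (f \<cdot> S b1) \<cdot> b2) d'"
        by (rule sw_la_mul_S_mul[OF e, symmetric])
      also have "\<dots> \<in> corad"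
      proof (rule sw_in_subco[OF vector_space_axioms _ sc sSD d'(1)])
        show "bilin scale (\<lambda>b1 b2. la e (f \<cdot> S b1) \<cdot> b2)" by (rule bilinI) (intro lin e)+
        fix b1 b2 assume b: "b1 \<in> S ` D" "b2 \<in> S ` D"
        note b1 = SD[OF b(1)]
        have "ra e (f \<cdot> S b1) = sw (\<lambda>a a'. sw (\<lambda>c c'. scale (e (a \<cdot> c)) (a' \<cdot> c')) (S b1)) f"
          by (rule ra_mul[OF e])
        also have "\<dots> \<in> corad"
        proof (rule sw_in_cwedge[OF vector_space_axioms _ sc subco_subspace[OF sC'] subco_subspace[OF sC] f])
          show "bilin scale (\<lambda>a a'. sw (\<lambda>c c'. scale (e (a \<cdot> c)) (a' \<cdot> c')) (S b1))" by (rule bilinI) (intro lin)+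
          have bil: "bilin scale (\<lambda>c c'. scale (e (a \<cdot> c)) (a' \<cdot> c'))" for a a' by (rule bilinI) (intro lin)+
          show "sw (\<lambda>c c'. scale (e (a \<cdot> c)) (a' \<cdot> c')) (S b1) \<in> corad" if "a' \<in> C" for a a'
            by (rule sw_in_subco[OF vector_space_axioms bil sc sD b1]) (intro subspace_scale[OF sc] corC that)
          show "sw (\<lambda>c c'. scale (e (a \<cdot> c)) (a' \<cdot> c')) (S b1) \<in> corad" if "a \<in> C'" for a a'
            by (rule sw_in_subco[OF vector_space_axioms bil sc sD b1]) (simp add: e0 that subspace_0[OF sc])
        qed
        finally show "la e (f \<cdot> S b1) \<cdot> b2 \<in> corad"
          unfolding la_ra_e using b simple_corad[OF D] by (intro corad_mul) (auto intro: corad_S)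
      qed
      finally show "la (\<lambda>x. e (x \<cdot> S d')) f \<in> corad" .
    qed
    moreover have "conv g h \<in> \<F>" "conv h g \<in> \<F>" if "g \<in> \<F>" "linear_form h" for g h
      using that conv_ann_left[OF sC'] conv_ann_right[OF sC'] subco_la[OF subco_corad] subco_la[OF sW]
      by (auto simp: \<F>_def la_la[symmetric] ann_linear)
    ultimately have "\<exists>g\<in>\<F>. \<forall>x\<in>C. g x = \<epsilon> x"
      by (intro ideal_contains_counit[OF C(1) _ _ _ _ _ _ _ c0(1), of \<F> "\<lambda>x. e (x \<cdot> S d')"])
        (use c0(3) d'(2) subspace_0[OF sc] subspace_add[OF sc] subspace_scale[OF sc] in
          \<open>auto simp: \<F>_def ann_def la_form_add la_form_scale lin_add_form lin_mult_right lin_zero_form\<close>)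
    then obtain g where g: "g \<in> \<F>" "\<And>x. x \<in> C \<Longrightarrow> g x = \<epsilon> x" by blast
    have lg: "linear_form g" using g(1) ann_linear by (auto simp: \<F>_def)
    have "la (\<lambda>x. \<epsilon> x - g x) f \<in> C'"
      unfolding la_def
    proof (rule sw_in_cwedge[OF vector_space_axioms _ subco_subspace[OF sC'] subco_subspace[OF sC'] subco_subspace[OF sC] f])
      show "bilin scale (\<lambda>u v. scale (\<epsilon> v - g v) u)" by (rule bilinI) (intro lin lg)+
    qed (simp_all add: g(2) subspace_0[OF subco_subspace[OF sC']] subspace_scale[OF subco_subspace[OF sC']])
    moreover have "la g f \<in> corad" using g(1) f by (auto simp: \<F>_def)
    moreover have "f = la (\<lambda>x. \<epsilon> x - g x) f + la g f" by (simp add: la_form_diff)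
    ultimately show "f \<in> corad" using C'cor subspace_add[OF sc] by (metis subsetD)
  qed
  ultimately show False using C(3) by (simp add: clinked_def)
qed

text \<open>Induction along the links from the unit: \<open>linked_product\<close> carries a class
  occurring in C D back to C' D, down to the product of the unit with D, which is D.\<close>

lemma simple_product_class:
  assumes "C \<in> link_class (span {one})" and D: "simple D" and E: "simple E" "E \<subseteq> prodsp C D"
  shows "E \<in> link_class D"
  using assms(1) E unfolding link_class_def[of "span {one}"] mem_Collect_eq
proof (induction arbitrary: E rule: rtranclp_induct)
  case base
  have "prodsp (span {one}) D \<subseteq> D"
    using subspace_scale[OF simple_subspace[OF D]]
    by (intro prodsp_subset simple_subspace[OF D]) (auto simp: span_singleton mul_scale_left)
  with base have "E = D" using simple_eq[OF _ D] by blast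
  then show ?case by simp
next
  case (step C' C)
  then have "\<exists>E'. simple E' \<and> E' \<subseteq> prodsp C' D \<and> E' \<in> link_class E"
    using linked_product[OF saturated_link_class _ _ _ D, of C C' E E] clinked_sym by auto
  then obtain E' where "simple E'" "E' \<subseteq> prodsp C' D" "E' \<in> link_class E" by blast
  with step.IH show ?case using link_class_sym link_class_trans by blast
qed

definition K :: "'b set" where
  "K = part (link_class (span {one}))"

lemma subco_K: "subco K"
  unfolding K_def by (rule subco_part)

lemma one_K: "one \<in> K"
  using simple_part[OF simple_one, of "link_class (span {one})"] span_base[of one "{one}"] by (auto simp: K_def)

lemma K_mul_part:
  assumes sat: "saturated \<A>" and "x \<in> K" "y \<in> part \<A>"
  shows "x \<cdot> y \<in> part \<A>"
proof -
  have "prodsp K (part \<A>) \<subseteq> part \<A>"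
  proof (rule subco_subset_part[OF subco_prodsp[OF subco_K subco_part]])
    fix E assume E: "simple E" "E \<subseteq> prodsp K (part \<A>)"
    obtain C D where CD: "simple C" "C \<subseteq> K" "simple D" "D \<subseteq> part \<A>" "E \<subseteq> prodsp C D"
      using simple_in_prodsp[OF subco_K subco_part E] by blast
    have "C \<in> link_class (span {one})" using CD(1,2) simple_part unfolding K_def by blast
    from simple_product_class[OF this CD(3) E(1) CD(5)] have "E \<in> link_class D" .
    moreover have "D \<in> \<A>" using CD simple_part by blast
    ultimately show "E \<in> \<A>" using saturated_closed[OF sat] by blast
  qed
  then show ?thesis using prodspI[OF assms(2,3)] by blast
qed

lemma K_op_cop: "hopf_dual_chevalley.K scale (\<lambda>x. map prod.swap (cop x)) one = K"
  by (simp add: hopf_dual_chevalley.K_def[OF op_cop] K_def part_cop link_class_cop)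

lemma part_mul_K: "saturated \<A> \<Longrightarrow> x \<in> K \<Longrightarrow> y \<in> part \<A> \<Longrightarrow> y \<cdot> x \<in> part \<A>"
  using hopf_dual_chevalley.K_mul_part[OF op_cop, of \<A> x y] by (simp add: K_op_cop part_cop saturated_cop)

subsection \<open>The dual basis\<close>

definition proj :: "'b \<Rightarrow> 'b" where
  "proj = part_proj (link_class (span {one}))"

definition pform :: "'b \<Rightarrow> 'a" where
  "pform = part_form (link_class (span {one}))"

lemma pform_linear: "linear_form pform"
  unfolding pform_def by (rule part_form(1))

lemma proj_linear: "linear_op proj"
  unfolding proj_def by (rule part_proj_linear)

lemma proj_la: "proj = la pform"
  by (simp add: proj_def pform_def part_proj_def fun_eq_iff)

lemma proj_in: "proj x \<in> K"
  unfolding proj_def K_def by (rule part_proj_in[OF saturated_link_class])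

lemma proj_id: "k \<in> K \<Longrightarrow> proj k = k"
  unfolding proj_def K_def by (rule part_proj_id)

lemma eps_proj: "\<epsilon> (proj x) = pform x"
  unfolding proj_def pform_def by (rule eps_part_proj[OF saturated_link_class])

lemma K_complement: "\<exists>a b. a \<in> K \<and> b \<in> part (- link_class (span {one})) \<and> x = a + b"
  unfolding K_def by (rule part_decomposition[OF saturated_link_class])

lemma K_mul: "x \<in> K \<Longrightarrow> y \<in> K \<Longrightarrow> x \<cdot> y \<in> K"
  unfolding K_def[symmetric] using K_mul_part[OF saturated_link_class] by (simp add: K_def)

text \<open>Left multiplication by k preserves both K and the complementary part.\<close>

lemma proj_mul_left:
  assumes k: "k \<in> K"
  shows "proj (k \<cdot> h) = k \<cdot> proj h"
proof -
  obtain a b where ab: "a \<in> K" "b \<in> part (- link_class (span {one}))" "h = a + b" using K_complement by blast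
  have "k \<cdot> b \<in> part (- link_class (span {one}))"
    by (rule K_mul_part[OF saturated_compl[OF saturated_link_class] k ab(2)])
  with ab K_mul[OF k ab(1)] show ?thesis
    by (simp add: mul_add_right proj_def K_def part_proj_sum)
qed

lemma proj_mul_right:
  assumes k: "k \<in> K"
  shows "proj (h \<cdot> k) = proj h \<cdot> k"
proof -
  obtain a b where ab: "a \<in> K" "b \<in> part (- link_class (span {one}))" "h = a + b" using K_complement by blast
  have "b \<cdot> k \<in> part (- link_class (span {one}))"
    by (rule part_mul_K[OF saturated_compl[OF saturated_link_class] k ab(2)])
  with ab K_mul[OF ab(1) k] show ?thesis
    by (simp add: mul_add_left proj_def K_def part_proj_sum)
qed

lemma pform_mul_left: "k \<in> K \<Longrightarrow> pform (k \<cdot> h) = \<epsilon> k * pform h"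
  using eps_proj[of "k \<cdot> h"] by (simp add: proj_mul_left eps_proj)

lemma pform_mul_right: "k \<in> K \<Longrightarrow> pform (h \<cdot> k) = pform h * \<epsilon> k"
  using eps_proj[of "h \<cdot> k"] by (simp add: proj_mul_right eps_proj)

lemma pform_one: "pform one = 1"
  using eps_proj[of one] by (simp add: proj_id one_K)

section \<open>Coordinates on a single block K D\<close>

definition rep_elt :: "'b set \<Rightarrow> 'b" where
  "rep_elt D = (SOME b. b \<in> D \<and> (\<forall>d\<in>D. pform (d \<cdot> S b) = \<epsilon> d))"

lemma rep_elt:
  assumes D: "simple D"
  shows "rep_elt D \<in> D" "d \<in> D \<Longrightarrow> pform (d \<cdot> S (rep_elt D)) = \<epsilon> d"
proof -
  have "\<exists>b\<in>D. \<forall>d\<in>D. pform (d \<cdot> S b) = \<epsilon> d"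
  proof (rule counit_represented[OF pform_linear pform_one _ _ D S_S_simple[OF D]])
    show "pform (la pform x \<cdot> h) = pform x * pform h" for x h
      using pform_mul_left[OF proj_in, of x h] by (simp add: eps_proj proj_la[symmetric])
    show "pform (h \<cdot> la pform x) = pform h * pform x" for x h
      using pform_mul_right[OF proj_in, of h x] by (simp add: eps_proj proj_la[symmetric])
  qed
  then have "rep_elt D \<in> D \<and> (\<forall>d\<in>D. pform (d \<cdot> S (rep_elt D)) = \<epsilon> d)"
    unfolding rep_elt_def by (intro someI_ex[of "\<lambda>b. b \<in> D \<and> (\<forall>d\<in>D. pform (d \<cdot> S b) = \<epsilon> d)"]) blast
  then show "rep_elt D \<in> D" "d \<in> D \<Longrightarrow> pform (d \<cdot> S (rep_elt D)) = \<epsilon> d" by auto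
qed

definition unit_form :: "'b set \<Rightarrow> 'b \<Rightarrow> 'a" where
  "unit_form D x = pform (x \<cdot> S (rep_elt D))"

lemma unit_form_linear: "linear_form (unit_form D)"
  unfolding unit_form_def[abs_def] by (intro linmap_compose[OF pform_linear] lin_all)

lemma subco_KD: "simple D \<Longrightarrow> subco (prodsp K D)"
  by (intro subco_prodsp subco_K simple_subco)

lemma D_KD: "D \<subseteq> prodsp K D"
  using prodspI[OF one_K, of _ D] by auto

lemma KD_closed:
  assumes k: "k \<in> K" and x: "x \<in> prodsp K D"
  shows "k \<cdot> x \<in> prodsp K D"
proof (rule span_image_in[OF mul_linear_right subspace_prodsp _ x[unfolded prodsp_def]])
  fix x assume "x \<in> {x \<cdot> y |x y. x \<in> K \<and> y \<in> D}"
  then obtain k' d where "k' \<in> K" "d \<in> D" "x = k' \<cdot> d" by blast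
  then show "k \<cdot> x \<in> prodsp K D" using prodspI[OF K_mul[OF k]] by (simp add: mul_assoc[symmetric])
qed

text \<open>By \<open>pform_mul_left\<close> the factor from K splits off as its counit. Hence
  \<open>la (unit_form D)\<close> is the identity on K D.\<close>

lemma unit_form_KD:
  assumes D: "simple D" and x: "x \<in> prodsp K D"
  shows "unit_form D x = \<epsilon> x"
proof (rule linmap_on_span_eq[OF unit_form_linear eps_linear _ x[unfolded prodsp_def]])
  fix x assume "x \<in> {x \<cdot> y |x y. x \<in> K \<and> y \<in> D}"
  then obtain k d where "k \<in> K" "d \<in> D" "x = k \<cdot> d" by blast
  then show "unit_form D x = \<epsilon> x"
    by (simp add: unit_form_def mul_assoc pform_mul_left rep_elt(2)[OF D])
qed

lemma la_mul_S_in_KD: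
  assumes D: "simple D" and u: "u \<in> D"
  shows "la (\<lambda>v. pform (v \<cdot> S u)) x \<in> prodsp K D"
proof -
  have "la (\<lambda>v. pform (v \<cdot> S u)) x = sw (\<lambda>b1 b2. la pform (x \<cdot> S b1) \<cdot> b2) u"
    by (rule sw_la_mul_S_mul[OF pform_linear, symmetric])
  also have "\<dots> \<in> prodsp K D"
  proof (rule sw_in_subco[OF vector_space_axioms _ subspace_prodsp simple_subco[OF D] u])
    show "bilin scale (\<lambda>b1 b2. la pform (x \<cdot> S b1) \<cdot> b2)"
      by (rule bilinI) (intro lin_all pform_linear)+
  qed (use proj_in in \<open>auto simp: proj_la intro!: prodspI\<close>)
  finally show ?thesis .
qed

text \<open>\<open>la\<close> of this form sends x into X and into K D at once, and the counit of
  the image is the value in question.\<close>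

lemma pform_mul_S_zero:
  assumes X: "subco X" and D: "simple D" and disj: "X \<inter> prodsp K D = {0}" and x: "x \<in> X" and u: "u \<in> D"
  shows "pform (x \<cdot> S u) = 0"
proof -
  have l: "linear_form (\<lambda>v. pform (v \<cdot> S u))" by (intro linmap_compose[OF pform_linear] lin_all)
  have "la (\<lambda>v. pform (v \<cdot> S u)) x = 0"
    using la_mul_S_in_KD[OF D u] subco_la[OF X l x] disj by blast
  then show ?thesis using eps_la[OF l, of x] linmap_0[OF eps_linear] by simp
qed

text \<open>If D were outside K D', the form of D' would vanish on D, hence on K D and on its
  subspace D'; but there it is the counit.\<close>

lemma KD_eq:
  assumes D: "simple D" "simple D'" and sub: "D' \<subseteq> prodsp K D"
  shows "prodsp K D' = prodsp K D"
proof
  have mono: "prodsp K A \<subseteq> prodsp K B" if "A \<subseteq> prodsp K B" for A B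
    using that KD_closed by (intro prodsp_subset subspace_prodsp) blast
  show "prodsp K D' \<subseteq> prodsp K D" by (rule mono[OF sub])
  have "D \<subseteq> prodsp K D'"
  proof (rule ccontr)
    assume "\<not> D \<subseteq> prodsp K D'"
    hence disj: "D \<inter> prodsp K D' = {0}" using simple_Int[OF D(1) subco_KD[OF D(2)]] by blast
    have "unit_form D' x = 0" if "x \<in> D" for x
      unfolding unit_form_def
      by (rule pform_mul_S_zero[OF simple_subco[OF D(1)] D(2) disj that rep_elt(1)[OF D(2)]])
    hence "unit_form D' \<in> ann {x \<cdot> y |x y. x \<in> K \<and> y \<in> D}"
      by (auto intro!: annI unit_form_linear simp: unit_form_def mul_assoc pform_mul_left)
    hence "unit_form D' \<in> ann (prodsp K D)" unfolding prodsp_def ann_span .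
    hence "\<epsilon> x = 0" if "x \<in> D'" for x
      using unit_form_KD[OF D(2), of x] annD[of _ _ x] sub that D_KD[of D'] by (metis subsetD)
    with eps_nonzero[OF simple_subco[OF D(2)]] simple_nonzero[OF D(2)] show False by blast
  qed
  then show "prodsp K D \<subseteq> prodsp K D'" by (rule mono)
qed

text \<open>Different D may generate the same K D; indexing by the subspaces counts each block
  once.\<close>

definition blocks :: "'b set set" where
  "blocks = {prodsp K D | D. simple D}"

definition block_rep :: "'b set \<Rightarrow> 'b set" where
  "block_rep P = (SOME D. simple D \<and> prodsp K D = P)"

lemma block_rep: "P \<in> blocks \<Longrightarrow> simple (block_rep P)" "P \<in> blocks \<Longrightarrow> prodsp K (block_rep P) = P"
  using someI_ex[of "\<lambda>D. simple D \<and> prodsp K D = P"] by (auto simp: blocks_def block_rep_def)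

lemma subco_block: "P \<in> blocks \<Longrightarrow> subco P"
  using subco_KD by (auto simp: blocks_def)

definition block_form :: "'b set \<Rightarrow> 'b \<Rightarrow> 'a" where
  "block_form P = unit_form (block_rep P)"

lemma block_form_linear: "linear_form (block_form P)"
  unfolding block_form_def by (rule unit_form_linear)

lemma block_form_eps: "P \<in> blocks \<Longrightarrow> x \<in> P \<Longrightarrow> block_form P x = \<epsilon> x"
  unfolding block_form_def using unit_form_KD[of "block_rep P" x] block_rep by auto

lemma block_form_simple_zero:
  assumes P: "P \<in> blocks" and C: "simple C" "prodsp K C \<noteq> P" and x: "x \<in> C"
  shows "block_form P x = 0"
proof -
  have "\<not> C \<subseteq> P"
    using KD_eq[OF block_rep(1)[OF P] C(1)] C(2) block_rep(2)[OF P] by auto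
  hence "C \<inter> P = {0}" using simple_Int[OF C(1) subco_block[OF P]] by blast
  then show ?thesis
    unfolding block_form_def unit_form_def
    using pform_mul_S_zero[OF simple_subco[OF C(1)] block_rep(1)[OF P] _ x rep_elt(1)[OF block_rep(1)[OF P]]]
      block_rep(2)[OF P] by simp
qed

definition blocks_of :: "'b set \<Rightarrow> 'b set set" where
  "blocks_of X = prodsp K ` {C. simple C \<and> C \<subseteq> X}"

lemma blocks_of: "fin_dim X \<Longrightarrow> finite (blocks_of X)" "blocks_of X \<subseteq> blocks"
  by (auto simp: blocks_of_def blocks_def finite_simples)

text \<open>X meets P in zero, so the values pform(b S(c)) that determine the projection vanish.
  This is the local finiteness of the dual basis.\<close>

lemma proj_mul_S_zero:
  assumes X: "subco X" and P: "P \<in> blocks" "P \<notin> blocks_of X" and x: "x \<in> X" and u: "u \<in> block_rep P"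
  shows "proj (x \<cdot> S u) = 0"
proof -
  note D = block_rep[OF P(1)]
  have "X \<inter> P = {0}"
  proof (rule ccontr)
    assume "X \<inter> P \<noteq> {0}"
    then obtain C where C: "simple C" "C \<subseteq> X" "C \<subseteq> P"
      using simple_exists[OF subco_Int[OF X subco_block[OF P(1)]]] by blast
    hence "prodsp K C = P" using KD_eq[OF D(1) C(1)] D(2) by simp
    with P(2) C show False by (auto simp: blocks_of_def)
  qed
  hence disj: "X \<inter> prodsp K (block_rep P) = {0}" using D(2) by simp
  note lin = linmap_compose[OF pform_linear] lin_all
  have "la pform (x \<cdot> S u) = sw (\<lambda>a b. sw (\<lambda>c d. scale (pform (b \<cdot> S c)) (a \<cdot> S d)) u) x"
    by (rule la_mul_S[OF pform_linear])
  also have "\<dots> \<in> {0}"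
  proof (rule sw_in_subco[OF vector_space_axioms _ subspace_single_0 X x])
    show "bilin scale (\<lambda>a b. sw (\<lambda>c d. scale (pform (b \<cdot> S c)) (a \<cdot> S d)) u)"
      by (rule bilinI) (intro lin)+
    fix a b assume b: "b \<in> X"
    show "sw (\<lambda>c d. scale (pform (b \<cdot> S c)) (a \<cdot> S d)) u \<in> {0}"
      by (rule sw_in_subco[OF vector_space_axioms _ subspace_single_0 simple_subco[OF D(1)] u], rule bilinI)
        (intro lin | simp add: pform_mul_S_zero[OF X D(1) disj b])+
  qed
  finally show ?thesis by (simp add: proj_la)
qed

lemma la_block_form: "la (block_form P) x = sw (\<lambda>b1 b2. proj (x \<cdot> S b1) \<cdot> b2) (rep_elt (block_rep P))"
  unfolding proj_la sw_la_mul_S_mul[OF pform_linear] by (simp add: block_form_def unit_form_def[abs_def])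

text \<open>Q replaces the entries of the chosen coproduct by elements of \<open>block_rep P\<close>
  without changing the tensor, so that \<open>proj_mul_S_zero\<close> applies to each entry.\<close>

definition block_list :: "'b set \<Rightarrow> ('b \<times> 'b) list" where
  "block_list P = (let Q = (SOME Q. linear_op Q \<and> range Q \<subseteq> block_rep P \<and> (\<forall>x\<in>block_rep P. Q x = x))
     in map (\<lambda>(u,v). (Q u, Q v)) (cop (rep_elt (block_rep P))))"

lemma block_list:
  assumes P: "P \<in> blocks"
  shows "(u, v) \<in> set (block_list P) \<Longrightarrow> u \<in> block_rep P"
    "la (block_form P) x = (\<Sum>(u,v)\<leftarrow>block_list P. proj (x \<cdot> S u) \<cdot> v)"
proof -
  let ?D = "block_rep P" and ?b = "rep_elt (block_rep P)"
  note D = block_rep(1)[OF P]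
  define Q where "Q = (SOME Q. linear_op Q \<and> range Q \<subseteq> ?D \<and> (\<forall>x\<in>?D. Q x = x))"
  have "linear_op Q \<and> range Q \<subseteq> ?D \<and> (\<forall>x\<in>?D. Q x = x)"
    unfolding Q_def by (rule someI_ex[OF projection_exists[OF simple_subspace[OF D]]])
  hence Q: "linear_op Q" "\<And>x. Q x \<in> ?D" "\<And>x. x \<in> ?D \<Longrightarrow> Q x = x" by auto
  have bl: "block_list P = map (\<lambda>(u,v). (Q u, Q v)) (cop ?b)"
    unfolding block_list_def Q_def Let_def ..
  show "(u, v) \<in> set (block_list P) \<Longrightarrow> u \<in> ?D" unfolding bl using Q(2) by auto
  note lin = linmap_compose[OF proj_linear] linmap_compose[OF Q(1)] lin_all
  have "la (block_form P) x = sw (\<lambda>u v. proj (x \<cdot> S (Q u)) \<cdot> Q v) ?b"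
    unfolding la_block_form
    by (rule sw_cong_subco[OF vector_space_axioms _ _ simple_subco[OF D] rep_elt(1)[OF D]])
      (rule bilinI; intro lin | simp add: Q(3))+
  then show "la (block_form P) x = (\<Sum>(u,v)\<leftarrow>block_list P. proj (x \<cdot> S u) \<cdot> v)"
    by (simp add: bl sw_def comp_def case_prod_unfold)
qed

lemma la_block_form_zero:
  assumes "subco X" "P \<in> blocks" "P \<notin> blocks_of X" "x \<in> X"
  shows "la (block_form P) x = 0"
proof -
  have "(\<Sum>(u,v)\<leftarrow>ps. proj (x \<cdot> S u) \<cdot> v) = 0" if "set ps \<subseteq> set (block_list P)" for ps
    using that
    by (induction ps) (use proj_mul_S_zero[OF assms(1-3) assms(4) block_list(1)[OF assms(2)]] in fastforce)+
  then show ?thesis by (simp add: block_list(2)[OF assms(2)])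
qed

text \<open>There may be infinitely many blocks, but x lies in a finite-dimensional X and only
  \<open>blocks_of X\<close> contribute.\<close>

definition tot :: "'b \<Rightarrow> 'b" where
  "tot x = (\<Sum>P\<in>{P \<in> blocks. la (block_form P) x \<noteq> 0}. la (block_form P) x)"

lemma tot_eq:
  assumes X: "subco X" "fin_dim X" and x: "x \<in> X"
  shows "tot x = (\<Sum>P\<in>blocks_of X. la (block_form P) x)"
  unfolding tot_def
  by (rule sum.mono_neutral_left) (use blocks_of X la_block_form_zero[OF X(1) _ _ x] in auto)

lemma tot_la: "subco X \<Longrightarrow> fin_dim X \<Longrightarrow> x \<in> X \<Longrightarrow> tot x = la (\<lambda>u. \<Sum>P\<in>blocks_of X. block_form P u) x"
  by (simp add: tot_eq la_def scale_sum_left sw_sum)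

lemma common_subco: "\<exists>X. subco X \<and> fin_dim X \<and> x \<in> X \<and> y \<in> X"
proof -
  obtain A where A: "subco A" "fin_dim A" "x \<in> A" using fin_dim_subco_exists by blast
  obtain B where B: "subco B" "fin_dim B" "y \<in> B" using fin_dim_subco_exists by blast
  let ?X = "span (\<Union>{A, B})"
  have "subco ?X" by (rule subco_span) (use A B in auto)
  moreover have "fin_dim ?X"
  proof -
    obtain F G where FG: "finite F" "A \<subseteq> span F" "finite G" "B \<subseteq> span G" using A B by (auto simp: fin_dim_def)
    have "\<Union>{A, B} \<subseteq> span (F \<union> G)" using FG span_mono[of F "F \<union> G"] span_mono[of G "F \<union> G"] by auto
    hence "?X \<subseteq> span (F \<union> G)" by (simp add: span_minimal)
    with FG show ?thesis unfolding fin_dim_def by (intro exI[of _ "F \<union> G"]) simp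
  qed
  moreover have "x \<in> ?X" "y \<in> ?X" using A B by (auto intro!: span_base)
  ultimately show ?thesis by blast
qed

lemma tot_linear: "linear_op tot"
proof (rule linmapI)
  fix x y
  obtain X where X: "subco X" "fin_dim X" "x \<in> X" "y \<in> X" using common_subco by blast
  have "x + y \<in> X" using X subspace_add[OF subco_subspace] by blast
  with X show "tot (x + y) = tot x + tot y"
    by (simp add: tot_eq[OF X(1,2)] linmap_add[OF la_linear[OF block_form_linear]] sum.distrib)
next
  fix c x
  obtain X where X: "subco X" "fin_dim X" "x \<in> X" using fin_dim_subco_exists by blast
  have "scale c x \<in> X" using X subspace_scale[OF subco_subspace] by blast
  with X show "tot (scale c x) = scale c (tot x)"
    by (simp add: tot_eq[OF X(1,2)] linmap_scale[OF la_linear[OF block_form_linear]] scale_sum_right)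
qed

lemma la_block_form_mul:
  assumes P: "P \<in> blocks" and k: "k \<in> K"
  shows "la (block_form P) (k \<cdot> x) = k \<cdot> la (block_form P) x"
proof -
  have "la (block_form P) (k \<cdot> x) = sw (\<lambda>b1 b2. k \<cdot> (proj (x \<cdot> S b1) \<cdot> b2)) (rep_elt (block_rep P))"
    by (simp add: la_block_form mul_assoc proj_mul_left[OF k])
  then show ?thesis by (simp add: la_block_form sw_app[OF mul_linear_right])
qed

lemma tot_mul:
  assumes k: "k \<in> K"
  shows "tot (k \<cdot> x) = k \<cdot> tot x"
proof -
  obtain X where X: "subco X" "fin_dim X" "x \<in> X" "k \<cdot> x \<in> X" using common_subco by blast
  show ?thesis
    using X by (simp add: tot_eq[OF X(1,2)] linmap_sum[OF mul_linear_right])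
      (rule sum.cong, use la_block_form_mul[OF _ k] blocks_of(2)[of X] in auto)
qed

text \<open>On a simple D in X only the block K D contributes to the sum of the forms, and it
  contributes \<epsilon>. So \<epsilon> minus the sum vanishes on all simple subcoalgebras of X and
  \<open>la_nilpotent\<close> applies.\<close>

lemma tot_nilpotent:
  assumes X: "subco X" "fin_dim X" and x: "x \<in> X"
  shows "\<exists>n. ((\<lambda>y. y - tot y) ^^ n) x = 0"
proof -
  define f where "f = (\<lambda>u. \<Sum>P\<in>blocks_of X. block_form P u)"
  define \<nu> where "\<nu> = (\<lambda>u. \<epsilon> u - f u)"
  have lf: "linear_form f" unfolding f_def by (intro lin_sum_form block_form_linear)
  have l\<nu>: "linear_form \<nu>" unfolding \<nu>_def by (intro lin_diff_form eps_linear lf)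
  have "\<nu> \<in> ann D" if D: "simple D" "D \<subseteq> X" for D
  proof (rule annI[OF l\<nu>])
    fix d assume d: "d \<in> D"
    let ?P = "prodsp K D"
    have P: "?P \<in> blocks_of X" "?P \<in> blocks" using D by (auto simp: blocks_of_def blocks_def)
    have "f d = block_form ?P d + (\<Sum>P\<in>blocks_of X - {?P}. block_form P d)"
      unfolding f_def by (rule sum.remove[OF blocks_of(1)[OF X(2)] P(1)])
    also have "(\<Sum>P\<in>blocks_of X - {?P}. block_form P d) = 0"
      using block_form_simple_zero[OF _ D(1) _ d] blocks_of(2)[of X] by (intro sum.neutral) auto
    also have "block_form ?P d = \<epsilon> d" using block_form_eps[OF P(2)] D_KD[of D] d by blast
    finally show "\<nu> d = 0" by (simp add: \<nu>_def)
  qed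
  from la_nilpotent[OF X(1) this subco_left_stable[OF X(1)] X(2) order_refl x]
  obtain n where n: "(la \<nu> ^^ n) x = 0" by blast
  have step: "y - tot y = la \<nu> y" if "y \<in> X" for y
    using tot_la[OF X that] by (simp add: \<nu>_def f_def la_form_diff)
  have "((\<lambda>y. y - tot y) ^^ n) x = (la \<nu> ^^ n) x \<and> (la \<nu> ^^ n) x \<in> X" for n
  proof (induction n)
    case 0
    then show ?case using x by simp
  next
    case (Suc n)
    then show ?case using step subco_la[OF X(1) l\<nu>] by simp
  qed
  with n show ?thesis by metis
qed

text \<open>The operator 1 - \<open>tot\<close> fixes the kernel of \<open>tot\<close>, which is
  zero by nilpotency. Surjectivity is an induction on the nilpotency index, in place of a Neumann
  series.\<close>

lemma tot_bij: "bij tot"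
proof -
  have inj: "x = 0" if "tot x = 0" for x
  proof -
    obtain X where "subco X" "fin_dim X" "x \<in> X" using fin_dim_subco_exists by blast
    from tot_nilpotent[OF this] obtain n where "((\<lambda>y. y - tot y) ^^ n) x = 0" by blast
    moreover have "((\<lambda>y. y - tot y) ^^ n) x = x" for n by (induction n) (simp_all add: that)
    ultimately show ?thesis by simp
  qed
  have "inj tot"
  proof (rule injI)
    fix x y assume "tot x = tot y"
    hence "tot (x - y) = 0" by (simp add: linmap_diff[OF tot_linear])
    then show "x = y" using inj[of "x - y"] by simp
  qed
  moreover have "y \<in> range tot" for y
  proof -
    obtain X where "subco X" "fin_dim X" "y \<in> X" using fin_dim_subco_exists by blast
    from tot_nilpotent[OF this] obtain n where "((\<lambda>y. y - tot y) ^^ n) y = 0" by blast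
    then show ?thesis
    proof (induction n arbitrary: y)
      case 0
      then show ?case using linmap_0[OF tot_linear] by (intro image_eqI[of _ _ 0]) auto
    next
      case (Suc n)
      then have "((\<lambda>y. y - tot y) ^^ n) (y - tot y) = 0" by (simp only: funpow_Suc_right comp_apply)
      from Suc.IH[OF this] obtain z where "y - tot y = tot z" by blast
      hence "y = tot (z + y)" by (simp add: linmap_add[OF tot_linear] algebra_simps)
      then show ?case by blast
    qed
  qed
  ultimately show ?thesis by (auto simp: bij_def)
qed

lemma inv_tot: "tot (inv tot x) = x"
  using tot_bij by (simp add: bij_is_surj surj_f_inv_f)

lemma inv_totI: "tot y = x \<Longrightarrow> inv tot x = y"
  using tot_bij by (auto simp: bij_is_inj)

theorem dual_basis:
  "\<exists>(I :: ('b set \<times> nat) set) f v.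
     (\<forall>i\<in>I. (\<forall>x y. f i (x + y) = f i x + f i y) \<and> (\<forall>x. f i x \<in> K) \<and> (\<forall>k\<in>K. \<forall>x. f i (k \<cdot> x) = k \<cdot> f i x)) \<and>
     (\<forall>x. finite {i \<in> I. f i x \<noteq> 0} \<and> (\<Sum>i\<in>{i \<in> I. f i x \<noteq> 0}. f i x \<cdot> v i) = x)"
proof -
  define I where "I = Sigma blocks (\<lambda>P. {..<length (block_list P)})"
  \<comment> \<open>The uncorrected coordinates add up to \<open>tot\<close>, so they are applied to
    the preimage of x under \<open>tot\<close>; K-linearity survives because \<open>tot\<close> is
    K-linear.\<close>
  define f where "f = (\<lambda>(P, n) x. proj (inv tot x \<cdot> S (fst (block_list P ! n))))"
  define v where "v = (\<lambda>(P, n). snd (block_list P ! n))"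
  have inv_add: "inv tot (x + y) = inv tot x + inv tot y" for x y
    by (rule inv_totI) (simp add: linmap_add[OF tot_linear] inv_tot)
  have inv_mul: "inv tot (k \<cdot> x) = k \<cdot> inv tot x" if "k \<in> K" for k x
    by (rule inv_totI) (simp add: tot_mul[OF that] inv_tot)
  have "f i (x + y) = f i x + f i y" for i x y
    by (simp add: f_def case_prod_unfold inv_add mul_add_left linmap_add[OF proj_linear])
  moreover have "f i x \<in> K" for i x by (simp add: f_def case_prod_unfold proj_in)
  moreover have "f i (k \<cdot> x) = k \<cdot> f i x" if "k \<in> K" for i k x
    by (simp add: f_def case_prod_unfold inv_mul[OF that] mul_assoc proj_mul_left[OF that])
  moreover have "finite {i \<in> I. f i x \<noteq> 0} \<and> (\<Sum>i\<in>{i \<in> I. f i x \<noteq> 0}. f i x \<cdot> v i) = x" for x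
  proof -
    obtain X where X: "subco X" "fin_dim X" "inv tot x \<in> X" using fin_dim_subco_exists by blast
    let ?J = "Sigma (blocks_of X) (\<lambda>P. {..<length (block_list P)})"
    have finJ: "finite ?J" using blocks_of(1)[OF X(2)] by simp
    have sub: "{i \<in> I. f i x \<noteq> 0} \<subseteq> ?J"
    proof
      fix i assume "i \<in> {i \<in> I. f i x \<noteq> 0}"
      then obtain P n where i: "i = (P, n)" "P \<in> blocks" "n < length (block_list P)" "f (P, n) x \<noteq> 0"
        by (auto simp: I_def)
      have "fst (block_list P ! n) \<in> block_rep P"
        using block_list(1)[OF i(2), of "fst (block_list P ! n)" "snd (block_list P ! n)"] i(3) by simp
      from proj_mul_S_zero[OF X(1) i(2) _ X(3) this] i(4) have "P \<in> blocks_of X" by (auto simp: f_def)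
      with i show "i \<in> ?J" by simp
    qed
    have "(\<Sum>i\<in>{i \<in> I. f i x \<noteq> 0}. f i x \<cdot> v i) = (\<Sum>i\<in>?J. f i x \<cdot> v i)"
      by (rule sum.mono_neutral_left[OF finJ sub]) (use blocks_of(2)[of X] in \<open>auto simp: I_def\<close>)
    also have "\<dots> = (\<Sum>P\<in>blocks_of X. \<Sum>n<length (block_list P). f (P, n) x \<cdot> v (P, n))"
      using blocks_of(1)[OF X(2)] by (subst sum.Sigma) auto
    also have "\<dots> = (\<Sum>P\<in>blocks_of X. la (block_form P) (inv tot x))"
    proof (rule sum.cong[OF refl])
      fix P assume "P \<in> blocks_of X"
      hence P: "P \<in> blocks" using blocks_of(2) by blast
      show "(\<Sum>n<length (block_list P). f (P, n) x \<cdot> v (P, n)) = la (block_form P) (inv tot x)"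
        unfolding block_list(2)[OF P] sum_list_sum_nth
        by (simp add: f_def v_def case_prod_unfold atLeast0LessThan)
    qed
    also have "\<dots> = tot (inv tot x)" by (rule tot_eq[OF X, symmetric])
    finally show ?thesis using finite_subset[OF sub finJ] by (simp add: inv_tot)
  qed
  ultimately show ?thesis by (intro exI[of _ I] exI[of _ f] exI[of _ v]) simp
qed

end

section \<open>Projective generators\<close>

lemma module_over_zero: "module_over K mul act M \<Longrightarrow> 0 \<in> M"
  by (simp add: module_over_def)

lemma module_over_add:
  assumes "module_over K mul act M" "x \<in> M" "y \<in> M"
  shows "x + y \<in> M"
proof -
  have "\<And>a b. a \<in> M \<Longrightarrow> b \<in> M \<Longrightarrow> a - b \<in> M" using assms(1) by (simp add: module_over_def)
  from this[OF assms(2) this[OF module_over_zero[OF assms(1)] assms(3)]] show ?thesis by simp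
qed

lemma module_over_sum:
  assumes "module_over K mul act M" "\<And>i. i \<in> A \<Longrightarrow> g i \<in> M"
  shows "sum g A \<in> M"
  using assms(2)
  by (induction A rule: infinite_finite_induct) (auto simp: module_over_zero[OF assms(1)] intro: module_over_add[OF assms(1)])

lemma act_zero_left:
  assumes "module_over K mul act M" "x \<in> M"
  shows "act 0 x = 0"
proof -
  have "0 \<in> K" using assms(1) unfolding module_over_def unital_subring_def by (metis diff_self)
  with assms have "act (0 + 0) x = act 0 x + act 0 x" unfolding module_over_def by blast
  then show ?thesis by simp
qed

lemma act_sum:
  assumes m: "module_over K mul act M" and a: "a \<in> K" and g: "\<And>i. i \<in> A \<Longrightarrow> g i \<in> M"
  shows "act a (sum g A) = (\<Sum>i\<in>A. act a (g i))"
  using g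
proof (induction A rule: infinite_finite_induct)
  case (insert i A)
  moreover from this have "sum g A \<in> M" by (intro module_over_sum[OF m]) auto
  ultimately show ?case using m a by (simp add: module_over_def)
next
  case empty
  have "act a (0 + 0) = act a 0 + act a 0" using m a module_over_zero[OF m] unfolding module_over_def by blast
  then show ?case by simp
next
  case (infinite A)
  have "act a (0 + 0) = act a 0 + act a 0" using m a module_over_zero[OF m] unfolding module_over_def by blast
  with infinite show ?case by simp
qed

lemma module_hom_sum:
  assumes m: "module_over K mul act M" and f: "module_hom K act M act' N f" and g: "\<And>i. i \<in> A \<Longrightarrow> g i \<in> M"
  shows "f (sum g A) = (\<Sum>i\<in>A. f (g i))"
proof -
  have "f (0 + 0) = f 0 + f 0" using f module_over_zero[OF m] unfolding module_hom_def by blast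
  hence f0: "f 0 = 0" by simp
  show ?thesis using g
  proof (induction A rule: infinite_finite_induct)
    case (insert i A)
    moreover from this have "sum g A \<in> M" by (intro module_over_sum[OF m]) auto
    ultimately show ?case using f by (simp add: module_hom_def)
  qed (simp_all add: f0)
qed

text \<open>The lift sends x to the sum of \<open>f i x\<close> times a preimage of the image of
  \<open>v i\<close>.\<close>

lemma projective_module_if_dual_basis:
  fixes act :: "'r::ring_1 \<Rightarrow> 'p \<Rightarrow> 'p::ab_group_add"
  assumes P: "module_over K mul act P"
    and coord: "\<And>i x. i \<in> I \<Longrightarrow> x \<in> P \<Longrightarrow> f i x \<in> K"
    and coord_add: "\<And>i x y. i \<in> I \<Longrightarrow> x \<in> P \<Longrightarrow> y \<in> P \<Longrightarrow> f i (x + y) = f i x + f i y"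
    and coord_act: "\<And>i k x. i \<in> I \<Longrightarrow> k \<in> K \<Longrightarrow> x \<in> P \<Longrightarrow> f i (act k x) = mul k (f i x)"
    and v: "\<And>i. i \<in> I \<Longrightarrow> v i \<in> P"
    and fin: "\<And>x. x \<in> P \<Longrightarrow> finite {i \<in> I. f i x \<noteq> 0}"
    and expand: "\<And>x. x \<in> P \<Longrightarrow> (\<Sum>i\<in>{i \<in> I. f i x \<noteq> 0}. act (f i x) (v i)) = x"
  shows "projective_module (TM :: 'm::ab_group_add itself) (TN :: 'n::ab_group_add itself) K mul act P"
  unfolding projective_module_def
proof (intro conjI allI impI)
  fix actM and M :: "'m set" and actN and N :: "'n set" and g \<phi>
  assume "module_over K mul actM M \<and> module_over K mul actN N \<and>
        module_hom K actM M actN N g \<and> g ` M = N \<and> module_hom K act P actN N \<phi>"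
  hence M: "module_over K mul actM M" and N: "module_over K mul actN N"
    and g: "module_hom K actM M actN N g" "g ` M = N" and \<phi>: "module_hom K act P actN N \<phi>" by blast+
  have "\<forall>i\<in>I. \<exists>m. m \<in> M \<and> g m = \<phi> (v i)" 
  proof
    fix i assume "i \<in> I"
    with \<phi> v have "\<phi> (v i) \<in> N" by (simp add: module_hom_def)
    then show "\<exists>m. m \<in> M \<and> g m = \<phi> (v i)" unfolding g(2)[symmetric] by (elim imageE) auto
  qed
  then obtain m where m: "\<And>i. i \<in> I \<Longrightarrow> m i \<in> M" "\<And>i. i \<in> I \<Longrightarrow> g (m i) = \<phi> (v i)" by metis
  define S where "S x = {i \<in> I. f i x \<noteq> 0}" for x
  define h where "h x = (\<Sum>i\<in>S x. actM (f i x) (m i))" for x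
  have M_act: "actM a y \<in> M" if "a \<in> K" "y \<in> M" for a y using M that by (simp add: module_over_def)
  \<comment> \<open>Different arguments have different supports; sums are compared over a common
    finite index set J.\<close>
  have h_eq: "h x = (\<Sum>i\<in>J. actM (f i x) (m i))" if "finite J" "S x \<subseteq> J" "J \<subseteq> I" for x J
    unfolding h_def
    by (rule sum.mono_neutral_left[OF that(1,2)]) (use that(3) act_zero_left[OF M m(1)] in \<open>auto simp: S_def\<close>)
  have finS: "finite (S x)" "S x \<subseteq> I" if "x \<in> P" for x using fin[OF that] by (auto simp: S_def)
  have "module_hom K act P actM M h"
    unfolding module_hom_def
  proof (intro conjI ballI)
    fix x assume x: "x \<in> P"
    show "h x \<in> M" unfolding h_def
      by (rule module_over_sum[OF M]) (use x in \<open>auto simp: S_def intro!: M_act coord m\<close>)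
  next
    fix x y assume x: "x \<in> P" and y: "y \<in> P"
    have xy: "x + y \<in> P" by (rule module_over_add[OF P x y])
    let ?J = "S x \<union> S y \<union> S (x + y)"
    have J: "finite ?J" "?J \<subseteq> I" using finS x y xy by auto
    have "actM (f i (x + y)) (m i) = actM (f i x) (m i) + actM (f i y) (m i)" if "i \<in> ?J" for i
    proof -
      have i: "i \<in> I" using that J by blast
      then show ?thesis using M coord[OF i x] coord[OF i y] m(1)[OF i] coord_add[OF i x y]
        by (simp add: module_over_def)
    qed
    then show "h (x + y) = h x + h y"
      by (subst (1 2 3) h_eq[of ?J]) (use J in \<open>auto simp: sum.distrib[symmetric]\<close>)
  next
    fix k x assume k: "k \<in> K" and x: "x \<in> P"
    have kx: "act k x \<in> P" using P k x by (simp add: module_over_def)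
    let ?J = "S x \<union> S (act k x)"
    have J: "finite ?J" "?J \<subseteq> I" using finS x kx by auto
    have "actM (f i (act k x)) (m i) = actM k (actM (f i x) (m i))" if "i \<in> ?J" for i
    proof -
      have i: "i \<in> I" using that J by blast
      then show ?thesis using M coord[OF i x] k m(1)[OF i] coord_act[OF i k x]
        by (simp add: module_over_def)
    qed
    hence "h (act k x) = (\<Sum>i\<in>?J. actM k (actM (f i x) (m i)))"
      by (subst h_eq[of ?J]) (use J in auto)
    also have "\<dots> = actM k (\<Sum>i\<in>?J. actM (f i x) (m i))"
      by (rule act_sum[OF M k, symmetric]) (use J in \<open>auto intro!: M_act coord m x\<close>)
    also have "\<dots> = actM k (h x)" by (subst h_eq[of ?J]) (use J in auto)
    finally show "h (act k x) = actM k (h x)" .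
  qed
  moreover have "g (h x) = \<phi> x" if x: "x \<in> P" for x
  proof -
    have *: "i \<in> I" "f i x \<in> K" "m i \<in> M" "v i \<in> P" if "i \<in> S x" for i
      using that coord[OF _ x] m v by (auto simp: S_def)
    have "g (h x) = (\<Sum>i\<in>S x. g (actM (f i x) (m i)))"
      unfolding h_def by (rule module_hom_sum[OF M g(1)]) (auto intro: M_act *)
    also have "\<dots> = (\<Sum>i\<in>S x. \<phi> (act (f i x) (v i)))"
    proof (rule sum.cong[OF refl])
      fix i assume i: "i \<in> S x"
      have "g (actM (f i x) (m i)) = actN (f i x) (\<phi> (v i))"
        using g(1) *[OF i] m(2) by (simp add: module_hom_def)
      also have "\<dots> = \<phi> (act (f i x) (v i))" using \<phi> *[OF i] by (simp add: module_hom_def)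
      finally show "g (actM (f i x) (m i)) = \<phi> (act (f i x) (v i))" .
    qed
    also have "\<dots> = \<phi> (\<Sum>i\<in>S x. act (f i x) (v i))"
      by (rule module_hom_sum[OF P \<phi>, symmetric]) (use * P in \<open>auto simp: module_over_def\<close>)
    also have "\<dots> = \<phi> x" using expand[OF x] by (simp add: S_def)
    finally show ?thesis .
  qed
  ultimately show "\<exists>h. module_hom K act P actM M h \<and> (\<forall>x\<in>P. g (h x) = \<phi> x)" by blast
qed (rule P)

text \<open>The map that sends y to \<pi>(y) x takes p to x, so it detects any x at which f and g
  differ.\<close>

lemma generator_module_if_retraction:
  assumes P: "module_over K mul act P"
    and \<pi>: "\<And>x. x \<in> P \<Longrightarrow> \<pi> x \<in> K" "\<And>x y. x \<in> P \<Longrightarrow> y \<in> P \<Longrightarrow> \<pi> (x + y) = \<pi> x + \<pi> y"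
      "\<And>k x. k \<in> K \<Longrightarrow> x \<in> P \<Longrightarrow> \<pi> (act k x) = mul k (\<pi> x)"
    and p: "p \<in> P" "\<pi> p = 1"
  shows "generator_module (TM :: 'm::ab_group_add itself) (TN :: 'n::ab_group_add itself) K mul act P"
  unfolding generator_module_def
proof (intro conjI allI impI)
  fix actM and M :: "'m set" and actN and N :: "'n set" and f g
  assume *: "module_over K mul actM M \<and> module_over K mul actN N \<and>
        module_hom K actM M actN N f \<and> module_hom K actM M actN N g \<and> (\<exists>x\<in>M. f x \<noteq> g x)"
  then obtain x where x: "x \<in> M" "f x \<noteq> g x" by blast
  have "module_hom K act P actM M (\<lambda>y. actM (\<pi> y) x)"
    using * x(1) \<pi> by (auto simp: module_hom_def module_over_def)
  moreover have "actM (\<pi> p) x = x" using * x(1) p(2) by (simp add: module_over_def)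
  ultimately show "\<exists>h. module_hom K act P actM M h \<and> (\<exists>x\<in>P. f (h x) \<noteq> g (h x))"
    using x(2) p(1) by (intro exI[of _ "\<lambda>y. actM (\<pi> y) x"] conjI bexI[of _ p]) simp_all
qed (rule P)

section \<open>Tensors as formal linear combinations\<close>

lemma vspace_pscale: "vspace pscale"
  using vector_space_pscale by (simp add: vspace_def)

lemma lin_ext_superset:
  assumes t: "vector_space t" and X: "finite X" "Poly_Mapping.keys p \<subseteq> X"
  shows "lin_ext t f p = (\<Sum>x\<in>X. t (Poly_Mapping.lookup p x) (f x))"
proof -
  interpret t: vector_space t by fact
  show ?thesis
    unfolding lin_ext_def using X by (intro sum.mono_neutral_left) (auto simp: in_keys_iff)
qed

lemma lin_ext_linear:
  fixes f :: "'x \<Rightarrow> 'v::ab_group_add" and t :: "'k::field \<Rightarrow> 'v \<Rightarrow> 'v"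
  assumes t: "vector_space t"
  shows "linmap pscale t (lin_ext t f)"
proof -
  interpret t: vector_space t by fact
  show ?thesis
  proof (rule linmapI)
    fix p q :: "'x \<Rightarrow>\<^sub>0 'k"
    let ?X = "Poly_Mapping.keys p \<union> Poly_Mapping.keys q \<union> Poly_Mapping.keys (p + q)"
    show "lin_ext t f (p + q) = lin_ext t f p + lin_ext t f q"
      by (subst (1 2 3) lin_ext_superset[OF t, of ?X])
        (auto simp: lookup_add t.scale_left_distrib sum.distrib)
  next
    fix c and p :: "'x \<Rightarrow>\<^sub>0 'k"
    let ?X = "Poly_Mapping.keys p \<union> Poly_Mapping.keys (pscale c p)"
    show "lin_ext t f (pscale c p) = t c (lin_ext t f p)"
      by (subst (1 2) lin_ext_superset[OF t, of ?X]) (auto simp: t.scale_sum_right)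
  qed
qed

lemma lin_ext_gen [simp]: "vector_space t \<Longrightarrow> lin_ext t f (gen x) = f x"
  by (simp add: lin_ext_def gen_def vector_space.vector_space_assms(4))

lemma linmap_lin_ext:
  assumes "linmap s t F"
  shows "F (lin_ext s f p) = lin_ext t (\<lambda>x. F (f x)) p"
  by (simp add: lin_ext_def linmap_sum[OF assms] linmap_scale[OF assms])

lemma lin_ext_pscale_gen: "lin_ext pscale gen p = p"
proof (rule poly_mapping_eqI)
  fix y
  have "Poly_Mapping.lookup (\<Sum>x\<in>X. pscale (Poly_Mapping.lookup p x) (gen x)) y =
      (\<Sum>x\<in>X. if x = y then Poly_Mapping.lookup p x else 0)" for X
    by (induction X rule: infinite_finite_induct) (auto simp: lookup_add gen_def lookup_single when_def)
  then show "Poly_Mapping.lookup (lin_ext pscale gen p) y = Poly_Mapping.lookup p y"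
    by (simp add: lin_ext_def in_keys_iff)
qed

text \<open>The coefficient is absorbed into the first factor, so evaluation only needs homogeneity
  there.\<close>

definition tensor_list :: "('k::field \<Rightarrow> 'h \<Rightarrow> 'h) \<Rightarrow> ('h \<times> 'h \<Rightarrow>\<^sub>0 'k) \<Rightarrow> ('h \<times> 'h) list" where
  "tensor_list s p = map (\<lambda>x. (s (Poly_Mapping.lookup p x) (fst x), snd x))
     (SOME xs. distinct xs \<and> set xs = Poly_Mapping.keys p)"

lemma sum_tensor_list:
  assumes "\<And>c a b. B (s c a) b = t c (B a b)"
  shows "(\<Sum>(u,v)\<leftarrow>tensor_list s p. B u v) = lin_ext t (\<lambda>(a, b). B a b) p"
proof -
  define xs where "xs = (SOME xs. distinct xs \<and> set xs = Poly_Mapping.keys p)"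
  have "\<exists>xs. distinct xs \<and> set xs = Poly_Mapping.keys p"
    using finite_distinct_list[OF finite_keys, of p] by blast
  from someI_ex[OF this] have xs: "distinct xs" "set xs = Poly_Mapping.keys p" by (auto simp: xs_def)
  have "(\<Sum>(u,v)\<leftarrow>tensor_list s p. B u v) = (\<Sum>x\<leftarrow>xs. t (Poly_Mapping.lookup p x) (B (fst x) (snd x)))"
    by (simp add: tensor_list_def xs_def[symmetric] comp_def assms)
  also have "\<dots> = lin_ext t (\<lambda>(a, b). B a b) p"
    using xs by (simp add: sum_list_distinct_conv_sum_set lin_ext_def case_prod_unfold)
  finally show ?thesis .
qed

context vspace
begin

lemma lin_ext_tensor2_rel:
  assumes t: "vector_space t" and B: "bilin t B" and r: "r \<in> tensor2_rel scale"
  shows "lin_ext t (\<lambda>(a, b). B a b) r = 0"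
proof -
  note F = lin_ext_linear[OF t, of "\<lambda>(a, b). B a b"]
  show ?thesis
    using r unfolding tensor2_rel_def
    by (auto simp: linmap_diff[OF F] linmap_scale[OF F] t linmap_add[OF bilin_left[OF B]]
        linmap_add[OF bilin_right[OF B]] linmap_scale[OF bilin_left[OF B]] linmap_scale[OF bilin_right[OF B]])
qed

lemma lin_ext_tensor2_sub:
  assumes t: "vector_space t" and B: "bilin t B" and V: "module.subspace t V"
    and A: "\<And>a b. (a, b) \<in> A \<Longrightarrow> B a b \<in> V" and p: "p \<in> tensor2_sub scale A"
  shows "lin_ext t (\<lambda>(a, b). B a b) p \<in> V"
proof -
  interpret t: vspace t using t by (simp add: vspace_def)
  interpret p: vspace "pscale :: 'a \<Rightarrow> ('b \<times> 'b \<Rightarrow>\<^sub>0 'a) \<Rightarrow> _" by (rule vspace_pscale)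
  note F = lin_ext_linear[OF t, of "\<lambda>(a, b). B a b"]
  show ?thesis
    using p unfolding tensor2_sub_def
  proof (induction rule: p.span_induct_alt)
    case base
    show ?case by (simp add: linmap_0[OF F] t.subspace_0[OF V])
  next
    case (step c x y)
    have "lin_ext t (\<lambda>(a, b). B a b) x \<in> V"
      using step(1) A lin_ext_tensor2_rel[OF t B] t.subspace_0[OF V] by (auto simp: t)
    with step(2) show ?case
      by (simp add: linmap_add[OF F] linmap_scale[OF F] t.subspace_add[OF V] t.subspace_scale[OF V])
  qed
qed

lemma tensor2_eq_lin_ext:
  assumes t: "vector_space t" and B: "bilin t B" and eq: "tensor2_eq scale p q"
  shows "lin_ext t (\<lambda>(a, b). B a b) p = lin_ext t (\<lambda>(a, b). B a b) q"
proof -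
  interpret t: vspace t using t by (simp add: vspace_def)
  have "p - q \<in> tensor2_sub scale {}" using eq by (simp add: tensor2_eq_def tensor2_sub_def)
  from lin_ext_tensor2_sub[OF t B t.subspace_single_0 _ this] show ?thesis
    by (simp add: linmap_diff[OF lin_ext_linear[OF t]])
qed

lemma tensor3_eq_lin_ext:
  assumes t: "vector_space t" and eq: "tensor3_eq scale p q"
    and T: "\<And>b c. linmap scale t (\<lambda>a. T a b c)" "\<And>a c. linmap scale t (\<lambda>b. T a b c)" "\<And>a b. linmap scale t (\<lambda>c. T a b c)"
  shows "lin_ext t (\<lambda>(a, b, c). T a b c) p = lin_ext t (\<lambda>(a, b, c). T a b c) q"
proof -
  interpret p: vspace "pscale :: 'a \<Rightarrow> ('b \<times> 'b \<times> 'b \<Rightarrow>\<^sub>0 'a) \<Rightarrow> _" by (rule vspace_pscale)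
  note F = lin_ext_linear[OF t, of "\<lambda>(a, b, c). T a b c"]
  have 0: "linmap pscale t (\<lambda>p :: 'b \<times> 'b \<times> 'b \<Rightarrow>\<^sub>0 'a. 0)"
    using module.scale_zero_right[OF module_iff_vector_space[THEN iffD2, OF t]] by (simp add: linmap_def)
  have "lin_ext t (\<lambda>(a, b, c). T a b c) (p - q) = 0"
  proof (rule p.linmap_on_span_eq[OF F 0 _ eq[unfolded tensor3_eq_def]])
    fix r assume "r \<in> tensor3_rel scale"
    then show "lin_ext t (\<lambda>(a, b, c). T a b c) r = 0"
      unfolding tensor3_rel_def
      by (auto simp: linmap_diff[OF F] linmap_scale[OF F] t linmap_add[OF T(1)] linmap_add[OF T(2)] linmap_add[OF T(3)]
          linmap_scale[OF T(1)] linmap_scale[OF T(2)] linmap_scale[OF T(3)])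
  qed
  then show ?thesis by (simp add: linmap_diff[OF F])
qed

text \<open>A form on the free space that vanishes on the relations is a bilinear map, and by
  \<open>tensor_zero\<close> pairs of forms detect whether all bilinear maps vanish.\<close>

lemma tensor2_relI_forms:
  assumes "\<And>f g. linear_form f \<Longrightarrow> linear_form g \<Longrightarrow> lin_ext (*) (\<lambda>(a, b). f a * g b) p = 0"
  shows "p \<in> module.span pscale (tensor2_rel scale)"
proof -
  interpret p: vspace "pscale :: 'a \<Rightarrow> ('b \<times> 'b \<Rightarrow>\<^sub>0 'a) \<Rightarrow> _" by (rule vspace_pscale)
  show ?thesis
  proof (rule p.in_subspaceI_forms)
    fix \<zeta> assume \<zeta>: "p.linear_form \<zeta>" and zero: "\<forall>v\<in>p.span (tensor2_rel scale). \<zeta> v = 0"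
    define \<beta> where "\<beta> a b = \<zeta> (gen (a, b))" for a b
    have rel: "\<zeta> r = 0" if "r \<in> tensor2_rel scale" for r using zero p.span_base[OF that] by blast
    have "\<zeta> (gen (a + a', b) - gen (a, b) - gen (a', b)) = 0" "\<zeta> (gen (a, b + b') - gen (a, b) - gen (a, b')) = 0"
      "\<zeta> (gen (scale c a, b) - pscale c (gen (a, b))) = 0" "\<zeta> (gen (a, scale c b) - pscale c (gen (a, b))) = 0" for a a' b b' c
      by (rule rel, unfold tensor2_rel_def, blast)+
    hence bil: "bilin (*) \<beta>"
      by (auto simp: bilin_def linmap_def \<beta>_def linmap_diff[OF \<zeta>] linmap_scale[OF \<zeta>] linmap_add[OF \<zeta>] algebra_simps)
    have "\<zeta> p = \<zeta> (lin_ext pscale gen p)" by (simp add: lin_ext_pscale_gen)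
    also have "\<dots> = lin_ext (*) (\<lambda>(a, b). \<beta> a b) p"
      by (simp add: linmap_lin_ext[OF \<zeta>] \<beta>_def case_prod_unfold)
    also have "\<dots> = (\<Sum>(u,v)\<leftarrow>tensor_list scale p. \<beta> u v)"
      by (rule sum_tensor_list[symmetric]) (simp add: linmap_scale[OF bilin_left[OF bil]])
    also have "\<dots> = 0"
    proof (rule tensor_zero[OF vector_space_times _ bil])
      fix f g assume fg: "linear_form f" "linear_form g"
      have "(\<Sum>(u,v)\<leftarrow>tensor_list scale p. f u * g v) = lin_ext (*) (\<lambda>(a, b). f a * g b) p"
        by (rule sum_tensor_list) (simp add: linmap_scale[OF fg(1)])
      then show "(\<Sum>(u,v)\<leftarrow>tensor_list scale p. f u * g v) = 0" using assms[OF fg] by simp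
    qed
    finally show "\<zeta> p = 0" .
  qed simp
qed

end

section \<open>From Hopf algebras to the functional description\<close>

context hopf_algebra
begin

definition cop :: "'h \<Rightarrow> ('h \<times> 'h) list" where
  "cop x = tensor_list scale (\<Delta> x)"

lemma sum_cop: "(\<And>c a b. B (scale c a) b = t c (B a b)) \<Longrightarrow> (\<Sum>(u,v)\<leftarrow>cop x. B u v) = lin_ext t (\<lambda>(a, b). B a b) (\<Delta> x)"
  unfolding cop_def by (rule sum_tensor_list)

sublocale vsp: vspace scale
  by unfold_locales

lemma lin_ext_Delta_linear:
  assumes t: "vector_space t" and B: "vsp.bilin t B"
  shows "linmap scale t (\<lambda>x. lin_ext t (\<lambda>(a, b). B a b) (\<Delta> x))"
proof (rule linmapI)
  note F = lin_ext_linear[OF t, of "\<lambda>(a, b). B a b"]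
  show "lin_ext t (\<lambda>(a, b). B a b) (\<Delta> (x + y)) =
    lin_ext t (\<lambda>(a, b). B a b) (\<Delta> x) + lin_ext t (\<lambda>(a, b). B a b) (\<Delta> y)" for x y
    using vsp.tensor2_eq_lin_ext[OF t B comult_add] by (simp add: linmap_add[OF F])
  show "lin_ext t (\<lambda>(a, b). B a b) (\<Delta> (scale c x)) = t c (lin_ext t (\<lambda>(a, b). B a b) (\<Delta> x))" for c x
    using vsp.tensor2_eq_lin_ext[OF t B comult_scale] by (simp add: linmap_scale[OF F])
qed

lemma sum_cop_bilin: "vsp.bilin t B \<Longrightarrow> (\<Sum>(u,v)\<leftarrow>cop x. B u v) = lin_ext t (\<lambda>(a, b). B a b) (\<Delta> x)"
  by (rule sum_cop) (simp add: linmap_scale[OF vsp.bilin_left])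

lemma coalg: "coalg scale cop \<epsilon>"
proof (unfold_locales, goal_cases)
  case (1 \<beta>)
  then show ?case by (simp add: sum_cop_bilin lin_ext_Delta_linear[OF vector_space_times])
next
  case (2 \<tau> x)
  note T = 2
  have b1: "vsp.bilin (*) (\<lambda>a' a''. \<tau> a' a'' b)" for b using T(1)[of _ b] T(2)[of _ b] by (intro vsp.bilinI)
  have b2: "vsp.bilin (*) (\<tau> a)" for a using T(2)[of a] T(3)[of a] by (intro vsp.bilinI)
  let ?F = "lin_ext (*) (\<lambda>(a, b, c). \<tau> a b c)"
  note F = lin_ext_linear[OF vector_space_times, of "\<lambda>(a, b, c). \<tau> a b c"]
  have "(\<Sum>(a, b)\<leftarrow>cop x. \<Sum>(a', a'')\<leftarrow>cop a. \<tau> a' a'' b) =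
      lin_ext (*) (\<lambda>(a, b). lin_ext (*) (\<lambda>(a', a''). \<tau> a' a'' b) (\<Delta> a)) (\<Delta> x)"
    unfolding sum_cop_bilin[OF b1]
    by (rule sum_cop) (rule linmap_scale[OF lin_ext_Delta_linear[OF vector_space_times b1]])
  also have "\<dots> = ?F (lin_ext pscale (\<lambda>(a, b). lin_ext pscale (\<lambda>(a', a''). gen (a', a'', b)) (\<Delta> a)) (\<Delta> x))"
    by (simp add: linmap_lin_ext[OF F[unfolded case_prod_unfold]] case_prod_unfold vector_space_times)
  also have "\<dots> = ?F (lin_ext pscale (\<lambda>(a, b). lin_ext pscale (\<lambda>(b', b''). gen (a, b', b'')) (\<Delta> b)) (\<Delta> x))"
    by (rule vsp.tensor3_eq_lin_ext[OF vector_space_times coassoc T])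
  also have "\<dots> = lin_ext (*) (\<lambda>(a, b). lin_ext (*) (\<lambda>(b', b''). \<tau> a b' b'') (\<Delta> b)) (\<Delta> x)"
    by (simp add: linmap_lin_ext[OF F[unfolded case_prod_unfold]] case_prod_unfold vector_space_times)
  also have "\<dots> = (\<Sum>(a, b)\<leftarrow>cop x. \<Sum>(b', b'')\<leftarrow>cop b. \<tau> a b' b'')"
    unfolding sum_cop_bilin[OF b2]
    by (rule sum_cop[symmetric])
      (simp add: lin_ext_def linmap_scale[OF T(1)] case_prod_unfold sum_distrib_left mult.left_commute)
  finally show ?case .
next
  case 3
  then show ?case using counit_linear by (simp add: linmap_iff_linear vector_space_axioms vector_space_times)
next
  case (4 x)
  have "\<epsilon> (scale c a) = c * \<epsilon> a" for c a using counit_linear by (simp add: Vector_Spaces.linear_iff)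
  then show ?case using sum_cop[of "\<lambda>u v. scale (\<epsilon> u) v" scale x] counit_left[of x] by simp
next
  case (5 x)
  show ?case using sum_cop[of "\<lambda>u v. scale (\<epsilon> v) u" scale x] counit_right[of x] by (simp add: scale_left_commute)
qed

lemma hopf: "hopf scale cop \<epsilon> (*) 1 S"
proof -
  interpret coalg scale cop \<epsilon> by (rule coalg)
  have S: "linmap scale scale S" using antipode_linear by (auto simp: Vector_Spaces.linear_iff linmap_def)
  show ?thesis
  proof (unfold_locales, goal_cases)
    case (6 \<beta>)
    show ?case unfolding sum_cop_bilin[OF 6]
      using vsp.tensor2_eq_lin_ext[OF vector_space_times 6 comult_one] by (simp add: vector_space_times)
  next
    case (7 \<beta> x y)
    note F = lin_ext_linear[OF vector_space_times, of "\<lambda>(a, b). \<beta> a b"]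
    have m: "linmap scale scale (\<lambda>c. a * c)" "linmap scale scale (\<lambda>c. c * a)" for a
      by (auto simp: linmap_def algebra_simps scale_mult_left scale_mult_right)
    have b: "vsp.bilin (*) (\<lambda>c d. \<beta> (a * c) (b * d))" for a b
      by (rule vsp.bilinI) (intro linmap_compose[OF vsp.bilin_left[OF 7] m(1)] linmap_compose[OF vsp.bilin_right[OF 7] m(1)])+
    have "(\<Sum>(u, v)\<leftarrow>cop (x * y). \<beta> u v) = lin_ext (*) (\<lambda>(a, b). \<beta> a b) (tensor2_mult (\<Delta> x) (\<Delta> y))"
      unfolding sum_cop_bilin[OF 7] by (rule vsp.tensor2_eq_lin_ext[OF vector_space_times 7 comult_mult])
    also have "\<dots> = lin_ext (*) (\<lambda>(a, b). lin_ext (*) (\<lambda>(c, d). \<beta> (a * c) (b * d)) (\<Delta> y)) (\<Delta> x)"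
      by (simp add: tensor2_mult_def linmap_lin_ext[OF F[unfolded case_prod_unfold]] case_prod_unfold vector_space_times)
    also have "\<dots> = (\<Sum>(a, b)\<leftarrow>cop x. \<Sum>(c, d)\<leftarrow>cop y. \<beta> (a * c) (b * d))"
      unfolding sum_cop_bilin[OF b]
      by (rule sum_cop[symmetric])
        (simp add: lin_ext_def scale_mult_left linmap_scale[OF vsp.bilin_left[OF 7]] case_prod_unfold
          sum_distrib_left mult.left_commute)
    finally show ?case .
  next
    case (11 x)
    show ?case using sum_cop[of "\<lambda>u v. S u * v" scale x] antipode_left[of x]
      by (simp add: linmap_scale[OF S] scale_mult_left)
  next
    case (12 x)
    show ?case using sum_cop[of "\<lambda>u v. u * S v" scale x] antipode_right[of x]
      by (simp add: scale_mult_left)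
  qed (simp_all add: linmap_def algebra_simps scale_mult_left scale_mult_right counit_one counit_mult linmap_add[OF S] linmap_scale[OF S])
qed

sublocale H: hopf scale cop \<epsilon> "(*)" 1 S
  by (rule hopf)

lemma sw_Delta: "vsp.bilin t B \<Longrightarrow> H.sw B x = lin_ext t (\<lambda>(a, b). B a b) (\<Delta> x)"
  unfolding H.sw_def by (rule sum_cop_bilin)

lemma bilin_form_mult:
  assumes "vsp.linear_form f" "vsp.linear_form g"
  shows "vsp.bilin (*) (\<lambda>a b. f a * g b)"
  by (rule vsp.bilinI) (intro H.lin_intros assms)+

text \<open>Applying T termwise gives a representative with entries in A. It differs from \<Delta> x
  by relations, since no pair of forms tells them apart.\<close>

lemma Delta_in_tensor2_subI:
  assumes T: "\<And>a b. T a b \<in> module.span pscale (gen ` A)"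
    and eq: "\<And>f g. vsp.linear_form f \<Longrightarrow> vsp.linear_form g \<Longrightarrow>
      H.conv f g x = lin_ext (*) (\<lambda>(a, b). lin_ext (*) (\<lambda>(a, b). f a * g b) (T a b)) (\<Delta> x)"
  shows "\<Delta> x \<in> tensor2_sub scale A"
proof -
  interpret p: vspace "pscale :: 'k \<Rightarrow> ('h \<times> 'h \<Rightarrow>\<^sub>0 'k) \<Rightarrow> _" by (rule vspace_pscale)
  define q where "q = lin_ext pscale (\<lambda>(a, b). T a b) (\<Delta> x)"
  have sub: "p.span (gen ` A) \<subseteq> tensor2_sub scale A" "p.span (tensor2_rel scale) \<subseteq> tensor2_sub scale A"
    unfolding tensor2_sub_def by (rule p.span_mono, blast)+
  have "q \<in> p.span (gen ` A)"
    unfolding q_def lin_ext_def by (intro p.span_sum p.span_scale) (simp add: case_prod_unfold T)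
  moreover have "\<Delta> x - q \<in> p.span (tensor2_rel scale)"
  proof (rule vsp.tensor2_relI_forms)
    fix f g assume fg: "vsp.linear_form f" "vsp.linear_form g"
    note F = lin_ext_linear[OF vector_space_times, of "\<lambda>(a, b). f a * g b"]
    have "lin_ext (*) (\<lambda>(a, b). f a * g b) q = H.conv f g x"
      unfolding q_def linmap_lin_ext[OF F] eq[OF fg] by (simp add: case_prod_unfold)
    then show "lin_ext (*) (\<lambda>(a, b). f a * g b) (\<Delta> x - q) = 0"
      using sw_Delta[OF bilin_form_mult[OF fg], of x] by (simp add: linmap_diff[OF F] H.conv_def)
  qed
  moreover have "\<Delta> x = q + (\<Delta> x - q)" by simp
  ultimately show ?thesis
    using sub p.subspace_add[of "tensor2_sub scale A"] by (metis (no_types, lifting) p.subspace_span subsetD tensor2_sub_def)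
qed

lemma subcoalgebra_iff: "subcoalgebra scale \<Delta> C \<longleftrightarrow> H.subco C"
proof
  assume C: "subcoalgebra scale \<Delta> C"
  hence sC: "subspace C" and D: "\<And>c. c \<in> C \<Longrightarrow> \<Delta> c \<in> tensor2_sub scale (C \<times> C)" by (auto simp: subcoalgebra_def)
  show "H.subco C"
  proof (rule H.subcoI[OF sC])
    fix f c assume f: "vsp.linear_form f" and c: "c \<in> C"
    have b: "vsp.bilin scale (\<lambda>u v. scale (f v) u)" "vsp.bilin scale (\<lambda>u v. scale (f u) v)"
      by (rule vsp.bilinI; intro H.lin_intros f)+
    show "H.la f c \<in> C" "H.ra f c \<in> C"
      unfolding H.la_def H.ra_def sw_Delta[OF b(1)] sw_Delta[OF b(2)]
      by (rule vsp.lin_ext_tensor2_sub[OF vector_space_axioms _ sC _ D[OF c]]; use b subspace_scale[OF sC] in auto)+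
  qed
next
  assume C: "H.subco C"
  note sC = H.subco_subspace[OF C]
  interpret p: vspace "pscale :: 'k \<Rightarrow> ('h \<times> 'h \<Rightarrow>\<^sub>0 'k) \<Rightarrow> _" by (rule vspace_pscale)
  obtain P where P: "vsp.linear_op P" "\<And>x. P x \<in> C" "\<And>x. x \<in> C \<Longrightarrow> P x = x"
    using vsp.projection_exists[OF sC] by blast
  have "\<Delta> c \<in> tensor2_sub scale (C \<times> C)" if c: "c \<in> C" for c
  proof (rule Delta_in_tensor2_subI)
    show "gen (P a, P b) \<in> p.span (gen ` (C \<times> C))" for a b
      using P(2) by (intro p.span_base) auto
    fix f g assume fg: "vsp.linear_form f" "vsp.linear_form g"
    note b = bilin_form_mult[OF fg] bilin_form_mult[OF linmap_compose[OF fg(1) P(1)] linmap_compose[OF fg(2) P(1)]]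
    have "H.conv f g c = H.sw (\<lambda>u v. f (P u) * g (P v)) c"
      unfolding H.conv_def by (rule H.sw_cong_subco[OF vector_space_times b C c]) (simp add: P(3))
    then show "H.conv f g c = lin_ext (*) (\<lambda>(a, b). lin_ext (*) (\<lambda>(a, b). f a * g b) (gen (P a, P b))) (\<Delta> c)"
      by (simp add: sw_Delta[OF b(2)] vector_space_times)
  qed
  with sC show "subcoalgebra scale \<Delta> C" by (simp add: subcoalgebra_def)
qed

lemma simple_subcoalgebra_iff: "simple_subcoalgebra scale \<Delta> C \<longleftrightarrow> H.simple C"
  by (simp add: simple_subcoalgebra_def H.simple_def subcoalgebra_iff)

lemma coradical_eq: "coradical scale \<Delta> = H.corad"
  by (simp add: coradical_def H.corad_def simple_subcoalgebra_iff)

section \<open>Comparison of wedges, links and components\<close>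

lemma wedge_subset_cwedge: "wedge scale \<Delta> L X Y \<subseteq> H.cwedge X Y"
proof
  fix h assume "h \<in> wedge scale \<Delta> L X Y"
  hence D: "\<Delta> h \<in> tensor2_sub scale (X \<times> L \<union> L \<times> Y)" by (simp add: wedge_def)
  interpret k: vspace "(*) :: 'k \<Rightarrow> 'k \<Rightarrow> 'k" using vector_space_times by (simp add: vspace_def)
  show "h \<in> H.cwedge X Y"
    unfolding H.cwedge_def
  proof (intro CollectI ballI)
    fix f g assume f: "f \<in> vsp.ann X" and g: "g \<in> vsp.ann Y"
    note b = bilin_form_mult[OF vsp.ann_linear[OF f] vsp.ann_linear[OF g]]
    have "lin_ext (*) (\<lambda>(a, b). f a * g b) (\<Delta> h) \<in> {0}"
      by (rule vsp.lin_ext_tensor2_sub[OF vector_space_times b k.subspace_single_0 _ D])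
        (auto simp: vsp.annD[OF f] vsp.annD[OF g])
    then show "H.conv f g h = 0" by (simp add: H.conv_def sw_Delta[OF b])
  qed
qed

lemma cwedge_subset_wedge:
  assumes L: "H.subco L" and X: "subspace X" "X \<subseteq> L" and Y: "subspace Y" "Y \<subseteq> L"
    and h: "h \<in> L" "h \<in> H.cwedge X Y"
  shows "h \<in> wedge scale \<Delta> L X Y"
proof -
  interpret p: vspace "pscale :: 'k \<Rightarrow> ('h \<times> 'h \<Rightarrow>\<^sub>0 'k) \<Rightarrow> _" by (rule vspace_pscale)
  note sL = H.subco_subspace[OF L]
  obtain P where P: "vsp.linear_op P" "\<And>x. P x \<in> X" "\<And>x. x \<in> X \<Longrightarrow> P x = x"
    using vsp.projection_exists[OF X(1)] by blast
  obtain Q where Q: "vsp.linear_op Q" "\<And>x. Q x \<in> Y" "\<And>x. x \<in> Y \<Longrightarrow> Q x = x"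
    using vsp.projection_exists[OF Y(1)] by blast
  obtain R where R: "vsp.linear_op R" "\<And>x. R x \<in> L" "\<And>x. x \<in> L \<Longrightarrow> R x = x"
    using vsp.projection_exists[OF sL] by blast
  \<comment> \<open>R brings both factors into L, then P and Q split them as in
    \<open>sw_in_cwedge\<close>; the omitted term is the one the wedge condition kills.\<close>
  let ?T = "\<lambda>a b. gen (P (R a), R b) + gen (R a - P (R a), Q (R b))"
  have "\<Delta> h \<in> tensor2_sub scale (X \<times> L \<union> L \<times> Y)"
  proof (rule Delta_in_tensor2_subI)
    show "?T a b \<in> p.span (gen ` (X \<times> L \<union> L \<times> Y))" for a b
    proof (intro p.span_add p.span_base imageI)
      show "(P (R a), R b) \<in> X \<times> L \<union> L \<times> Y" using P R by simp
      have "R a - P (R a) \<in> L" using R(2)[of a] P(2)[of "R a"] X(2) by (intro subspace_diff[OF sL]) auto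
      then show "(R a - P (R a), Q (R b)) \<in> X \<times> L \<union> L \<times> Y" using Q by simp
    qed
    fix f g assume fg: "vsp.linear_form f" "vsp.linear_form g"
    note lin = linmap_compose[OF fg(1)] linmap_compose[OF fg(2)] linmap_compose[OF P(1)] linmap_compose[OF Q(1)]
      linmap_compose[OF R(1)] H.lin_intros
    have b: "vsp.bilin (*) (\<lambda>u v. f (P (R u)) * g (R v) + f (R u - P (R u)) * g (Q (R v)))"
      "vsp.bilin (*) (\<lambda>u v. f u * g v)" "vsp.bilin (*) (\<lambda>u v. f (P u) * g v + f (u - P u) * g (Q v))"
      by (rule vsp.bilinI; intro lin)+
    have ann: "(\<lambda>u. f (u - P u)) \<in> vsp.ann X" "(\<lambda>v. g (v - Q v)) \<in> vsp.ann Y"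
      by (rule vsp.annI, intro lin, simp add: P(3) linmap_0[OF fg(1)])
        (rule vsp.annI, intro lin, simp add: Q(3) linmap_0[OF fg(2)])
    have "H.conv (\<lambda>u. f (u - P u)) (\<lambda>v. g (v - Q v)) h = 0"
      using H.cwedgeD[OF h(2) ann] .
    hence "H.sw (\<lambda>u v. f u * g v - (f (P u) * g v + f (u - P u) * g (Q v))) h = 0"
      unfolding H.conv_def by (simp add: linmap_diff[OF fg(1)] linmap_diff[OF fg(2)] algebra_simps)
    hence "H.conv f g h = H.sw (\<lambda>u v. f (P u) * g v + f (u - P u) * g (Q v)) h"
      unfolding H.sw_diff by (simp add: H.conv_def)
    also have "\<dots> = H.sw (\<lambda>u v. f (P (R u)) * g (R v) + f (R u - P (R u)) * g (Q (R v))) h"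
      by (rule H.sw_cong_subco[OF vector_space_times b(3,1) L h(1)]) (simp add: R(3))
    also have "\<dots> = lin_ext (*) (\<lambda>(a, b). lin_ext (*) (\<lambda>(a, b). f a * g b) (?T a b)) (\<Delta> h)"
      by (simp add: sw_Delta[OF b(1)] linmap_add[OF lin_ext_linear[OF vector_space_times]] vector_space_times)
    finally show "H.conv f g h = lin_ext (*) (\<lambda>(a, b). lin_ext (*) (\<lambda>(a, b). f a * g b) (?T a b)) (\<Delta> h)" .
  qed
  with h(1) show ?thesis by (simp add: wedge_def)
qed

lemma hopf_dual_chevalley:
  assumes "dual_Chevalley scale \<Delta> S"
  shows "hopf_dual_chevalley scale cop \<epsilon> (*) 1 S"
  using assms by unfold_locales (simp_all add: dual_Chevalley_def hopf_subalgebra_def coradical_eq)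

lemma directly_linked_imp_clinked:
  assumes C: "H.simple C" and D: "H.simple D" and link: "directly_linked scale \<Delta> L C D"
  shows "H.clinked C D"
proof (rule ccontr)
  assume "\<not> H.clinked C D"
  hence cor: "H.cwedge C D \<subseteq> H.corad" "H.cwedge D C \<subseteq> H.corad" by (auto simp: H.clinked_def)
  have sum: "subspace (subspace_sum C D)"
    unfolding subspace_sum_def using H.simple_subspace[OF C] H.simple_subspace[OF D] by (rule subspace_sums)
  have 1: "x \<in> subspace_sum C D" if x: "x \<in> wedge scale \<Delta> L C D" for x
  proof -
    obtain c d where "c \<in> C" "d \<in> D" "x = c + d"
      using H.cwedge_Int_corad[OF C D, of x] cor(1) wedge_subset_cwedge x by blast
    then show ?thesis unfolding subspace_sum_def by auto
  qed
  have 2: "x \<in> subspace_sum C D" if x: "x \<in> wedge scale \<Delta> L D C" for x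
  proof -
    obtain d c where "d \<in> D" "c \<in> C" "x = d + c"
      using H.cwedge_Int_corad[OF D C, of x] cor(2) wedge_subset_cwedge x by blast
    then show ?thesis unfolding subspace_sum_def by (auto simp: add.commute)
  qed
  have "subspace_sum (wedge scale \<Delta> L C D) (wedge scale \<Delta> L D C) \<subseteq> subspace_sum C D"
    unfolding subspace_sum_def[of "wedge scale \<Delta> L C D"] using 1 2 subspace_add[OF sum] by auto
  with link show False by (auto simp: directly_linked_def)
qed

text \<open>Once L contains the full wedges, these agree with the wedges formed in L, and an element
  outside the coradical is not in C + D.\<close>

lemma clinked_imp_directly_linked:
  assumes C: "H.simple C" and D: "H.simple D" and L: "H.subco L"
    and sub: "H.cwedge C D \<subseteq> L" "H.cwedge D C \<subseteq> L" and link: "H.clinked C D"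
  shows "directly_linked scale \<Delta> L C D"
proof -
  note sC = H.simple_subco[OF C] and sD = H.simple_subco[OF D]
  have CL: "C \<subseteq> L" "D \<subseteq> L" using H.subset_cwedge_left[OF sC] H.subset_cwedge_right[OF sD] sub(1) by blast+
  have W: "H.cwedge C D \<subseteq> wedge scale \<Delta> L C D" "H.cwedge D C \<subseteq> wedge scale \<Delta> L D C"
    using cwedge_subset_wedge[OF L] H.simple_subspace C D CL sub by blast+
  let ?S = "subspace_sum (wedge scale \<Delta> L C D) (wedge scale \<Delta> L D C)"
  have zero: "0 \<in> H.cwedge C D" "0 \<in> H.cwedge D C"
    using subspace_0[OF H.subco_subspace[OF H.subco_cwedge]] sC sD by blast+
  have "subspace_sum C D \<subseteq> ?S"
    unfolding subspace_sum_def using W H.subset_cwedge_left[OF sC, of D] H.subset_cwedge_left[OF sD, of C] by blast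
  moreover have "\<exists>x\<in>?S. x \<notin> subspace_sum C D"
  proof -
    have "subspace_sum C D \<subseteq> H.corad"
      unfolding subspace_sum_def using H.simple_corad[OF C] H.simple_corad[OF D]
        subspace_add[OF H.subco_subspace[OF H.subco_corad]] by blast
    moreover have "\<exists>x\<in>?S. x \<notin> H.corad"
    proof -
      from link obtain x where x: "x \<in> H.cwedge C D \<or> x \<in> H.cwedge D C" "x \<notin> H.corad"
        by (auto simp: H.clinked_def)
      have "x \<in> ?S"
        using x(1)
      proof
        assume "x \<in> H.cwedge C D"
        with W zero have "x \<in> wedge scale \<Delta> L C D" "0 \<in> wedge scale \<Delta> L D C" by blast+
        then show ?thesis unfolding subspace_sum_def by force
      next
        assume "x \<in> H.cwedge D C"
        with W zero have "x \<in> wedge scale \<Delta> L D C" "0 \<in> wedge scale \<Delta> L C D" by blast+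
        then show ?thesis unfolding subspace_sum_def by force
      qed
      with x(2) show ?thesis by blast
    qed
    ultimately show ?thesis by blast
  qed
  ultimately show ?thesis unfolding directly_linked_def by blast
qed

lemma linked_refl: "H.simple C \<Longrightarrow> C \<subseteq> L \<Longrightarrow> linked scale \<Delta> L C C"
  unfolding linked_def by (intro exI[of _ 0] exI[of _ "\<lambda>_. C"]) (simp add: simple_subcoalgebra_iff)

lemma linked_step:
  assumes "linked scale \<Delta> L C D" "directly_linked scale \<Delta> L D D'" "H.simple D'" "D' \<subseteq> L"
  shows "linked scale \<Delta> L C D'"
proof -
  from assms(1) obtain n E where E: "E 0 = C" "E n = D"
    "\<And>i. i \<le> n \<Longrightarrow> H.simple (E i) \<and> E i \<subseteq> L" "\<And>i. i < n \<Longrightarrow> directly_linked scale \<Delta> L (E i) (E (Suc i))"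
    by (auto simp: linked_def simple_subcoalgebra_iff)
  show ?thesis
    unfolding linked_def simple_subcoalgebra_iff
  proof (intro exI[of _ "Suc n"] exI[of _ "E(Suc n := D')"] conjI allI impI)
    fix i assume "i < Suc n"
    then show "directly_linked scale \<Delta> L ((E(Suc n := D')) i) ((E(Suc n := D')) (Suc i))"
      using E assms(2) by (cases "i = n") auto
  qed (use E assms(3,4) in \<open>auto simp: le_Suc_eq\<close>)
qed

lemma linked_imp_link_class:
  assumes "linked scale \<Delta> L C D"
  shows "D \<in> H.link_class C"
proof -
  from assms obtain n E where E: "E 0 = C" "E n = D"
    "\<And>i. i \<le> n \<Longrightarrow> H.simple (E i)" "\<And>i. i < n \<Longrightarrow> directly_linked scale \<Delta> L (E i) (E (Suc i))"
    by (auto simp: linked_def simple_subcoalgebra_iff)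
  have "E i \<in> H.link_class C" if "i \<le> n" for i
    using that
  proof (induction i)
    case 0
    then show ?case by (simp add: E(1))
  next
    case (Suc i)
    then have *: "H.simple (E i)" "H.simple (E (Suc i))" "E i \<in> H.link_class C" using E(3) by auto
    moreover have "H.clinked (E i) (E (Suc i))"
      by (rule directly_linked_imp_clinked[OF *(1,2) E(4)]) (use Suc.prems in simp)
    ultimately show ?case
      using H.saturated_link_class[of C] by (auto simp: H.saturated_def)
  qed
  with E(2) show ?thesis by auto
qed

lemma part_link_indecomposable:
  "link_indecomposable scale \<Delta> (H.part (H.link_class C))"
  unfolding link_indecomposable_def
proof (intro conjI allI impI)
  let ?K = "H.part (H.link_class C)"
  show "subcoalgebra scale \<Delta> ?K" by (simp add: subcoalgebra_iff H.subco_part)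
  fix D E assume "simple_subcoalgebra scale \<Delta> D \<and> D \<subseteq> ?K \<and> simple_subcoalgebra scale \<Delta> E \<and> E \<subseteq> ?K"
  hence D: "H.simple D" "D \<in> H.link_class C" and E: "H.simple E" "E \<in> H.link_class C"
    using H.simple_part by (auto simp: simple_subcoalgebra_iff)
  have "E \<in> H.link_class D" using H.link_class_trans[OF H.link_class_sym[OF D(2)] E(2)] .
  then show "linked scale \<Delta> ?K D E"
    unfolding H.link_class_def[of D] mem_Collect_eq
  proof (induction rule: rtranclp_induct)
    case base
    show ?case using D H.simple_part by (intro linked_refl) auto
  next
    case (step X Y)
    hence XY: "H.simple X" "H.simple Y" "H.clinked X Y" by auto
    have X: "X \<in> H.link_class C"
      using H.link_class_trans[OF D(2)] step(1) by (simp add: H.link_class_def)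
    have Y: "Y \<in> H.link_class C" using H.saturated_link_class[of C] XY X by (auto simp: H.saturated_def)
    \<comment> \<open>The simple subcoalgebras of the wedge are A and B only, so the wedge stays in
      the part and links in H are links in the part.\<close>
    have "H.cwedge A B \<subseteq> ?K"
      if "H.simple A" "H.simple B" "A \<in> H.link_class C" "B \<in> H.link_class C" for A B
    proof (rule H.subco_subset_part[OF H.subco_cwedge])
      fix Z assume "H.simple Z" "Z \<subseteq> H.cwedge A B"
      then show "Z \<in> H.link_class C" using H.simple_in_cwedge that by blast
    qed (use that H.simple_subco in auto)
    hence "directly_linked scale \<Delta> ?K X Y"
      using XY X Y by (intro clinked_imp_directly_linked H.subco_part) auto
    then show ?case using linked_step[OF step.IH _ XY(2)] H.simple_part[OF XY(2)] Y by blast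
  qed
qed

text \<open>K is the largest link-indecomposable subcoalgebra containing the unit: the simple ones
  of any other are linked to the span of 1. So the definite description is well defined.\<close>

lemma unit_component_eq:
  assumes "dual_Chevalley scale \<Delta> S"
  shows "unit_component scale \<Delta> = hopf_dual_chevalley.K scale cop 1"
proof -
  interpret D: hopf_dual_chevalley scale cop \<epsilon> "(*)" 1 S by (rule hopf_dual_chevalley[OF assms])
  have ind: "link_indecomposable scale \<Delta> D.K" unfolding D.K_def by (rule part_link_indecomposable)
  have max: "L \<subseteq> D.K" if L: "link_indecomposable scale \<Delta> L" "1 \<in> L" for L
    unfolding D.K_def
  proof (rule H.subco_subset_part)
    show sL: "H.subco L" using L(1) by (simp add: link_indecomposable_def subcoalgebra_iff)
    have "span {1} \<subseteq> L" using L(2) H.subco_subspace[OF sL] by (intro span_minimal) auto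
    fix C assume "H.simple C" "C \<subseteq> L"
    with L(1) \<open>span {1} \<subseteq> L\<close> D.simple_one have "linked scale \<Delta> L (span {1}) C"
      by (auto simp: link_indecomposable_def simple_subcoalgebra_iff)
    then show "C \<in> H.link_class (span {1})" by (rule linked_imp_link_class)
  qed
  show ?thesis
    unfolding unit_component_def
  proof (rule the_equality)
    show "link_component scale \<Delta> D.K \<and> 1 \<in> D.K"
      unfolding link_component_def using ind D.one_K max by blast
    fix L assume "link_component scale \<Delta> L \<and> 1 \<in> L"
    then show "L = D.K" unfolding link_component_def using ind max by blast
  qed
qed

end

text \<open>Stated for an arbitrary product, to be used for H and for its opposite.\<close>

lemma projective_generator_K:
  fixes mul :: "'h::ring_1 \<Rightarrow> 'h \<Rightarrow> 'h" and scale :: "'k::field \<Rightarrow> 'h \<Rightarrow> 'h"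
  assumes D: "hopf_dual_chevalley scale cop \<epsilon> mul 1 S"
    and M: "module_over (hopf_dual_chevalley.K scale cop 1) mul mul (UNIV :: 'h set)"
  shows "projective_generator (TM :: 'm::ab_group_add itself) (TN :: 'n::ab_group_add itself)
    (hopf_dual_chevalley.K scale cop 1) mul mul (UNIV :: 'h set)"
proof -
  interpret D: hopf_dual_chevalley scale cop \<epsilon> mul 1 S by (rule D)
  obtain I :: "('h set \<times> nat) set" and f v where
    fv: "(\<forall>i\<in>I. (\<forall>x y. f i (x + y) = f i x + f i y) \<and> (\<forall>x. f i x \<in> D.K) \<and>
        (\<forall>k\<in>D.K. \<forall>x. f i (mul k x) = mul k (f i x))) \<and>
      (\<forall>x. finite {i \<in> I. f i x \<noteq> 0} \<and> (\<Sum>i\<in>{i \<in> I. f i x \<noteq> 0}. mul (f i x) (v i)) = x)"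
    using D.dual_basis by (elim exE) (rule that)
  have "projective_module TM TN D.K mul mul (UNIV :: 'h set)"
    by (rule projective_module_if_dual_basis[OF M, of I f v]) (use fv in simp_all)
  moreover have "generator_module TM TN D.K mul mul (UNIV :: 'h set)"
    by (rule generator_module_if_retraction[OF M, of D.proj 1])
      (simp_all add: D.proj_in D.proj_mul_left D.proj_id D.one_K linmap_add[OF D.proj_linear])
  ultimately show ?thesis by (simp add: projective_generator_def)
qed

theorem corollary1p3:
  fixes scale :: "'k::field \<Rightarrow> 'h::ring_1 \<Rightarrow> 'h"
    and \<Delta> :: "'h \<Rightarrow> ('h \<times> 'h \<Rightarrow>\<^sub>0 'k)"
    and \<epsilon> :: "'h \<Rightarrow> 'k"
    and S :: "'h \<Rightarrow> 'h"
  assumes "hopf_algebra scale \<Delta> \<epsilon> S"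
    and "dual_Chevalley scale \<Delta> S"
  shows "projective_generator TYPE('m::ab_group_add) TYPE('n::ab_group_add)
           (unit_component scale \<Delta>) (\<lambda>a b. a * b) (\<lambda>a h. a * h) (UNIV :: 'h set)
       \<and> projective_generator TYPE('m) TYPE('n)
           (unit_component scale \<Delta>) (\<lambda>a b. b * a) (\<lambda>a h. h * a) (UNIV :: 'h set)"
proof -
  interpret hopf_algebra scale \<Delta> \<epsilon> S by (rule assms(1))
  interpret D: hopf_dual_chevalley scale cop \<epsilon> "(*)" 1 S by (rule hopf_dual_chevalley[OF assms(2)])
  have K: "unit_component scale \<Delta> = D.K" by (rule unit_component_eq[OF assms(2)])
  \<comment> \<open>Right modules are left modules for the Hopf algebra with product and coproduct
    reversed, whose unit component is the same.\<close>
  have K': "hopf_dual_chevalley.K scale (\<lambda>x. map prod.swap (cop x)) 1 = D.K" by (rule D.K_op_cop)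
  have sub: "unital_subring D.K"
    unfolding unital_subring_def
    using D.one_K D.K_mul subspace_diff[OF H.subco_subspace[OF D.subco_K]] by blast
  have "module_over D.K (*) (*) (UNIV :: 'h set)" "module_over D.K (\<lambda>a b. b * a) (\<lambda>a h. h * a) (UNIV :: 'h set)"
    using sub by (simp_all add: module_over_def algebra_simps)
  with projective_generator_K[OF D.hopf_dual_chevalley_axioms]
    projective_generator_K[OF D.op_cop, unfolded K']
  show ?thesis unfolding K by blast
qed

end
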